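(* Let $b$ be a non-extreme point of the closed unit ball of $H^\infty$ and let $\varphi\in H^\infty$. Then the operator $T_{\overline{\varphi}}:\mathcal H(b)\to\mathcal H(b)$, $f\mapsto P_+(\overline{\varphi}f)$, is hypercyclic if and only if $\varphi$ is non-constant and $\varphi(\mathbb D)\cap\mathbb T\neq\emptyset$.
   Context: $\mathbb D$ is the open unit disc, $\mathbb T=\partial\mathbb D$ with normalized Lebesgue measure $m$, $H^2$ is the Hardy space of $\mathbb D$ (identified via boundary values with a closed subspace of $L^2(\mathbb T)=L^2(\mathbb T,m)$), and $H^\infty$ is the algebra of bounded analytic functions on $\mathbb D$ with the supremum norm. $P_+:L^2(\mathbb T)\to H^2$ is the orthogonal projection. For $b$ in the closed unit ball of $H^\infty$, the de Branges-Rovnyak space $\mathcal H(b)$ is the Hilbert space of analytic functions on $\mathbb D$ with reproducing kernel $k_\lambda^b(z)=\frac{1-\overline{b(\lambda)}b(z)}{1-\overline{\lambda}z}$, $\lambda,z\in\mathbb D$; it is contractively contained in $H^2$. "Non-extreme" means that $b$ is not an extreme point of the closed unit ball of $H^\infty$; equivalently $\log(1-|b|)\in L^1(\mathbb T)$. For $\varphi\in H^\infty$, the Toeplitz operator $T_{\overline\varphi}f=P_+(\overline\varphi f)$ on $H^2$ maps $\mathcal H(b)$ into itself and is bounded on $\mathcal H(b)$ with norm at most $\|\varphi\|_\infty$. A bounded operator $T$ on a complex separable Banach space $X$ is hypercyclic if there is $x\in X$ whose orbit $\{T^n x: n\in\mathbb N\}$ is dense in $X$. *)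

theory Defs
  imports "HOL-Analysis.Analysis"
begin

text \<open>
  A function on the open unit disc \<open>ball 0 1\<close> is represented by its extension by \<open>0\<close> to the
  whole plane. Two such functions are then equal in HOL iff they agree on the disc, and the
  function spaces below are complex vector spaces under pointwise operations.
\<close>

definition hol_disc :: "(complex \<Rightarrow> complex) set" where
  "hol_disc = {f. f holomorphic_on ball 0 1 \<and> (\<forall>z. z \<notin> ball 0 1 \<longrightarrow> f z = 0)}"


subsection \<open>The algebra of bounded analytic functions\<close>

definition Hinf :: "(complex \<Rightarrow> complex) set" where
  "Hinf = {f \<in> hol_disc. bounded (f ` ball 0 1)}"

definition Hinf_norm :: "(complex \<Rightarrow> complex) \<Rightarrow> real" where
  "Hinf_norm f = (SUP z\<in>ball 0 1. norm (f z))"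

definition Hinf_ball :: "(complex \<Rightarrow> complex) set" where
  "Hinf_ball = {f \<in> Hinf. Hinf_norm f \<le> 1}"

text \<open>
  This is \<^const>\<open>extreme_point_of\<close> with \<^const>\<open>open_segment\<close> unfolded; the library constant is not
  applicable because the function type is not an instance of \<^class>\<open>real_vector\<close>.
\<close>

definition extreme_function_of ::
    "(complex \<Rightarrow> complex) \<Rightarrow> (complex \<Rightarrow> complex) set \<Rightarrow> bool" where
  "extreme_function_of b S \<longleftrightarrow> b \<in> S \<and>
     \<not> (\<exists>f\<in>S. \<exists>g\<in>S. f \<noteq> g \<and>
          (\<exists>t::real. 0 < t \<and> t < 1 \<and>
             b = (\<lambda>z. of_real (1 - t) * f z + of_real t * g z)))"


subsection \<open>The Hardy space and the Riesz projection\<close>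

text \<open>Normalized Lebesgue measure on the unit circle, as a Borel measure on the plane.\<close>

definition circle_measure :: "complex measure" where
  "circle_measure = distr (uniform_measure lborel {0..<2 * pi}) borel cis"

definition H2 :: "(complex \<Rightarrow> complex) set" where
  "H2 = {f \<in> hol_disc.
     bdd_above ((\<lambda>r. \<integral>\<zeta>. (norm (f (of_real r * \<zeta>)))\<^sup>2 \<partial>circle_measure) ` {0..<1::real})}"

text \<open>
  The radial limit. For \<open>f\<close> in \<^const>\<open>H2\<close> it exists almost everywhere on the circle
  (Fatou); elsewhere the value is an irrelevant default.
\<close>

definition boundary_value :: "(complex \<Rightarrow> complex) \<Rightarrow> complex \<Rightarrow> complex" where
  "boundary_value f \<zeta> = Lim (at_left 1) (\<lambda>r::real. f (of_real r * \<zeta>))"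

text \<open>
  The orthogonal projection of \<open>L\<^sup>2\<close> of the circle onto \<^const>\<open>H2\<close>, the latter being embedded by
  boundary values: the unique \<open>h\<close> in \<^const>\<open>H2\<close> such that \<open>g - boundary_value h\<close> is orthogonal
  to \<^const>\<open>H2\<close>.
\<close>

definition P_plus :: "(complex \<Rightarrow> complex) \<Rightarrow> complex \<Rightarrow> complex" where
  "P_plus g = (THE h. h \<in> H2 \<and>
     (\<forall>u\<in>H2. (\<integral>\<zeta>. (g \<zeta> - boundary_value h \<zeta>) * cnj (boundary_value u \<zeta>) \<partial>circle_measure) = 0))"

definition toeplitz_cnj ::
    "(complex \<Rightarrow> complex) \<Rightarrow> (complex \<Rightarrow> complex) \<Rightarrow> complex \<Rightarrow> complex" where
  "toeplitz_cnj \<phi> f = P_plus (\<lambda>\<zeta>. cnj (boundary_value \<phi> \<zeta>) * boundary_value f \<zeta>)"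


subsection \<open>Hilbert spaces of analytic functions with a reproducing kernel\<close>

definition ip_norm ::
    "((complex \<Rightarrow> complex) \<Rightarrow> (complex \<Rightarrow> complex) \<Rightarrow> complex) \<Rightarrow> (complex \<Rightarrow> complex) \<Rightarrow> real" where
  "ip_norm ip f = sqrt (Re (ip f f))"

definition analytic_hilbert_space ::
    "(complex \<Rightarrow> complex) set \<Rightarrow>
     ((complex \<Rightarrow> complex) \<Rightarrow> (complex \<Rightarrow> complex) \<Rightarrow> complex) \<Rightarrow> bool" where
  "analytic_hilbert_space H ip \<longleftrightarrow>
     H \<subseteq> hol_disc \<and>
     (\<lambda>z. 0) \<in> H \<and>
     (\<forall>f\<in>H. \<forall>g\<in>H. (\<lambda>z. f z + g z) \<in> H) \<and>
     (\<forall>c. \<forall>f\<in>H. (\<lambda>z. c * f z) \<in> H) \<and>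
     (\<forall>f\<in>H. \<forall>g\<in>H. \<forall>h\<in>H. ip (\<lambda>z. f z + g z) h = ip f h + ip g h) \<and>
     (\<forall>c. \<forall>f\<in>H. \<forall>g\<in>H. ip (\<lambda>z. c * f z) g = c * ip f g) \<and>
     (\<forall>f\<in>H. \<forall>g\<in>H. ip g f = cnj (ip f g)) \<and>
     (\<forall>f\<in>H. 0 \<le> Re (ip f f)) \<and>
     (\<forall>f\<in>H. ip f f = 0 \<longrightarrow> f = (\<lambda>z. 0)) \<and>
     (\<forall>X :: nat \<Rightarrow> complex \<Rightarrow> complex.
        (\<forall>n. X n \<in> H) \<and>
        (\<forall>e>0. \<exists>N. \<forall>m\<ge>N. \<forall>n\<ge>N. ip_norm ip (\<lambda>z. X m z - X n z) < e) \<longrightarrow>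
        (\<exists>f\<in>H. (\<lambda>n. ip_norm ip (\<lambda>z. X n z - f z)) \<longlonglongrightarrow> 0))"

definition has_reproducing_kernel ::
    "(complex \<Rightarrow> complex) set \<Rightarrow>
     ((complex \<Rightarrow> complex) \<Rightarrow> (complex \<Rightarrow> complex) \<Rightarrow> complex) \<Rightarrow>
     (complex \<Rightarrow> complex \<Rightarrow> complex) \<Rightarrow> bool" where
  "has_reproducing_kernel H ip K \<longleftrightarrow>
     (\<forall>l\<in>ball 0 1. K l \<in> H \<and> (\<forall>f\<in>H. ip f (K l) = f l))"

definition dBR_kernel :: "(complex \<Rightarrow> complex) \<Rightarrow> complex \<Rightarrow> complex \<Rightarrow> complex" where
  "dBR_kernel b l z =
     (if z \<in> ball 0 1 then (1 - cnj (b l) * b z) / (1 - cnj l * z) else 0)"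

text \<open>
  \<open>H\<close> with the inner product \<open>ip\<close> is the de Branges-Rovnyak space of \<open>b\<close>. By the Moore-Aronszajn
  theorem this determines \<open>H\<close>, and \<open>ip\<close> on \<open>H\<close>, uniquely, and for \<open>b\<close> in \<^const>\<open>Hinf_ball\<close> such a
  space exists.
\<close>

definition de_Branges_Rovnyak_space ::
    "(complex \<Rightarrow> complex) \<Rightarrow> (complex \<Rightarrow> complex) set \<Rightarrow>
     ((complex \<Rightarrow> complex) \<Rightarrow> (complex \<Rightarrow> complex) \<Rightarrow> complex) \<Rightarrow> bool" where
  "de_Branges_Rovnyak_space b H ip \<longleftrightarrow>
     analytic_hilbert_space H ip \<and> has_reproducing_kernel H ip (dBR_kernel b)"


subsection \<open>Hypercyclicity\<close>

definition bounded_operator_on ::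
    "(complex \<Rightarrow> complex) set \<Rightarrow> ((complex \<Rightarrow> complex) \<Rightarrow> real) \<Rightarrow>
     ((complex \<Rightarrow> complex) \<Rightarrow> complex \<Rightarrow> complex) \<Rightarrow> bool" where
  "bounded_operator_on H nrm T \<longleftrightarrow>
     (\<forall>f\<in>H. T f \<in> H) \<and>
     (\<forall>f\<in>H. \<forall>g\<in>H. T (\<lambda>z. f z + g z) = (\<lambda>z. T f z + T g z)) \<and>
     (\<forall>c. \<forall>f\<in>H. T (\<lambda>z. c * f z) = (\<lambda>z. c * T f z)) \<and>
     (\<exists>C. \<forall>f\<in>H. nrm (T f) \<le> C * nrm f)"

definition hypercyclic_on ::
    "(complex \<Rightarrow> complex) set \<Rightarrow> ((complex \<Rightarrow> complex) \<Rightarrow> real) \<Rightarrow>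
     ((complex \<Rightarrow> complex) \<Rightarrow> complex \<Rightarrow> complex) \<Rightarrow> bool" where
  "hypercyclic_on H nrm T \<longleftrightarrow> bounded_operator_on H nrm T \<and>
     (\<exists>x\<in>H. \<forall>y\<in>H. \<forall>e>0. \<exists>n::nat. nrm (\<lambda>z. (T ^^ n) x z - y z) < e)"

end

theory Submission
  imports Defs "HOL-Complex_Analysis.Complex_Analysis"
begin

text \<open>
  Write \<open>k\<^sub>l\<close> for the Szego kernel at \<open>l\<close>. The co-analytic Toeplitz operator \<open>T\<close> with symbol
  \<open>\<phi>\<close> is the adjoint of multiplication by \<open>\<phi>\<close> on the Hardy space, hence
  \<open>T k\<^sub>l = cnj (\<phi> l) k\<^sub>l\<close>. If \<open>\<phi>\<close> is not constant and takes a unimodular value, the image of the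
  disc under \<open>\<phi>\<close> is open and therefore has points on both sides of the circle. The kernels with
  \<open>\<bar>\<phi> l\<bar> < 1\<close> are driven to \<open>0\<close> by the powers of \<open>T\<close>, those with \<open>\<bar>\<phi> l\<bar> > 1\<close> have preimages
  under the powers of \<open>T\<close> that tend to \<open>0\<close>, and a hypercyclicity criterion
  (\<open>hypercyclicity_criterion\<close>) applies as soon as the kernels over any open set span a dense
  subspace of \<open>\<H>(b)\<close>. Conversely, if the condition on \<open>\<phi>\<close> fails, connectedness of the disc gives
  \<open>\<bar>\<phi>\<bar> \<le> 1\<close> throughout or \<open>\<bar>\<phi>\<bar> \<ge> 1\<close> throughout. Then \<open>T\<close>, or its inverse with symbol
  \<open>1 / \<phi>\<close>, is a contraction of \<open>\<H>(b)\<close>, and orbits are bounded, or bounded away from \<open>0\<close>.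

  Three facts carry this argument.

  The Riesz projection is defined through radial limits, so Fatou's theorem is needed before \<open>T\<close>
  can be identified with an adjoint. It is proved for the Hardy space only, from a weak-type bound
  for the radial maximal function (\<open>radial_maximal\<close>): Poisson means are dominated by centred
  averages, and these are controlled by a Vitali covering. The outcome is
  \<open>toeplitz_cnj_eq_toep\<close>; from there on only Taylor coefficients and integral means over circles of
  radius below \<open>1\<close> occur.

  The space \<open>\<H>(b)\<close> is given by its kernel alone. With \<open>S\<close> the co-analytic Toeplitz operator of
  symbol \<open>b\<close>, a function \<open>f\<close> of the Hardy space belongs to \<open>\<H>(b)\<close> with norm at most \<open>C\<close> if
  \<open>\<bar>\<langle>f, u\<rangle>\<bar>\<^sup>2 \<le> C\<^sup>2 (\<parallel>u\<parallel>\<^sup>2 - \<parallel>S u\<parallel>\<^sup>2)\<close> for all \<open>u\<close> (\<open>membership_criterion\<close>). The inequality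
  \<open>defect_mult_le\<close> for the right-hand side then bounds \<open>T\<close> on \<open>\<H>(b)\<close> by the supremum of \<open>\<bar>\<phi>\<bar>\<close>.

  If \<open>b\<close> is not extreme, it is the midpoint of a segment in the unit ball, and the parallelogram law
  gives a function \<open>h \<noteq> 0\<close> with \<open>\<bar>b\<bar>\<^sup>2 + \<bar>h\<bar>\<^sup>2 \<le> 1\<close> on the disc. Replacing \<open>h\<close> by its outer part
  \<open>a\<close> (\<open>outer_part\<close>) keeps \<open>\<parallel>a u\<parallel>\<^sup>2 \<le> \<parallel>u\<parallel>\<^sup>2 - \<parallel>S u\<parallel>\<^sup>2\<close>. So the co-analytic Toeplitz operator of
  symbol \<open>a\<close> maps the Hardy space into \<open>\<H>(b)\<close>, and cyclicity of \<open>a\<close> makes its range dense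
  (\<open>toep_a_total\<close>). This puts the kernels \<open>k\<^sub>l\<close> with \<open>a l \<noteq> 0\<close> into \<open>\<H>(b)\<close> and makes them total
  there.
\<close>

section \<open>Hilbert spaces of functions\<close>

text \<open>
  Linear combinations are indexed by lists of coefficient-index pairs: concatenation of lists is
  addition, and inductions over a span become inductions over a list.
\<close>

definition lin_comb :: "('i \<Rightarrow> complex \<Rightarrow> complex) \<Rightarrow> (complex \<times> 'i) list \<Rightarrow> complex \<Rightarrow> complex" where
  "lin_comb e xs z = (\<Sum>(c, i)\<leftarrow>xs. c * e i z)"

lemma lin_comb_Nil: "lin_comb e [] = (\<lambda>z. 0)"
  and lin_comb_Cons: "lin_comb e ((c, i) # xs) = (\<lambda>z. c * e i z + lin_comb e xs z)"
  and lin_comb_append: "lin_comb e (xs @ ys) = (\<lambda>z. lin_comb e xs z + lin_comb e ys z)"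
  by (auto simp: lin_comb_def)

lemma lin_comb_scale: "lin_comb e (map (\<lambda>(c, i). (a * c, i)) xs) = (\<lambda>z. a * lin_comb e xs z)"
  by (induction xs) (auto simp: lin_comb_Nil lin_comb_Cons distrib_left mult.assoc fun_eq_iff)

locale function_hilbert_space =
  fixes H :: "(complex \<Rightarrow> complex) set"
    and ip :: "(complex \<Rightarrow> complex) \<Rightarrow> (complex \<Rightarrow> complex) \<Rightarrow> complex"
  assumes ahs: "analytic_hilbert_space H ip"
begin

abbreviation nrm :: "(complex \<Rightarrow> complex) \<Rightarrow> real" where "nrm \<equiv> ip_norm ip"

lemma in_hol_disc: "f \<in> H \<Longrightarrow> f \<in> hol_disc"
  and zero_mem: "(\<lambda>z. 0) \<in> H"
  and add_mem: "f \<in> H \<Longrightarrow> g \<in> H \<Longrightarrow> (\<lambda>z. f z + g z) \<in> H"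
  and scale_mem: "f \<in> H \<Longrightarrow> (\<lambda>z. c * f z) \<in> H"
  and ip_add_left: "f \<in> H \<Longrightarrow> g \<in> H \<Longrightarrow> h \<in> H \<Longrightarrow> ip (\<lambda>z. f z + g z) h = ip f h + ip g h"
  and ip_scale_left: "f \<in> H \<Longrightarrow> g \<in> H \<Longrightarrow> ip (\<lambda>z. c * f z) g = c * ip f g"
  and ip_commute: "f \<in> H \<Longrightarrow> g \<in> H \<Longrightarrow> ip g f = cnj (ip f g)"
  and ip_self_nonneg: "f \<in> H \<Longrightarrow> 0 \<le> Re (ip f f)"
  and ip_self_eq_0: "f \<in> H \<Longrightarrow> ip f f = 0 \<Longrightarrow> f = (\<lambda>z. 0)"
proof -
  note A = ahs[unfolded analytic_hilbert_space_def]
  note B = A[THEN conjunct2, THEN conjunct2]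
  note C = B[THEN conjunct2, THEN conjunct2]
  note D = C[THEN conjunct2, THEN conjunct2]
  show "f \<in> H \<Longrightarrow> f \<in> hol_disc" "(\<lambda>z. 0) \<in> H"
    using A[THEN conjunct1] A[THEN conjunct2, THEN conjunct1] by blast+
  show "f \<in> H \<Longrightarrow> g \<in> H \<Longrightarrow> (\<lambda>z. f z + g z) \<in> H" "f \<in> H \<Longrightarrow> (\<lambda>z. c * f z) \<in> H"
    using B[THEN conjunct1] B[THEN conjunct2, THEN conjunct1] by blast+
  show "f \<in> H \<Longrightarrow> g \<in> H \<Longrightarrow> h \<in> H \<Longrightarrow> ip (\<lambda>z. f z + g z) h = ip f h + ip g h"
    "f \<in> H \<Longrightarrow> g \<in> H \<Longrightarrow> ip (\<lambda>z. c * f z) g = c * ip f g"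
    using C[THEN conjunct1] C[THEN conjunct2, THEN conjunct1] by blast+
  show "f \<in> H \<Longrightarrow> g \<in> H \<Longrightarrow> ip g f = cnj (ip f g)" "f \<in> H \<Longrightarrow> 0 \<le> Re (ip f f)"
    "f \<in> H \<Longrightarrow> ip f f = 0 \<Longrightarrow> f = (\<lambda>z. 0)"
    using D[THEN conjunct1] D[THEN conjunct2, THEN conjunct1]
      D[THEN conjunct2, THEN conjunct2, THEN conjunct1] by blast+
qed

lemma complete:
  assumes "\<And>n. X n \<in> H"
    and "\<And>e. e > 0 \<Longrightarrow> \<exists>N. \<forall>m\<ge>N. \<forall>n\<ge>N. nrm (\<lambda>z. X m z - X n z) < e"
  obtains f where "f \<in> H" "(\<lambda>n. nrm (\<lambda>z. X n z - f z)) \<longlonglongrightarrow> 0"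
proof -
  note A = ahs[unfolded analytic_hilbert_space_def, THEN conjunct2, THEN conjunct2, THEN conjunct2,
      THEN conjunct2, THEN conjunct2, THEN conjunct2, THEN conjunct2, THEN conjunct2, THEN conjunct2]
  show thesis using A[THEN spec, of X] assms that by blast
qed

lemma diff_mem: "f \<in> H \<Longrightarrow> g \<in> H \<Longrightarrow> (\<lambda>z. f z - g z) \<in> H"
  using add_mem[OF _ scale_mem[of g "-1"], of f] by simp

lemma ip_diff_left:
  "f \<in> H \<Longrightarrow> g \<in> H \<Longrightarrow> h \<in> H \<Longrightarrow> ip (\<lambda>z. f z - g z) h = ip f h - ip g h"
  using ip_add_left[OF _ scale_mem[of g "-1"], of f h] ip_scale_left[of g h "-1"] by simp

lemma ip_add_right:
  "f \<in> H \<Longrightarrow> g \<in> H \<Longrightarrow> h \<in> H \<Longrightarrow> ip h (\<lambda>z. f z + g z) = ip h f + ip h g"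
  using ip_commute[of _ h] add_mem ip_add_left by simp

lemma ip_diff_right:
  "f \<in> H \<Longrightarrow> g \<in> H \<Longrightarrow> h \<in> H \<Longrightarrow> ip h (\<lambda>z. f z - g z) = ip h f - ip h g"
  using ip_commute[of _ h] diff_mem ip_diff_left by simp

lemma ip_scale_right:
  "f \<in> H \<Longrightarrow> g \<in> H \<Longrightarrow> ip g (\<lambda>z. c * f z) = cnj c * ip g f"
  using ip_commute[of _ g] scale_mem ip_scale_left by simp

lemma ip_zero_left: "f \<in> H \<Longrightarrow> ip (\<lambda>z. 0) f = 0"
  using ip_scale_left[of f f 0] by simp

lemma ip_self: "f \<in> H \<Longrightarrow> ip f f = of_real ((nrm f)\<^sup>2)"
  using ip_commute[of f f] ip_self_nonneg[of f]
  by (simp add: ip_norm_def complex_eq_iff)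

lemma nrm_nonneg: "f \<in> H \<Longrightarrow> 0 \<le> nrm f"
  by (simp add: ip_norm_def ip_self_nonneg)

lemma nrm_eq_0: "f \<in> H \<Longrightarrow> nrm f = 0 \<Longrightarrow> f = (\<lambda>z. 0)"
  using ip_self ip_self_eq_0 by simp

lemma nrm_zero [simp]: "nrm (\<lambda>z. 0) = 0"
  using ip_zero_left[OF zero_mem] by (simp add: ip_norm_def)

lemma nrm_add_sq:
  assumes "f \<in> H" "g \<in> H"
  shows "(nrm (\<lambda>z. f z + g z))\<^sup>2 = (nrm f)\<^sup>2 + 2 * Re (ip f g) + (nrm g)\<^sup>2"
proof -
  have "Re (ip (\<lambda>z. f z + g z) (\<lambda>z. f z + g z)) = Re (ip f f) + 2 * Re (ip f g) + Re (ip g g)"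
    using assms ip_commute[of f g] by (simp add: ip_add_left ip_add_right add_mem)
  with assms show ?thesis by (simp add: ip_self add_mem)
qed

lemma nrm_scale_sq:
  assumes "f \<in> H"
  shows "(nrm (\<lambda>z. c * f z))\<^sup>2 = (cmod c)\<^sup>2 * (nrm f)\<^sup>2"
proof -
  have "complex_of_real ((nrm (\<lambda>z. c * f z))\<^sup>2) = c * cnj c * ip f f"
    using ip_self[OF scale_mem[OF assms], of c] assms by (simp add: scale_mem ip_scale_left ip_scale_right mult.assoc)
  also have "\<dots> = of_real ((cmod c)\<^sup>2 * (nrm f)\<^sup>2)"
    using assms by (simp add: ip_self complex_mult_cnj cmod_power2)
  finally show ?thesis by (simp only: of_real_eq_iff)
qed

lemma nrm_scale: "f \<in> H \<Longrightarrow> nrm (\<lambda>z. c * f z) = cmod c * nrm f"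
  by (rule power2_eq_imp_eq) (simp_all add: nrm_scale_sq power_mult_distrib nrm_nonneg scale_mem)

lemma nrm_minus_commute:
  assumes "f \<in> H" "g \<in> H"
  shows "nrm (\<lambda>z. f z - g z) = nrm (\<lambda>z. g z - f z)"
  using nrm_scale[OF diff_mem[OF assms], of "-1"] by simp

lemma nrm_diff_sq:
  assumes "f \<in> H" "g \<in> H"
  shows "(nrm (\<lambda>z. f z - g z))\<^sup>2 = (nrm f)\<^sup>2 - 2 * Re (ip f g) + (nrm g)\<^sup>2"
  using nrm_add_sq[OF assms(1) scale_mem[OF assms(2)], of "-1"] nrm_scale[OF assms(2), of "-1"]
    ip_scale_right[OF assms(2,1), of "-1"] by simp

text \<open>
  Expanding \<open>\<parallel>f + t g\<parallel>\<^sup>2 \<ge> 0\<close> at its minimum \<open>t = - \<langle>f, g\<rangle> / \<parallel>g\<parallel>\<^sup>2\<close>.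
\<close>

lemma Cauchy_Schwarz:
  assumes "f \<in> H" "g \<in> H"
  shows "cmod (ip f g) \<le> nrm f * nrm g"
proof (cases "nrm g = 0")
  case True
  then have "g = (\<lambda>z. 0)" using nrm_eq_0 assms by blast
  then show ?thesis
    using ip_commute[of "\<lambda>z. 0" f] ip_zero_left[of f] assms zero_mem by simp
next
  case False
  define q where "q = (nrm g)\<^sup>2"
  define s where "s = ip f g"
  define t where "t = - s / of_real q"
  have q: "q > 0" using False by (simp add: q_def)
  have "0 \<le> (nrm (\<lambda>z. f z + t * g z))\<^sup>2" by simp
  also have "\<dots> = (nrm f)\<^sup>2 + 2 * Re (cnj t * s) + (cmod t)\<^sup>2 * q"
    using assms by (simp add: nrm_add_sq scale_mem nrm_scale_sq ip_scale_right s_def q_def)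
  also have "Re (cnj t * s) = - (cmod s)\<^sup>2 / q"
    by (simp add: t_def cmod_power2 diff_divide_distrib add_divide_distrib flip: power2_eq_square)
  also have "(cmod t)\<^sup>2 * q = (cmod s)\<^sup>2 / q"
    using q by (simp add: t_def norm_divide power2_eq_square)
  finally have "(cmod s)\<^sup>2 / q \<le> (nrm f)\<^sup>2" by simp
  then have "(cmod s)\<^sup>2 \<le> (nrm f * nrm g)\<^sup>2"
    using q by (simp add: divide_simps power_mult_distrib q_def)
  then show ?thesis
    using power2_le_imp_le nrm_nonneg assms unfolding s_def by (metis mult_nonneg_nonneg)
qed

lemma nrm_triangle:
  assumes "f \<in> H" "g \<in> H"
  shows "nrm (\<lambda>z. f z + g z) \<le> nrm f + nrm g"
proof -
  have "Re (ip f g) \<le> nrm f * nrm g"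
    using Cauchy_Schwarz[OF assms] complex_Re_le_cmod order_trans by blast
  then have "(nrm (\<lambda>z. f z + g z))\<^sup>2 \<le> (nrm f + nrm g)\<^sup>2"
    by (simp add: nrm_add_sq assms power2_sum)
  then show ?thesis
    using power2_le_imp_le nrm_nonneg assms by (metis add_nonneg_nonneg)
qed

lemma nrm_triangle_diff:
  assumes "f \<in> H" "g \<in> H" "h \<in> H"
  shows "nrm (\<lambda>z. f z - h z) \<le> nrm (\<lambda>z. f z - g z) + nrm (\<lambda>z. g z - h z)"
  using nrm_triangle[OF diff_mem[OF assms(1,2)] diff_mem[OF assms(2,3)]] by simp

lemma nrm_le_add_diff:
  assumes "f \<in> H" "g \<in> H"
  shows "nrm f \<le> nrm g + nrm (\<lambda>z. f z - g z)"
  using nrm_triangle[OF assms(2) diff_mem[OF assms]] by simp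

lemma tendsto_ip_left:
  assumes "\<And>n. X n \<in> H" "f \<in> H" "g \<in> H" "(\<lambda>n. nrm (\<lambda>z. X n z - f z)) \<longlonglongrightarrow> 0"
  shows "(\<lambda>n. ip (X n) g) \<longlonglongrightarrow> ip f g"
proof -
  have "(\<lambda>n. ip (X n) g - ip f g) \<longlonglongrightarrow> 0"
  proof (rule Lim_null_comparison)
    show "(\<lambda>n. nrm (\<lambda>z. X n z - f z) * nrm g) \<longlonglongrightarrow> 0"
      using tendsto_mult_right[OF assms(4), of "nrm g"] by simp
    show "\<forall>\<^sub>F n in sequentially. cmod (ip (X n) g - ip f g) \<le> nrm (\<lambda>z. X n z - f z) * nrm g"
      using Cauchy_Schwarz[OF diff_mem[OF assms(1,2)] assms(3)] ip_diff_left[OF assms(1,2,3)] by simp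
  qed
  then show ?thesis by (simp add: LIM_zero_cancel)
qed

lemma tendsto_ip_right:
  assumes "\<And>n. X n \<in> H" "f \<in> H" "g \<in> H" "(\<lambda>n. nrm (\<lambda>z. X n z - f z)) \<longlonglongrightarrow> 0"
  shows "(\<lambda>n. ip g (X n)) \<longlonglongrightarrow> ip g f"
  using tendsto_cnj[OF tendsto_ip_left[OF assms]] ip_commute[OF assms(1,3)] ip_commute[OF assms(2,3)]
  by simp

lemma tendsto_nrm:
  assumes "\<And>n. X n \<in> H" "f \<in> H" "(\<lambda>n. nrm (\<lambda>z. X n z - f z)) \<longlonglongrightarrow> 0"
  shows "(\<lambda>n. nrm (X n)) \<longlonglongrightarrow> nrm f"
proof -
  have "(\<lambda>n. nrm (X n) - nrm f) \<longlonglongrightarrow> 0"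
  proof (rule Lim_null_comparison[OF _ assms(3)])
    have "\<bar>nrm (X n) - nrm f\<bar> \<le> nrm (\<lambda>z. X n z - f z)" for n
      using nrm_le_add_diff[OF assms(1) assms(2), of n] nrm_le_add_diff[OF assms(2) assms(1), of n]
        nrm_minus_commute[OF assms(1) assms(2), of n] by linarith
    then show "\<forall>\<^sub>F n in sequentially. norm (nrm (X n) - nrm f) \<le> nrm (\<lambda>z. X n z - f z)" by simp
  qed
  then show ?thesis by (simp add: LIM_zero_cancel)
qed

text \<open>
  The representation theorem for a bounded functional on a subspace, the functional being given by its
  graph \<open>G\<close>. The bound makes \<open>G\<close> single-valued, so a functional may be prescribed on formal
  combinations without checking that it is well defined. The representing vector is found by
  minimizing \<open>\<parallel>u\<parallel>\<^sup>2 - 2 Re c\<close> over \<open>(u, c) \<in> G\<close>: the parallelogram law makes minimizing sequences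
  Cauchy, and the derivative of the quadratic functional vanishes at the limit. The sequence is part
  of the conclusion, which thus also serves as an orthogonal projection onto the closure of the
  subspace.
\<close>

lemma Riesz_relation:
  assumes "G \<noteq> {}" and GH: "\<And>u c. (u, c) \<in> G \<Longrightarrow> u \<in> H"
    and lin: "\<And>u c v d a. (u, c) \<in> G \<Longrightarrow> (v, d) \<in> G \<Longrightarrow> (\<lambda>z. u z + a * v z, c + a * d) \<in> G"
    and bd: "\<And>u c. (u, c) \<in> G \<Longrightarrow> cmod c \<le> C * nrm u"
  obtains F X where "F \<in> H" "\<And>v d. (v, d) \<in> G \<Longrightarrow> ip v F = d" "nrm F \<le> C \<or> F = (\<lambda>z. 0)"
    "\<And>n. \<exists>c. (X n, c) \<in> G" "(\<lambda>n. nrm (\<lambda>z. X n z - F z)) \<longlonglongrightarrow> 0"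
proof -
  define J where "J = (\<lambda>(u, c). (nrm u)\<^sup>2 - 2 * Re c)"
  have Jlow: "- C\<^sup>2 \<le> J x" if "x \<in> G" for x
  proof -
    obtain u c where x: "x = (u, c)" by fastforce
    have "0 \<le> (nrm u - C)\<^sup>2" by simp
    moreover have "Re c \<le> C * nrm u"
      using bd that x complex_Re_le_cmod order_trans by blast
    ultimately show ?thesis unfolding J_def x power2_diff by simp argo
  qed
  define m where "m = Inf (J ` G)"
  have bdd: "bdd_below (J ` G)" using Jlow unfolding bdd_below_def by blast
  have m_le: "m \<le> J x" if "x \<in> G" for x
    unfolding m_def using bdd that by (simp add: cInf_lower)
  have "\<exists>x\<in>G. J x < m + 1 / real (Suc n)" for n
  proof -
    have "m < m + 1 / real (Suc n)" by simp
    then show ?thesis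
      using cInf_lessD[of "J ` G"] assms(1) unfolding m_def by blast
  qed
  then obtain x where x: "\<And>n. x n \<in> G" "\<And>n. J (x n) < m + 1 / real (Suc n)" by metis
  define X where "X n = fst (x n)" for n
  define c where "c n = snd (x n)" for n
  have XG: "(X n, c n) \<in> G" for n using x(1)[of n] by (simp add: X_def c_def)
  have XH: "X n \<in> H" for n using GH XG by blast
  have JX: "(nrm (X n))\<^sup>2 - 2 * Re (c n) < m + 1 / real (Suc n)" for n
    using x(2)[of n] by (simp add: J_def X_def c_def case_prod_beta)
  have sc: "(\<lambda>z. a * v z, a * d) \<in> G" if "(v, d) \<in> G" for v d a
    using lin[OF lin[OF that that, of "-1"] that, of a] by simp
  have mid: "a - 2 * i + b \<le> 2 * s + 2 * t"
    if "m \<le> (a + 2 * i + b) / 4 - c1 - c2" "a - 2 * c1 < m + s" "b - 2 * c2 < m + t"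
    for a b i c1 c2 s t :: real
    using that by argo
  have cau: "(nrm (\<lambda>z. X n z - X k z))\<^sup>2 \<le> 2 * (1 / real (Suc n)) + 2 * (1 / real (Suc k))" for n k
  proof -
    have "(\<lambda>z. (1/2) * X n z + (1/2) * X k z, (1/2) * c n + (1/2) * c k) \<in> G"
      using lin[OF sc[OF XG] XG, of "1/2" n "1/2" k] by simp
    then have "m \<le> (nrm (\<lambda>z. (1/2) * X n z + (1/2) * X k z))\<^sup>2 - Re (c n) - Re (c k)"
      using m_le by (fastforce simp: J_def)
    also have "(nrm (\<lambda>z. (1/2) * X n z + (1/2) * X k z))\<^sup>2
        = ((nrm (X n))\<^sup>2 + 2 * Re (ip (X n) (X k)) + (nrm (X k))\<^sup>2) / 4"
      using nrm_scale_sq[OF add_mem[OF XH XH], of "1/2" n k] nrm_add_sq[OF XH XH, of n k]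
      by (simp add: distrib_left power2_eq_square)
    finally show ?thesis
      unfolding nrm_diff_sq[OF XH XH] using JX[of n] JX[of k] by (rule mid)
  qed
  have "\<exists>N. \<forall>p\<ge>N. \<forall>n\<ge>N. nrm (\<lambda>z. X p z - X n z) < e" if "e > 0" for e
  proof -
    have e4: "0 < e\<^sup>2 / 4" using that by simp
    obtain N where N: "inverse (real (Suc N)) < e\<^sup>2 / 4"
      using reals_Archimedean[OF e4] by blast
    have "nrm (\<lambda>z. X p z - X n z) < e" if pn: "p \<ge> N" "n \<ge> N" for p n
    proof -
      have "2 / real (Suc p) \<le> 2 / real (Suc N)" "2 / real (Suc n) \<le> 2 / real (Suc N)"
        using pn by (simp_all add: frac_le)
      then have "(nrm (\<lambda>z. X p z - X n z))\<^sup>2 < e\<^sup>2"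
        using cau[of p n] N by (simp add: inverse_eq_divide)
      then show ?thesis using \<open>e > 0\<close> by (simp add: power2_less_imp_less)
    qed
    then show ?thesis by blast
  qed
  then obtain F where F: "F \<in> H" "(\<lambda>n. nrm (\<lambda>z. X n z - F z)) \<longlonglongrightarrow> 0"
    using complete[of X] XH by blast
  have inv0: "(\<lambda>n. 1 / real (Suc n)) \<longlonglongrightarrow> 0"
    using LIMSEQ_inverse_real_of_nat by (simp add: inverse_eq_divide)
  have rep: "ip v F = d" if vd: "(v, d) \<in> G" for v d
  proof -
    have vH: "v \<in> H" using GH vd by blast
    define e where "e = ip v F - d"
    have pos: "0 \<le> 2 * Re (a * e) + (cmod a)\<^sup>2 * (nrm v)\<^sup>2" for a
    proof (rule LIMSEQ_le_const)
      show "(\<lambda>n. 1 / real (Suc n) + 2 * Re (a * (ip v (X n) - d)) + (cmod a)\<^sup>2 * (nrm v)\<^sup>2)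
          \<longlonglongrightarrow> 2 * Re (a * e) + (cmod a)\<^sup>2 * (nrm v)\<^sup>2"
        unfolding e_def by (rule tendsto_eq_intros inv0 tendsto_ip_right[OF XH F(1) vH F(2)] refl | simp)+
      have "0 \<le> 1 / real (Suc n) + 2 * Re (a * (ip v (X n) - d)) + (cmod a)\<^sup>2 * (nrm v)\<^sup>2" for n
      proof -
        have "m \<le> (nrm (\<lambda>z. X n z + a * v z))\<^sup>2 - 2 * Re (c n + a * d)"
          using m_le[OF lin[OF XG vd, of n a]] by (simp add: J_def)
        also have "(nrm (\<lambda>z. X n z + a * v z))\<^sup>2
            = (nrm (X n))\<^sup>2 + 2 * Re (cnj a * ip (X n) v) + (cmod a)\<^sup>2 * (nrm v)\<^sup>2"
          using XH vH by (simp add: nrm_add_sq scale_mem nrm_scale_sq ip_scale_right)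
        also have "Re (cnj a * ip (X n) v) = Re (a * ip v (X n))"
          using ip_commute[OF vH XH, of n] by simp
        finally show ?thesis using JX[of n] by (simp add: algebra_simps)
      qed
      then show "\<exists>N. \<forall>n\<ge>N. 0 \<le> 1 / real (Suc n) + 2 * Re (a * (ip v (X n) - d))
          + (cmod a)\<^sup>2 * (nrm v)\<^sup>2" by blast
    qed
    \<comment> \<open>the direction of steepest descent, with a step short enough for the linear term to win\<close>
    define t where "t = 1 / ((nrm v)\<^sup>2 + 1)"
    have t: "t > 0" "t * (nrm v)\<^sup>2 < 1"
      by (simp_all add: t_def add_nonneg_pos)
    have "0 \<le> 2 * Re ((- of_real t * cnj e) * e) + (cmod (- of_real t * cnj e))\<^sup>2 * (nrm v)\<^sup>2"
      by (rule pos)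
    also have "Re ((- of_real t * cnj e) * e) = - t * (cmod e)\<^sup>2"
      unfolding cmod_power2 by (simp add: power2_eq_square algebra_simps)
    also have "(cmod (- of_real t * cnj e))\<^sup>2 * (nrm v)\<^sup>2 = t * (t * (nrm v)\<^sup>2) * (cmod e)\<^sup>2"
      using t by (simp add: norm_mult power_mult_distrib power2_eq_square)
    finally have "0 \<le> t * (cmod e)\<^sup>2 * (t * (nrm v)\<^sup>2 - 2)"
      by (simp add: algebra_simps)
    then have "cmod e = 0" using t by (smt (verit) mult_pos_neg zero_less_mult_iff zero_less_power2)
    then show ?thesis by (simp add: e_def)
  qed
  have "nrm F \<le> C \<or> F = (\<lambda>z. 0)"
  proof (cases "nrm F = 0")
    case True
    then show ?thesis using nrm_eq_0 F(1) by blast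
  next
    case False
    have "(\<lambda>n. cmod (ip (X n) F)) \<longlonglongrightarrow> cmod (ip F F)"
      by (intro tendsto_norm tendsto_ip_left XH F)
    moreover have "(\<lambda>n. C * nrm (X n)) \<longlonglongrightarrow> C * nrm F"
      by (intro tendsto_mult_left tendsto_nrm XH F)
    moreover have "cmod (ip (X n) F) \<le> C * nrm (X n)" for n
      using rep[OF XG] bd[OF XG] by simp
    ultimately have "cmod (ip F F) \<le> C * nrm F" by (blast intro: LIMSEQ_le)
    then have "nrm F * nrm F \<le> C * nrm F"
      using F nrm_nonneg[OF F(1)] by (simp add: ip_self norm_power norm_mult power2_eq_square)
    then show ?thesis using False nrm_nonneg[OF F(1)] by simp
  qed
  with F rep XG that show thesis by blast
qed


lemma lin_comb_mem:
  assumes "\<And>i. i \<in> I \<Longrightarrow> e i \<in> H" "xs \<in> lists (UNIV \<times> I)"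
  shows "lin_comb e xs \<in> H"
  using assms(2)
proof (induction xs rule: list.induct)
  case Nil
  then show ?case by (simp add: lin_comb_Nil zero_mem)
next
  case (Cons x xs)
  then show ?case
    using assms(1) by (cases x) (auto simp: lin_comb_Cons intro!: add_mem scale_mem)
qed

text \<open>
  The orthogonal projection of \<open>f\<close> onto the closed span is \<open>f\<close> itself, because the difference is
  orthogonal to every \<open>e i\<close>.
\<close>

lemma lin_comb_dense_if_total:
  assumes e: "\<And>i. i \<in> I \<Longrightarrow> e i \<in> H"
    and total: "\<And>f. f \<in> H \<Longrightarrow> (\<And>i. i \<in> I \<Longrightarrow> ip f (e i) = 0) \<Longrightarrow> f = (\<lambda>z. 0)"
    and f: "f \<in> H" and "\<epsilon> > 0"
  shows "\<exists>xs\<in>lists (UNIV \<times> I). nrm (\<lambda>z. lin_comb e xs z - f z) < \<epsilon>"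
proof -
  define G where "G = (\<lambda>xs. (lin_comb e xs, ip (lin_comb e xs) f)) ` lists (UNIV \<times> I)"
  have GD: "\<exists>xs\<in>lists (UNIV \<times> I). u = lin_comb e xs \<and> c = ip u f" if "(u, c) \<in> G" for u c
    using that by (auto simp: G_def)
  have mem: "lin_comb e xs \<in> H" if "xs \<in> lists (UNIV \<times> I)" for xs
    using lin_comb_mem[of I e] e that by blast
  have ne: "G \<noteq> {}" by (auto simp: G_def)
  have GH: "u \<in> H" if "(u, c) \<in> G" for u c using GD[OF that] mem by blast
  have bd: "cmod c \<le> nrm f * nrm u" if "(u, c) \<in> G" for u c
    using GD[OF that] mem Cauchy_Schwarz[OF _ f] by (fastforce simp: mult.commute)
  have lin: "(\<lambda>z. u z + a * v z, c + a * d) \<in> G" if uv: "(u, c) \<in> G" "(v, d) \<in> G" for u c v d a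
  proof -
    obtain xs ys where xs: "xs \<in> lists (UNIV \<times> I)" "u = lin_comb e xs" "c = ip u f"
      and ys: "ys \<in> lists (UNIV \<times> I)" "v = lin_comb e ys" "d = ip v f"
      using GD[OF uv(1)] GD[OF uv(2)] by blast
    have "(\<lambda>z. u z + a * v z) = lin_comb e (xs @ map (\<lambda>(c, i). (a * c, i)) ys)"
      by (simp add: xs ys lin_comb_append lin_comb_scale)
    moreover have "xs @ map (\<lambda>(c, i). (a * c, i)) ys \<in> lists (UNIV \<times> I)"
      using xs(1) ys(1) by (auto simp: in_lists_conv_set)
    moreover have "c + a * d = ip (\<lambda>z. u z + a * v z) f"
      using xs ys mem f by (simp add: ip_add_left ip_scale_left scale_mem)
    ultimately show ?thesis
      unfolding G_def by (intro image_eqI[of _ _ "xs @ map (\<lambda>(c, i). (a * c, i)) ys"]) simp_all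
  qed
  obtain F X where F: "F \<in> H" "\<And>v d. (v, d) \<in> G \<Longrightarrow> ip v F = d" "nrm F \<le> nrm f \<or> F = (\<lambda>z. 0)"
    and X: "\<And>n. \<exists>c. (X n, c) \<in> G" "(\<lambda>n. nrm (\<lambda>z. X n z - F z)) \<longlonglongrightarrow> 0"
  proof (rule Riesz_relation[of G "nrm f", OF ne])
    show "u \<in> H" if "(u, c) \<in> G" for u c using GH[OF that] .
    show "(\<lambda>z. u z + a * v z, c + a * d) \<in> G" if "(u, c) \<in> G" "(v, d) \<in> G" for u c v d a
      using lin[OF that] .
    show "cmod c \<le> nrm f * nrm u" if "(u, c) \<in> G" for u c using bd[OF that] .
  qed (rule that)
  have "ip (\<lambda>z. f z - F z) (e i) = 0" if "i \<in> I" for i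
  proof -
    have "(e i, ip (e i) f) \<in> G"
      unfolding G_def using that
      by (intro image_eqI[of _ _ "[(1, i)]"]) (auto simp: lin_comb_Cons lin_comb_Nil)
    then have "ip (e i) F = ip (e i) f" using F(2) by blast
    then show ?thesis
      using F(1) f e[OF that] ip_commute[of "e i" F] ip_commute[of "e i" f] by (simp add: ip_diff_left)
  qed
  then have "(\<lambda>z. f z - F z) = (\<lambda>z. 0)" using total diff_mem F(1) f by blast
  then have "F = f" by (metis eq_iff_diff_eq_0 ext)
  then have "\<forall>\<^sub>F n in sequentially. nrm (\<lambda>z. X n z - f z) < \<epsilon>"
    using X(2) \<open>\<epsilon> > 0\<close> by (simp add: order_tendstoD(2))
  then obtain n where "nrm (\<lambda>z. X n z - f z) < \<epsilon>" by (auto simp: eventually_sequentially)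
  moreover obtain c where "(X n, c) \<in> G" using X(1) by blast
  then obtain xs where "xs \<in> lists (UNIV \<times> I)" "X n = lin_comb e xs" using GD by blast
  ultimately show ?thesis by auto
qed

text \<open>
  The combinations with coefficients in a countable dense set of complex numbers are dense: the error is
  distributed over the summands by induction on the list.
\<close>

lemma separable_if_total:
  assumes e: "\<And>i. i \<in> I \<Longrightarrow> e i \<in> H"
    and total: "\<And>f. f \<in> H \<Longrightarrow> (\<And>i. i \<in> I \<Longrightarrow> ip f (e i) = 0) \<Longrightarrow> f = (\<lambda>z. 0)"
    and "countable I"
  obtains Q where "countable Q" "Q \<subseteq> H" "\<And>f \<epsilon>. f \<in> H \<Longrightarrow> \<epsilon> > 0 \<Longrightarrow> \<exists>q\<in>Q. nrm (\<lambda>z. q z - f z) < \<epsilon>"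
proof -
  obtain D :: "complex set" where D: "countable D" "\<And>X. open X \<Longrightarrow> X \<noteq> {} \<Longrightarrow> \<exists>d\<in>D. d \<in> X"
    using countable_dense_setE by blast
  have mem: "lin_comb e xs \<in> H" if "xs \<in> lists (UNIV \<times> I)" for xs
    using lin_comb_mem[of I e] e that by blast
  have mem': "lin_comb e xs \<in> H" if "xs \<in> lists (D \<times> I)" for xs
    by (rule mem) (use that in \<open>auto simp: in_lists_conv_set\<close>)
  have approx: "\<exists>ys\<in>lists (D \<times> I). nrm (\<lambda>z. lin_comb e ys z - lin_comb e xs z) < \<epsilon>"
    if "xs \<in> lists (UNIV \<times> I)" "\<epsilon> > 0" for xs \<epsilon>
    using that
  proof (induction xs arbitrary: \<epsilon> rule: list.induct)
    case Nil
    then show ?case by (intro bexI[of _ "[]"]) (auto simp: lin_comb_Nil)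
  next
    case (Cons x xs)
    obtain c i where x: "x = (c, i)" "i \<in> I" using Cons.prems(1) by (metis SigmaE listsE)
    have xs: "xs \<in> lists (UNIV \<times> I)" using Cons.prems(1) by (rule listsE)
    obtain ys where ys: "ys \<in> lists (D \<times> I)" "nrm (\<lambda>z. lin_comb e ys z - lin_comb e xs z) < \<epsilon> / 2"
      using Cons.IH[OF xs, of "\<epsilon> / 2"] Cons.prems(2) by auto
    define \<delta> where "\<delta> = \<epsilon> / (2 * (nrm (e i) + 1))"
    have e1: "0 \<le> nrm (e i)" using nrm_nonneg e x by blast
    have "\<delta> > 0" using Cons.prems e1 by (auto simp: \<delta>_def intro!: divide_pos_pos)
    then obtain d where d: "d \<in> D" "cmod (d - c) < \<delta>"
      using D(2)[of "ball c \<delta>"] by (auto simp: dist_norm norm_minus_commute)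
    have "nrm (\<lambda>z. lin_comb e ((d, i) # ys) z - lin_comb e (x # xs) z)
        = nrm (\<lambda>z. (d - c) * e i z + (lin_comb e ys z - lin_comb e xs z))"
      by (simp add: x lin_comb_Cons algebra_simps)
    also have "\<dots> \<le> nrm (\<lambda>z. (d - c) * e i z) + nrm (\<lambda>z. lin_comb e ys z - lin_comb e xs z)"
      using e x(2) mem mem' xs ys(1) by (intro nrm_triangle scale_mem diff_mem) auto
    also have "nrm (\<lambda>z. (d - c) * e i z) = cmod (d - c) * nrm (e i)"
      using e x by (simp add: nrm_scale)
    also have "cmod (d - c) * nrm (e i) \<le> \<delta> * (nrm (e i) + 1)"
      using d e1 \<open>\<delta> > 0\<close> by (intro mult_mono) auto
    also have "\<delta> * (nrm (e i) + 1) = \<epsilon> / 2"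
      using e1 by (simp add: \<delta>_def divide_simps)
    finally show ?case
      using ys d x(2) by (intro bexI[of _ "(d, i) # ys"]) auto
  qed
  show thesis
  proof (rule that[of "lin_comb e ` lists (D \<times> I)"])
    show "countable (lin_comb e ` lists (D \<times> I))"
      using D(1) assms(3) by (simp add: countable_lists)
    show "lin_comb e ` lists (D \<times> I) \<subseteq> H" using mem' by blast
    show "\<exists>q\<in>lin_comb e ` lists (D \<times> I). nrm (\<lambda>z. q z - f z) < \<epsilon>" if f: "f \<in> H" "\<epsilon> > 0" for f \<epsilon>
    proof -
      have "\<epsilon> / 2 > 0" using f by simp
      have "\<exists>xs\<in>lists (UNIV \<times> I). nrm (\<lambda>z. lin_comb e xs z - f z) < \<epsilon> / 2"
        by (rule lin_comb_dense_if_total[of I e f]) (fact e total f(1) \<open>\<epsilon> / 2 > 0\<close>)+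
      then obtain xs where xs: "xs \<in> lists (UNIV \<times> I)" "nrm (\<lambda>z. lin_comb e xs z - f z) < \<epsilon> / 2"
        by blast
      obtain ys where ys: "ys \<in> lists (D \<times> I)" "nrm (\<lambda>z. lin_comb e ys z - lin_comb e xs z) < \<epsilon> / 2"
        using approx[OF xs(1) \<open>\<epsilon> / 2 > 0\<close>] by blast
      have "nrm (\<lambda>z. lin_comb e ys z - f z) < \<epsilon>"
        using nrm_triangle_diff[OF mem'[OF ys(1)] mem[OF xs(1)] f(1)] xs(2) ys(2) by linarith
      then show ?thesis using ys(1) by blast
    qed
  qed
qed

subsection \<open>A hypercyclicity criterion\<close>

lemma power_op:
  assumes "bounded_operator_on H nrm T"
  shows "f \<in> H \<Longrightarrow> (T ^^ n) f \<in> H"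
    and "f \<in> H \<Longrightarrow> g \<in> H \<Longrightarrow> (T ^^ n) (\<lambda>z. f z + g z) = (\<lambda>z. (T ^^ n) f z + (T ^^ n) g z)"
    and "f \<in> H \<Longrightarrow> (T ^^ n) (\<lambda>z. c * f z) = (\<lambda>z. c * (T ^^ n) f z)"
    and "f \<in> H \<Longrightarrow> g \<in> H \<Longrightarrow> (T ^^ n) (\<lambda>z. f z - g z) = (\<lambda>z. (T ^^ n) f z - (T ^^ n) g z)"
proof -
  note T = assms[unfolded bounded_operator_on_def]
  show mem: "f \<in> H \<Longrightarrow> (T ^^ n) f \<in> H" for f by (induction n) (use T in auto)
  show add: "f \<in> H \<Longrightarrow> g \<in> H \<Longrightarrow> (T ^^ n) (\<lambda>z. f z + g z) = (\<lambda>z. (T ^^ n) f z + (T ^^ n) g z)" for f g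
  proof (induction n)
    case (Suc n)
    have "(T ^^ n) f \<in> H" "(T ^^ n) g \<in> H" using Suc.prems T by (induction n) auto
    then show ?case using Suc T by simp
  qed simp
  show scale: "f \<in> H \<Longrightarrow> (T ^^ n) (\<lambda>z. c * f z) = (\<lambda>z. c * (T ^^ n) f z)" for f c
  proof (induction n)
    case (Suc n)
    have "(T ^^ n) f \<in> H" using Suc.prems T by (induction n) auto
    then show ?case using Suc T by simp
  qed simp
  show "f \<in> H \<Longrightarrow> g \<in> H \<Longrightarrow> (T ^^ n) (\<lambda>z. f z - g z) = (\<lambda>z. (T ^^ n) f z - (T ^^ n) g z)"
    using add[of f "\<lambda>z. -1 * g z"] scale[of g "-1"] scale_mem[of g "-1"] by simp
qed

text \<open>
  Birkhoff's transitivity theorem. For \<open>q\<close> in a countable dense set and each \<open>k\<close>, the vectors whose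
  orbit comes within \<open>1 / (k + 1)\<close> of \<open>q\<close> form an open set, dense by transitivity; a vector in all of
  these sets exists by the Baire category theorem.
\<close>

lemma hypercyclic_if_transitive:
  assumes T: "bounded_operator_on H nrm T"
    and Q: "countable Q" "Q \<subseteq> H" "\<And>f \<epsilon>. f \<in> H \<Longrightarrow> \<epsilon> > 0 \<Longrightarrow> \<exists>q\<in>Q. nrm (\<lambda>z. q z - f z) < \<epsilon>"
    and trans: "\<And>f g \<epsilon>. f \<in> H \<Longrightarrow> g \<in> H \<Longrightarrow> \<epsilon> > 0 \<Longrightarrow>
      \<exists>x\<in>H. \<exists>n. nrm (\<lambda>z. x z - f z) < \<epsilon> \<and> nrm (\<lambda>z. (T ^^ n) x z - g z) < \<epsilon>"
  shows "hypercyclic_on H nrm T"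
proof -
  define d where "d f g = nrm (\<lambda>z. f z - g z)" for f g
  have dtri: "d f h \<le> d f g + d g h" if "f \<in> H" "g \<in> H" "h \<in> H" for f g h
    using nrm_triangle_diff that by (simp add: d_def)
  \<comment> \<open>outside \<open>H\<close> the distance is set to \<open>0\<close>, so that it is nonnegative and symmetric everywhere\<close>
  define d' where "d' f g = (if f \<in> H \<and> g \<in> H then d f g else 0)" for f g
  interpret M: Metric_space H d'
  proof
    show "0 \<le> d' x y" for x y using nrm_nonneg diff_mem by (auto simp: d'_def d_def)
    show "d' x y = d' y x" for x y using nrm_minus_commute by (auto simp: d'_def d_def)
    show "(d' x y = 0) = (x = y)" if "x \<in> H" "y \<in> H" for x y
    proof
      assume "d' x y = 0"
      then have "(\<lambda>z. x z - y z) = (\<lambda>z. 0)"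
        using that nrm_eq_0 diff_mem by (simp add: d'_def d_def)
      then show "x = y" by (metis eq_iff_diff_eq_0 ext)
    qed (use that in \<open>simp add: d'_def d_def\<close>)
    show "d' x z \<le> d' x y + d' y z" if "x \<in> H" "y \<in> H" "z \<in> H" for x y z
      using that dtri by (simp add: d'_def)
  qed
  have mcomp: "M.mcomplete"
    unfolding M.mcomplete_def
  proof (intro allI impI)
    fix X :: "nat \<Rightarrow> complex \<Rightarrow> complex" assume "M.MCauchy X"
    then have XH: "\<And>n. X n \<in> H" and cau: "\<And>e. e > 0 \<Longrightarrow> \<exists>N. \<forall>m n. N \<le> m \<longrightarrow> N \<le> n \<longrightarrow> d' (X m) (X n) < e"
      by (auto simp: M.MCauchy_def)
    obtain f where f: "f \<in> H" "(\<lambda>n. nrm (\<lambda>z. X n z - f z)) \<longlonglongrightarrow> 0"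
    proof (rule complete[of X])
      show "\<exists>N. \<forall>m\<ge>N. \<forall>n\<ge>N. nrm (\<lambda>z. X m z - X n z) < e" if "e > 0" for e
        using cau[OF that] XH by (auto simp: d'_def d_def)
    qed (use XH in auto)
    have "limitin M.mtopology X f sequentially"
      unfolding M.limitin_metric
    proof (intro conjI allI impI f(1))
      fix e :: real assume "e > 0"
      then have "\<forall>\<^sub>F n in sequentially. nrm (\<lambda>z. X n z - f z) < e"
        using f(2) by (simp add: order_tendstoD(2))
      then show "\<forall>\<^sub>F n in sequentially. X n \<in> H \<and> d' (X n) f < e"
        using XH f(1) by (simp add: d'_def d_def)
    qed
    then show "\<exists>x. limitin M.mtopology X x sequentially" by blast
  qed
  obtain C where C: "\<And>f. f \<in> H \<Longrightarrow> nrm (T f) \<le> C * nrm f" and TH: "\<And>f. f \<in> H \<Longrightarrow> T f \<in> H"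
    using T unfolding bounded_operator_on_def by blast
  define B where "B = \<bar>C\<bar> + 1"
  have Bp: "B > 0" by (simp add: B_def)
  have TB: "nrm (T f) \<le> B * nrm f" if "f \<in> H" for f
  proof -
    have "C * nrm f \<le> B * nrm f" using nrm_nonneg[OF that] by (intro mult_right_mono) (auto simp: B_def)
    then show ?thesis using C[OF that] by linarith
  qed
  have TnB: "nrm ((T ^^ n) f) \<le> B ^ n * nrm f" if "f \<in> H" for f n
  proof (induction n)
    case (Suc n)
    have "nrm ((T ^^ Suc n) f) \<le> B * nrm ((T ^^ n) f)" using TB power_op(1)[OF T that] by simp
    also have "\<dots> \<le> B * (B ^ n * nrm f)" using Suc Bp by simp
    finally show ?case by (simp add: mult.assoc)
  qed simp
  have Tnd: "d ((T ^^ n) f) ((T ^^ n) g) \<le> B ^ n * d f g" if "f \<in> H" "g \<in> H" for f g n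
    using TnB[OF diff_mem[OF that], of n] power_op(4)[OF T that] by (simp add: d_def)
  define U where "U q k = {x \<in> H. \<exists>n. d ((T ^^ n) x) q < 1 / real (Suc k)}" for q k
  have opn: "openin M.mtopology (U q k)" if q: "q \<in> H" for q k
    unfolding M.openin_mtopology
  proof (intro conjI allI impI)
    show "U q k \<subseteq> H" by (auto simp: U_def)
    fix x assume "x \<in> U q k"
    then obtain n where x: "x \<in> H" "d ((T ^^ n) x) q < 1 / real (Suc k)" by (auto simp: U_def)
    define r where "r = (1 / real (Suc k) - d ((T ^^ n) x) q) / B ^ n"
    have "r > 0" using x Bp by (simp add: r_def)
    moreover have "M.mball x r \<subseteq> U q k"
    proof
      fix y assume "y \<in> M.mball x r"
      then have y: "y \<in> H" "d y x < r"
        using x(1) nrm_minus_commute[of x y] by (auto simp: d'_def d_def)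
      have "d ((T ^^ n) y) q \<le> d ((T ^^ n) y) ((T ^^ n) x) + d ((T ^^ n) x) q"
        using power_op(1)[OF T] x y q by (intro dtri) auto
      also have "d ((T ^^ n) y) ((T ^^ n) x) \<le> B ^ n * d y x" using Tnd x y by blast
      also have "B ^ n * d y x < B ^ n * r" using y Bp by simp
      also have "B ^ n * r = 1 / real (Suc k) - d ((T ^^ n) x) q" using Bp by (simp add: r_def)
      finally show "y \<in> U q k" using y by (auto simp: U_def)
    qed
    ultimately show "\<exists>r>0. M.mball x r \<subseteq> U q k" by blast
  qed
  have dns: "M.mtopology closure_of (U q k) = H" if q: "q \<in> H" for q k
  proof -
    have "\<exists>y\<in>U q k. y \<in> M.mball f r" if f: "f \<in> H" "r > 0" for f r
    proof -
      have "min r (1 / real (Suc k)) > 0" using f by simp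
      then obtain x n where x: "x \<in> H" "nrm (\<lambda>z. x z - f z) < min r (1 / real (Suc k))"
          "nrm (\<lambda>z. (T ^^ n) x z - q z) < min r (1 / real (Suc k))"
        using trans[OF f(1) q] by blast
      then have "x \<in> U q k" "x \<in> M.mball f r"
        using f nrm_minus_commute[of x f] by (auto simp: U_def d'_def d_def)
      then show ?thesis by blast
    qed
    then show ?thesis unfolding M.metric_closure_of by blast
  qed
  have "M.mtopology closure_of \<Inter>((\<lambda>(q, k). U q k) ` (Q \<times> (UNIV :: nat set))) = H"
  proof (rule M.metric_Baire_category[OF mcomp])
    show "countable ((\<lambda>(q, k). U q k) ` (Q \<times> (UNIV :: nat set)))" using Q(1) by simp
    show "openin M.mtopology S \<and> M.mtopology closure_of S = H"
      if SQ: "S \<in> (\<lambda>(q, k). U q k) ` (Q \<times> (UNIV :: nat set))" for S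
    proof -
      obtain q k where S: "S = U q k" "q \<in> Q" using SQ by auto
      then have "q \<in> H" using Q(2) by auto
      then show ?thesis unfolding S(1) using opn dns by simp
    qed
  qed
  then have "\<Inter>((\<lambda>(q, k). U q k) ` (Q \<times> (UNIV :: nat set))) \<noteq> {}"
    using zero_mem by auto
  then obtain x where xO: "\<And>q k. q \<in> Q \<Longrightarrow> x \<in> U q k" by blast
  have "Q \<noteq> {}" using Q(3)[OF zero_mem, of 1] by auto
  then have xH: "x \<in> H" using xO by (auto simp: U_def)
  have "\<exists>n. nrm (\<lambda>z. (T ^^ n) x z - y z) < e" if y: "y \<in> H" "e > 0" for y e
  proof -
    have "e / 2 > 0" using y by simp
    then obtain q where q: "q \<in> Q" "nrm (\<lambda>z. q z - y z) < e / 2" using Q(3)[OF y(1), of "e / 2"] by auto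
    obtain k where k: "inverse (real (Suc k)) < e / 2" using reals_Archimedean[OF \<open>e / 2 > 0\<close>] by blast
    obtain n where n: "d ((T ^^ n) x) q < 1 / real (Suc k)" using xO[OF q(1), of k] by (auto simp: U_def)
    have "nrm (\<lambda>z. (T ^^ n) x z - y z) \<le> d ((T ^^ n) x) q + nrm (\<lambda>z. q z - y z)"
      unfolding d_def by (rule nrm_triangle_diff[OF power_op(1)[OF T xH] _ y(1)]) (use q(1) Q(2) in auto)
    then show ?thesis using q(2) k n by (intro exI[of _ n]) (simp add: inverse_eq_divide)
  qed
  then show ?thesis using T xH unfolding hypercyclic_on_def by blast
qed

text \<open>
  The criterion of Kitai and of Gethner and Shapiro. If \<open>T\<^sup>n x \<rightarrow> 0\<close>, \<open>T\<^sup>n (Y n) = y\<close> and \<open>Y n \<rightarrow> 0\<close>, then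
  \<open>x + Y n\<close> is eventually close to \<open>x\<close> while its image under \<open>T\<^sup>n\<close> is close to \<open>y\<close>.
\<close>

lemma hypercyclicity_criterion:
  assumes T: "bounded_operator_on H nrm T"
    and Q: "countable Q" "Q \<subseteq> H" "\<And>f \<epsilon>. f \<in> H \<Longrightarrow> \<epsilon> > 0 \<Longrightarrow> \<exists>q\<in>Q. nrm (\<lambda>z. q z - f z) < \<epsilon>"
    and A: "\<And>f \<epsilon>. f \<in> H \<Longrightarrow> \<epsilon> > 0 \<Longrightarrow> \<exists>x\<in>H. nrm (\<lambda>z. x z - f z) < \<epsilon> \<and> (\<lambda>n. nrm ((T ^^ n) x)) \<longlonglongrightarrow> 0"
    and B: "\<And>f \<epsilon>. f \<in> H \<Longrightarrow> \<epsilon> > 0 \<Longrightarrow> \<exists>y\<in>H. nrm (\<lambda>z. y z - f z) < \<epsilon> \<and>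
      (\<exists>Y. (\<forall>n. Y n \<in> H \<and> (T ^^ n) (Y n) = y) \<and> (\<lambda>n. nrm (Y n)) \<longlonglongrightarrow> 0)"
  shows "hypercyclic_on H nrm T"
proof (rule hypercyclic_if_transitive[OF T Q])
  fix f g and \<epsilon> :: real assume f: "f \<in> H" and g: "g \<in> H" and "\<epsilon> > 0"
  then have e2: "\<epsilon> / 2 > 0" by simp
  obtain x where x: "x \<in> H" "nrm (\<lambda>z. x z - f z) < \<epsilon> / 2" "(\<lambda>n. nrm ((T ^^ n) x)) \<longlonglongrightarrow> 0"
    using A[OF f e2] by blast
  obtain y where y: "y \<in> H" "nrm (\<lambda>z. y z - g z) < \<epsilon> / 2"
    and "\<exists>Y. (\<forall>n. Y n \<in> H \<and> (T ^^ n) (Y n) = y) \<and> (\<lambda>n. nrm (Y n)) \<longlonglongrightarrow> 0"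
    using B[OF g e2] by auto
  then obtain Y where Y: "\<forall>n. Y n \<in> H \<and> (T ^^ n) (Y n) = y" "(\<lambda>n. nrm (Y n)) \<longlonglongrightarrow> 0"
    by auto
  have YH: "Y n \<in> H" and TY: "(T ^^ n) (Y n) = y" for n using Y(1) by auto
  have "\<forall>\<^sub>F n in sequentially. nrm ((T ^^ n) x) < \<epsilon> / 2 \<and> nrm (Y n) < \<epsilon> / 2"
    using order_tendstoD(2)[OF x(3) e2] order_tendstoD(2)[OF Y(2) e2] by (rule eventually_conj)
  then obtain n where n: "nrm ((T ^^ n) x) < \<epsilon> / 2" "nrm (Y n) < \<epsilon> / 2"
    by (auto simp: eventually_sequentially)
  define w where "w = (\<lambda>z. x z + Y n z)"
  have w: "w \<in> H" unfolding w_def using x(1) YH by (rule add_mem)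
  have "nrm (\<lambda>z. w z - f z) \<le> nrm (\<lambda>z. x z - f z) + nrm (Y n)"
    using nrm_triangle[OF diff_mem[OF x(1) f] YH[of n]] by (simp add: w_def algebra_simps)
  moreover have "nrm (\<lambda>z. (T ^^ n) w z - g z) \<le> nrm (\<lambda>z. y z - g z) + nrm ((T ^^ n) x)"
    using nrm_triangle[OF diff_mem[OF y(1) g] power_op(1)[OF T x(1), of n]] power_op(2)[OF T x(1) YH, of n]
    by (simp add: w_def algebra_simps TY)
  ultimately show "\<exists>x\<in>H. \<exists>n. nrm (\<lambda>z. x z - f z) < \<epsilon> \<and> nrm (\<lambda>z. (T ^^ n) x z - g z) < \<epsilon>"
    using w n x(2) y(2) by (intro bexI[of _ w] exI[of _ n]) auto
qed

end

section \<open>The circle and the Hardy space\<close>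

lemma circle_measure_density:
  "circle_measure = distr (density lborel (\<lambda>x. ennreal (indicator {0..<2 * pi} x / (2 * pi)))) borel cis"
proof -
  have "(\<lambda>x. indicator {0..<2 * pi} x / ennreal (2 * pi)) = (\<lambda>x. ennreal (indicator {0..<2 * pi} x / (2 * pi)))"
    by (auto simp: fun_eq_iff divide_ennreal split: split_indicator)
       (metis divide_ennreal ennreal_1 mult_pos_pos pi_gt_zero zero_le_one zero_less_numeral)
  then show ?thesis
    unfolding circle_measure_def uniform_measure_def by simp
qed

lemma sets_circle_measure [simp, measurable_cong]: "sets circle_measure = sets borel"
  and space_circle_measure [simp]: "space circle_measure = UNIV"
  by (simp_all add: circle_measure_def)

lemma cis_borel [measurable]: "cis \<in> borel_measurable borel"
  by (intro borel_measurable_continuous_onI continuous_intros)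

lemma cnj_borel [measurable]: "cnj \<in> borel_measurable borel"
  by (intro borel_measurable_continuous_onI continuous_intros)

lemma nn_integral_circle:
  assumes [measurable]: "f \<in> borel_measurable borel"
  shows "(\<integral>\<^sup>+\<zeta>. f \<zeta> \<partial>circle_measure)
    = ennreal (1 / (2 * pi)) * (\<integral>\<^sup>+x. indicator {0..<2 * pi} x * f (cis x) \<partial>lborel)"
proof -
  have "(\<integral>\<^sup>+\<zeta>. f \<zeta> \<partial>circle_measure)
      = (\<integral>\<^sup>+x. ennreal (indicator {0..<2 * pi} x / (2 * pi)) * f (cis x) \<partial>lborel)"
    unfolding circle_measure_density by (subst nn_integral_distr) (auto simp: nn_integral_density)
  also have "\<dots> = (\<integral>\<^sup>+x. ennreal (1 / (2 * pi)) * (indicator {0..<2 * pi} x * f (cis x)) \<partial>lborel)"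
    by (intro nn_integral_cong) (auto split: split_indicator)
  finally show ?thesis by (simp add: nn_integral_cmult)
qed

lemma emeasure_circle_space: "emeasure circle_measure (space circle_measure) = 1"
proof -
  have "emeasure circle_measure (space circle_measure) = (\<integral>\<^sup>+\<zeta>. 1 \<partial>circle_measure)" by simp
  also have "\<dots> = ennreal (1 / (2 * pi)) * (\<integral>\<^sup>+x. indicator {0..<2 * pi} x \<partial>lborel)"
    by (subst nn_integral_circle) auto
  also have "\<dots> = 1" by (simp add: ennreal_mult[symmetric])
  finally show ?thesis .
qed

interpretation circle: finite_measure circle_measure
  by standard (use emeasure_circle_space in auto)

lemma circle_measure_space [simp]: "measure circle_measure UNIV = 1"
  using emeasure_circle_space by (simp add: measure_def)

lemma AE_circleI:
  assumes "{\<zeta>. P \<zeta>} \<in> sets borel" "AE x in lborel. x \<in> {0..<2 * pi} \<longrightarrow> P (cis x)"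
  shows "AE \<zeta> in circle_measure. P \<zeta>"
  unfolding circle_measure_def
  using assms by (subst AE_distr_iff) (auto intro!: AE_uniform_measureI)

lemma AE_circle_norm: "AE \<zeta> in circle_measure. cmod \<zeta> = 1"
  by (rule AE_circleI) auto

lemma integral_circle:
  fixes g :: "complex \<Rightarrow> 'b::euclidean_space"
  assumes [measurable]: "g \<in> borel_measurable borel"
    and cont: "continuous_on {0..2 * pi} (\<lambda>x. g (cis x))"
  shows "(\<integral>\<zeta>. g \<zeta> \<partial>circle_measure) = (1 / (2 * pi)) *\<^sub>R integral {0..2 * pi} (\<lambda>x. g (cis x))"
proof -
  have "(\<integral>\<zeta>. g \<zeta> \<partial>circle_measure) = (\<integral>x. (indicator {0..<2 * pi} x / (2 * pi)) *\<^sub>R g (cis x) \<partial>lborel)"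
    unfolding circle_measure_density by (subst integral_distr) (auto simp: integral_density)
  also have "\<dots> = (\<integral>x. (1 / (2 * pi)) *\<^sub>R (indicator {0..2 * pi} x *\<^sub>R g (cis x)) \<partial>lborel)"
  proof (intro integral_cong_AE)
    have "AE x in lborel. x \<noteq> 2 * pi" by (simp add: AE_lborel_singleton)
    then show "AE x in lborel. (indicator {0..<2 * pi} x / (2 * pi)) *\<^sub>R g (cis x)
        = (1 / (2 * pi)) *\<^sub>R (indicator {0..2 * pi} x *\<^sub>R g (cis x))"
      by eventually_elim (auto split: split_indicator)
  qed measurable
  also have "\<dots> = (1 / (2 * pi)) *\<^sub>R (LINT x:{0..2 * pi}|lborel. g (cis x))"
    unfolding set_lebesgue_integral_def by (rule integral_scaleR_right)
  also have "(LINT x:{0..2 * pi}|lborel. g (cis x)) = integral {0..2 * pi} (\<lambda>x. g (cis x))"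
    by (rule set_borel_integral_eq_integral) (rule borel_integrable_atLeastAtMost'[OF cont])
  finally show ?thesis .
qed

lemma circle_orthonormal:
  "(\<integral>\<zeta>. \<zeta> ^ j * cnj (\<zeta> ^ k) \<partial>circle_measure) = (if j = k then 1 else 0)"
proof -
  define m where "m = real j - real k"
  have e: "cis x ^ j * cnj (cis x ^ k) = cis (m * x)" for x
    by (simp add: m_def Complex.DeMoivre cis_cnj cis_mult algebra_simps)
  have "(\<integral>\<zeta>. \<zeta> ^ j * cnj (\<zeta> ^ k) \<partial>circle_measure)
      = (1 / (2 * pi)) *\<^sub>R integral {0..2 * pi} (\<lambda>x. cis (m * x))"
    by (subst integral_circle) (simp_all only: e, auto intro!: continuous_intros borel_measurable_continuous_onI)
  also have "integral {0..2 * pi} (\<lambda>x. cis (m * x)) = (if j = k then of_real (2 * pi) else 0)"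
  proof (cases "j = k")
    case True
    then show ?thesis by (simp add: m_def scaleR_conv_of_real)
  next
    case False
    then have m: "m \<noteq> 0" by (simp add: m_def)
    have "((\<lambda>x. cis (m * x)) has_integral
        cis (m * (2 * pi)) / (\<i> * of_real m) - cis (m * 0) / (\<i> * of_real m)) {0..2 * pi}"
    proof (rule fundamental_theorem_of_calculus)
      show "((\<lambda>x. cis (m * x) / (\<i> * of_real m)) has_vector_derivative cis (m * x)) (at x within {0..2 * pi})" for x
        unfolding cis_conv_exp using m
        by (auto intro!: derivative_eq_intros has_vector_derivative_real_field simp: field_simps)
    qed simp
    moreover have "cis (m * (2 * pi)) = 1"
    proof -
      have "m = of_int (int j - int k)" by (simp add: m_def)
      then show ?thesis
        by (metis cis_multiple_2pi Ints_of_int mult.commute)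
    qed
    ultimately show ?thesis using False by (simp add: integral_unique)
  qed
  finally show ?thesis by (simp add: scaleR_conv_of_real)
qed

subsection \<open>Taylor coefficients\<close>

definition coef :: "(complex \<Rightarrow> complex) \<Rightarrow> nat \<Rightarrow> complex" where
  "coef f n = (deriv ^^ n) f 0 / fact n"

lemma hol_disc_zero: "f \<in> hol_disc \<Longrightarrow> z \<notin> ball 0 1 \<Longrightarrow> f z = 0"
  and hol_disc_holomorphic: "f \<in> hol_disc \<Longrightarrow> f holomorphic_on ball 0 1"
  unfolding hol_disc_def by blast+

lemma hol_discI:
  "f holomorphic_on ball 0 1 \<Longrightarrow> (\<And>z. 1 \<le> cmod z \<Longrightarrow> f z = 0) \<Longrightarrow> f \<in> hol_disc"
  unfolding hol_disc_def by auto

lemma hol_disc_eqI: "f \<in> hol_disc \<Longrightarrow> g \<in> hol_disc \<Longrightarrow> (\<And>z. cmod z < 1 \<Longrightarrow> f z = g z) \<Longrightarrow> f = g"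
  by (rule ext) (metis hol_disc_zero mem_ball_0)

lemma coef_sums: "f \<in> hol_disc \<Longrightarrow> cmod z < 1 \<Longrightarrow> (\<lambda>n. coef f n * z ^ n) sums f z"
  using holomorphic_power_series[of f 0 1 z] hol_disc_holomorphic[of f] by (simp add: coef_def)


text \<open>
  A power series that vanishes identically on the disc has no nonzero coefficient, since its zeros
  would otherwise be isolated.
\<close>

lemma coef_unique:
  assumes f: "f \<in> hol_disc" and a: "\<And>z. cmod z < 1 \<Longrightarrow> (\<lambda>n. a n * z ^ n) sums f z"
  shows "coef f = a"
proof
  fix n
  define c where "c n = coef f n - a n" for n
  have c: "(\<lambda>n. c n * z ^ n) sums 0" if "cmod z < 1" for z
    using sums_diff[OF coef_sums[OF f that] a[OF that]] by (simp add: c_def algebra_simps)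
  have "c 0 = 0" using c[of 0] powser_sums_zero[of c] sums_unique2 by fastforce
  moreover have "c m = 0" if m: "m > 0" for m
  proof (rule ccontr)
    assume "c m \<noteq> 0"
    then obtain s where s: "0 < s" "\<And>z :: complex. z \<in> cball 0 s - {0} \<Longrightarrow> (\<lambda>z. 0::complex) z \<noteq> 0"
      using powser_0_nonzero[of 1 0 c "\<lambda>z. 0" m] c m by auto
    then show False using s(2)[of "complex_of_real s"] by simp
  qed
  ultimately have "c n = 0" by (cases n) auto
  then show "coef f n = a n" by (simp add: c_def)
qed

lemma hol_disc_eq_if_coef_eq: "f \<in> hol_disc \<Longrightarrow> g \<in> hol_disc \<Longrightarrow> coef f = coef g \<Longrightarrow> f = g"
  by (rule hol_disc_eqI) (metis coef_sums sums_unique2)+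

lemma zero_hol_disc: "(\<lambda>z. 0) \<in> hol_disc"
  and add_hol_disc: "f \<in> hol_disc \<Longrightarrow> g \<in> hol_disc \<Longrightarrow> (\<lambda>z. f z + g z) \<in> hol_disc"
  and scale_hol_disc: "f \<in> hol_disc \<Longrightarrow> (\<lambda>z. c * f z) \<in> hol_disc"
  and diff_hol_disc: "f \<in> hol_disc \<Longrightarrow> g \<in> hol_disc \<Longrightarrow> (\<lambda>z. f z - g z) \<in> hol_disc"
  and mult_hol_disc: "f \<in> hol_disc \<Longrightarrow> g \<in> hol_disc \<Longrightarrow> (\<lambda>z. f z * g z) \<in> hol_disc"
  unfolding hol_disc_def by (auto intro!: holomorphic_intros)

lemma coef_zero: "coef (\<lambda>z. 0) = (\<lambda>n. 0)"
  by (rule coef_unique) (auto simp: zero_hol_disc)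

lemma coef_add: "f \<in> hol_disc \<Longrightarrow> g \<in> hol_disc \<Longrightarrow> coef (\<lambda>z. f z + g z) = (\<lambda>n. coef f n + coef g n)"
  by (rule coef_unique) (auto simp: add_hol_disc distrib_right intro!: sums_add coef_sums)

lemma coef_diff: "f \<in> hol_disc \<Longrightarrow> g \<in> hol_disc \<Longrightarrow> coef (\<lambda>z. f z - g z) = (\<lambda>n. coef f n - coef g n)"
  by (rule coef_unique) (auto simp: diff_hol_disc left_diff_distrib intro!: sums_diff coef_sums)

lemma coef_scale: "f \<in> hol_disc \<Longrightarrow> coef (\<lambda>z. c * f z) = (\<lambda>n. c * coef f n)"
  by (rule coef_unique) (auto simp: scale_hol_disc mult.assoc intro!: sums_mult coef_sums)

definition zpow :: "nat \<Rightarrow> complex \<Rightarrow> complex" where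
  "zpow n z = (if cmod z < 1 then z ^ n else 0)"

lemma zpow_hol_disc: "zpow n \<in> hol_disc"
  by (rule hol_discI) (auto simp: zpow_def intro!: holomorphic_transform[of "\<lambda>z. z ^ n"] holomorphic_intros)

lemma coef_zpow: "coef (zpow n) = (\<lambda>k. if k = n then 1 else 0)"
proof (rule coef_unique[OF zpow_hol_disc])
  fix z :: complex assume "cmod z < 1"
  then show "(\<lambda>k. (if k = n then 1 else 0) * z ^ k) sums zpow n z"
    using sums_single[of n "\<lambda>k. z ^ k"] by (simp add: zpow_def if_distribR if_distrib[of "\<lambda>x. x * _"] cong: if_cong)
qed

lemma zpow_mult_hol_disc: "f \<in> hol_disc \<Longrightarrow> zpow k z * f z = z ^ k * f z"
  by (auto simp: zpow_def hol_disc_zero)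

lemma shift_hol_disc: "f \<in> hol_disc \<Longrightarrow> (\<lambda>z. z ^ k * f z) \<in> hol_disc"
  using mult_hol_disc[OF zpow_hol_disc, of f k] by (simp add: zpow_mult_hol_disc)

lemma coef_shift:
  assumes "f \<in> hol_disc"
  shows "coef (\<lambda>z. z ^ k * f z) = (\<lambda>n. if n < k then 0 else coef f (n - k))"
proof (rule coef_unique)
  fix z :: complex assume "cmod z < 1"
  then have "(\<lambda>n. z ^ k * (coef f n * z ^ n)) sums (z ^ k * f z)"
    by (intro sums_mult coef_sums assms)
  then have "(\<lambda>n. (if n + k < k then 0 else coef f (n + k - k)) * z ^ (n + k)) sums (z ^ k * f z)"
    by (simp add: power_add mult_ac)
  then show "(\<lambda>n. (if n < k then 0 else coef f (n - k)) * z ^ n) sums (z ^ k * f z)"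
    by (subst (asm) sums_iff_shift) simp
qed (use assms shift_hol_disc in auto)

definition of_coef :: "(nat \<Rightarrow> complex) \<Rightarrow> complex \<Rightarrow> complex" where
  "of_coef a z = (if cmod z < 1 then \<Sum>n. a n * z ^ n else 0)"

lemma
  assumes "\<And>n. cmod (a n) \<le> B"
  shows of_coef_hol_disc: "of_coef a \<in> hol_disc"
    and coef_of_coef: "coef (of_coef a) = a"
proof -
  have s: "(\<lambda>n. a n * z ^ n) sums of_coef a z" if "cmod z < 1" for z
  proof -
    have "summable (\<lambda>n. B * cmod z ^ n)" using that by (simp add: summable_mult)
    then have "summable (\<lambda>n. a n * z ^ n)"
      by (rule summable_comparison_test'[where N=0])
         (auto simp: norm_mult norm_power intro!: mult_right_mono assms)
    then show ?thesis using that by (simp add: of_coef_def summable_sums)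
  qed
  show h: "of_coef a \<in> hol_disc"
  proof (rule hol_discI)
    show "of_coef a holomorphic_on ball 0 1"
      by (rule power_series_holomorphic[of _ _ a]) (use s in auto)
  qed (auto simp: of_coef_def)
  show "coef (of_coef a) = a" by (rule coef_unique[OF h s])
qed

lemma coef_abs_summable:
  assumes "f \<in> hol_disc" "0 \<le> r" "r < 1"
  shows "summable (\<lambda>n. cmod (coef f n) * r ^ n)"
proof -
  have "summable (\<lambda>n. norm (coef f n * of_real r ^ n))"
  proof (rule powser_insidea)
    show "summable (\<lambda>n. coef f n * of_real ((1 + r) / 2) ^ n)"
      by (rule sums_summable[OF coef_sums[OF assms(1)]]) (use assms in \<open>simp only: norm_of_real; auto\<close>)
    show "norm (complex_of_real r) < norm (complex_of_real ((1 + r) / 2))"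
      using assms by (simp only: norm_of_real) auto
  qed
  then show ?thesis using assms by (simp add: norm_mult norm_power)
qed

subsection \<open>Integral means\<close>

lemma hol_disc_borel: "f \<in> hol_disc \<Longrightarrow> f \<in> borel_measurable borel"
proof -
  assume f: "f \<in> hol_disc"
  have "(\<lambda>z. indicator (ball 0 1) z *\<^sub>R f z) \<in> borel_measurable borel"
    using hol_disc_holomorphic[OF f]
    by (intro borel_measurable_continuous_on_indicator) (auto intro: holomorphic_on_imp_continuous_on)
  moreover have "(\<lambda>z. indicator (ball 0 1) z *\<^sub>R f z) = f"
    using hol_disc_zero[OF f] by (auto simp: fun_eq_iff split: split_indicator)
  ultimately show ?thesis by simp
qed

lemma circle_integrableI:
  fixes F :: "complex \<Rightarrow> complex"
  assumes "F \<in> borel_measurable borel" "\<And>\<zeta>. cmod \<zeta> = 1 \<Longrightarrow> cmod (F \<zeta>) \<le> B"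
  shows "integrable circle_measure F"
  using assms AE_circle_norm
  by (intro circle.integrable_const_bound[where B = B]) (auto elim: eventually_mono)

text \<open>
  Termwise integration; absolute summability of the coefficients dominates the series on the circle.
\<close>

lemma circle_series_inner:
  assumes F [measurable]: "F \<in> borel_measurable borel" and B: "\<And>\<zeta>. cmod \<zeta> = 1 \<Longrightarrow> cmod (F \<zeta>) \<le> B"
    and c: "summable (\<lambda>n. cmod (c n))"
  shows "(\<lambda>n. cnj (c n) * (\<integral>\<zeta>. F \<zeta> * cnj (\<zeta> ^ n) \<partial>circle_measure)) sums
    (\<integral>\<zeta>. F \<zeta> * cnj (\<Sum>n. c n * \<zeta> ^ n) \<partial>circle_measure)"
proof -
  define g where "g n \<zeta> = cnj (c n) * (F \<zeta> * cnj (\<zeta> ^ n))" for n \<zeta>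
  have [measurable]: "g n \<in> borel_measurable borel" for n
    unfolding g_def by measurable
  have gb: "cmod (g n \<zeta>) \<le> cmod (c n) * B" if "cmod \<zeta> = 1" for n \<zeta>
    using B[OF that] that by (auto simp: g_def norm_mult norm_power intro: mult_left_mono)
  have cB: "summable (\<lambda>n. cmod (c n) * B)" using c by (rule summable_mult2)
  have gi: "integrable circle_measure (g n)" for n
    by (rule circle_integrableI[OF _ gb]) auto
  have "(\<lambda>n. integral\<^sup>L circle_measure (g n)) sums (\<integral>\<zeta>. (\<Sum>n. g n \<zeta>) \<partial>circle_measure)"
  proof (rule sums_integral[OF gi])
    show "AE \<zeta> in circle_measure. summable (\<lambda>n. norm (g n \<zeta>))"
      using AE_circle_norm
    proof eventually_elim
      case (elim \<zeta>)
      show ?case by (rule summable_comparison_test'[OF cB, of 0]) (use gb[OF elim] in auto)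
    qed
    show "summable (\<lambda>n. \<integral>\<zeta>. norm (g n \<zeta>) \<partial>circle_measure)"
    proof (rule summable_comparison_test'[OF cB, of 0])
      fix n
      have "(\<integral>\<zeta>. norm (g n \<zeta>) \<partial>circle_measure) \<le> (\<integral>\<zeta>. cmod (c n) * B \<partial>circle_measure)"
        using AE_circle_norm by (intro integral_mono_AE integrable_norm gi) (auto elim!: eventually_mono intro: gb)
      then show "norm (\<integral>\<zeta>. norm (g n \<zeta>) \<partial>circle_measure) \<le> cmod (c n) * B" by simp
    qed
  qed
  moreover have "(\<integral>\<zeta>. (\<Sum>n. g n \<zeta>) \<partial>circle_measure) = (\<integral>\<zeta>. F \<zeta> * cnj (\<Sum>n. c n * \<zeta> ^ n) \<partial>circle_measure)"
  proof (rule integral_cong_AE)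
    show "AE \<zeta> in circle_measure. (\<Sum>n. g n \<zeta>) = F \<zeta> * cnj (\<Sum>n. c n * \<zeta> ^ n)"
      using AE_circle_norm
    proof eventually_elim
      case (elim \<zeta>)
      have "summable (\<lambda>n. cmod (c n * \<zeta> ^ n))" using c elim by (simp add: norm_mult norm_power)
      then have "(\<lambda>n. F \<zeta> * cnj (c n * \<zeta> ^ n)) sums (F \<zeta> * cnj (\<Sum>n. c n * \<zeta> ^ n))"
        by (intro sums_mult) (simp only: sums_cnj summable_sums summable_norm_cancel)
      then show ?case by (simp add: g_def sums_iff mult_ac)
    qed
  qed measurable
  moreover have "integral\<^sup>L circle_measure (g n) = cnj (c n) * (\<integral>\<zeta>. F \<zeta> * cnj (\<zeta> ^ n) \<partial>circle_measure)" for n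
    unfolding g_def by simp
  ultimately show ?thesis by simp
qed

definition circle_mean :: "real \<Rightarrow> (complex \<Rightarrow> complex) \<Rightarrow> (complex \<Rightarrow> complex) \<Rightarrow> complex" where
  "circle_mean r f g = (\<integral>\<zeta>. f (of_real r * \<zeta>) * cnj (g (of_real r * \<zeta>)) \<partial>circle_measure)"

lemma hol_disc_radius_bounded:
  assumes "f \<in> hol_disc" "0 \<le> r" "r < 1"
  obtains B where "\<And>\<zeta>. cmod \<zeta> = 1 \<Longrightarrow> cmod (f (of_real r * \<zeta>)) \<le> B"
proof -
  have "cmod (f (of_real r * \<zeta>)) \<le> (\<Sum>n. cmod (coef f n) * r ^ n)" if "cmod \<zeta> = 1" for \<zeta>
  proof -
    have "cmod (of_real r * \<zeta>) = r" using that assms by (simp add: norm_mult)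
    then have s: "(\<lambda>n. coef f n * (of_real r * \<zeta>) ^ n) sums f (of_real r * \<zeta>)"
      using coef_sums assms by simp
    have n: "norm (coef f n * (of_real r * \<zeta>) ^ n) = cmod (coef f n) * r ^ n" for n
      using that assms by (simp add: norm_mult norm_power)
    show ?thesis
      using summable_norm[of "\<lambda>n. coef f n * (of_real r * \<zeta>) ^ n"] coef_abs_summable[OF assms]
      by (simp add: n sums_unique[OF s, symmetric])
  qed
  then show thesis using that by blast
qed

lemma dilate_borel [measurable (raw)]:
  "f \<in> hol_disc \<Longrightarrow> (\<lambda>\<zeta>. f (of_real r * \<zeta>)) \<in> borel_measurable borel"
  by (rule measurable_compose[OF _ hol_disc_borel]) measurable

lemma circle_mean_integrable:
  assumes "f \<in> hol_disc" "g \<in> hol_disc" "0 \<le> r" "r < 1"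
  shows "integrable circle_measure (\<lambda>\<zeta>. f (of_real r * \<zeta>) * cnj (g (of_real r * \<zeta>)))"
proof -
  obtain A where A: "\<And>\<zeta>. cmod \<zeta> = 1 \<Longrightarrow> cmod (f (of_real r * \<zeta>)) \<le> A"
    using hol_disc_radius_bounded[OF assms(1,3,4)] by blast
  obtain B where B: "\<And>\<zeta>. cmod \<zeta> = 1 \<Longrightarrow> cmod (g (of_real r * \<zeta>)) \<le> B"
    using hol_disc_radius_bounded[OF assms(2,3,4)] by blast
  show ?thesis
  proof (rule circle_integrableI)
    show "(\<lambda>\<zeta>. f (of_real r * \<zeta>) * cnj (g (of_real r * \<zeta>))) \<in> borel_measurable borel"
      using assms by measurable
    show "cmod (f (of_real r * \<zeta>) * cnj (g (of_real r * \<zeta>))) \<le> A * B" if "cmod \<zeta> = 1" for \<zeta>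
      using A[OF that] B[OF that] unfolding norm_mult complex_mod_cnj by (intro mult_mono') auto
  qed
qed

text \<open>
  Parseval's identity on the circle of radius \<open>r\<close>. It is obtained by two termwise integrations, the first of
  which identifies the Fourier coefficients of \<open>\<zeta> \<mapsto> f (r \<zeta>)\<close>.
\<close>

lemma circle_mean_sums:
  assumes f: "f \<in> hol_disc" and g: "g \<in> hol_disc" and r: "0 \<le> r" "r < 1"
  shows "(\<lambda>n. coef f n * cnj (coef g n) * of_real (r ^ (2 * n))) sums circle_mean r f g"
proof -
  have series: "(\<Sum>n. (coef h n * of_real r ^ n) * \<zeta> ^ n) = h (of_real r * \<zeta>)"
    if "h \<in> hol_disc" "cmod \<zeta> = 1" for h \<zeta>
    using coef_sums[OF that(1), of "of_real r * \<zeta>"] that r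
    by (simp add: norm_mult sums_iff power_mult_distrib mult.assoc)
  have ab: "summable (\<lambda>n. cmod (coef h n * of_real r ^ n))" if "h \<in> hol_disc" for h
    using coef_abs_summable[OF that r] r by (simp add: norm_mult norm_power)
  have ae: "(\<integral>\<zeta>. F \<zeta> * cnj (\<Sum>n. (coef h n * of_real r ^ n) * \<zeta> ^ n) \<partial>circle_measure)
      = (\<integral>\<zeta>. F \<zeta> * cnj (h (of_real r * \<zeta>)) \<partial>circle_measure)"
    if h: "h \<in> hol_disc" and [measurable]: "F \<in> borel_measurable borel" for F h
  proof (rule integral_cong_AE)
    show "AE \<zeta> in circle_measure. F \<zeta> * cnj (\<Sum>n. (coef h n * of_real r ^ n) * \<zeta> ^ n) = F \<zeta> * cnj (h (of_real r * \<zeta>))"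
      using AE_circle_norm by eventually_elim (simp add: series h)
    show "(\<lambda>\<zeta>. F \<zeta> * cnj (\<Sum>n. coef h n * of_real r ^ n * \<zeta> ^ n)) \<in> borel_measurable circle_measure"
      by measurable
    have [measurable]: "(\<lambda>\<zeta>. h (of_real r * \<zeta>)) \<in> borel_measurable borel" using h by (rule dilate_borel)
    show "(\<lambda>\<zeta>. F \<zeta> * cnj (h (of_real r * \<zeta>))) \<in> borel_measurable circle_measure"
      by measurable
  qed
  have mom: "(\<integral>\<zeta>. f (of_real r * \<zeta>) * cnj (\<zeta> ^ k) \<partial>circle_measure) = coef f k * of_real r ^ k" for k
  proof -
    have "(\<lambda>n. cnj (coef f n * of_real r ^ n) * (\<integral>\<zeta>. \<zeta> ^ k * cnj (\<zeta> ^ n) \<partial>circle_measure)) sums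
        (\<integral>\<zeta>. \<zeta> ^ k * cnj (\<Sum>n. (coef f n * of_real r ^ n) * \<zeta> ^ n) \<partial>circle_measure)"
      by (rule circle_series_inner[of _ 1]) (auto simp: norm_power intro!: ab f)
    moreover have "(\<lambda>n. cnj (coef f n * of_real r ^ n) * (\<integral>\<zeta>. \<zeta> ^ k * cnj (\<zeta> ^ n) \<partial>circle_measure))
        = (\<lambda>n. if n = k then cnj (coef f n * of_real r ^ n) else 0)"
      by (auto simp: circle_orthonormal fun_eq_iff simp del: complex_cnj_power)
    moreover have "(\<lambda>n. if n = k then cnj (coef f n * of_real r ^ n) else 0) sums cnj (coef f k * of_real r ^ k)"
      by (rule sums_single)
    ultimately have "(\<integral>\<zeta>. \<zeta> ^ k * cnj (\<Sum>n. (coef f n * of_real r ^ n) * \<zeta> ^ n) \<partial>circle_measure)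
        = cnj (coef f k * of_real r ^ k)"
      by (simp only: sums_unique2)
    then have "cnj (\<integral>\<zeta>. \<zeta> ^ k * cnj (f (of_real r * \<zeta>)) \<partial>circle_measure) = coef f k * of_real r ^ k"
      by (simp add: ae f)
    moreover have "cnj (\<integral>\<zeta>. \<zeta> ^ k * cnj (f (of_real r * \<zeta>)) \<partial>circle_measure)
        = (\<integral>\<zeta>. cnj (\<zeta> ^ k * cnj (f (of_real r * \<zeta>))) \<partial>circle_measure)"
      by (rule Bochner_Integration.integral_cnj[symmetric])
    ultimately show ?thesis by (simp add: mult.commute)
  qed
  obtain B where B: "\<And>\<zeta>. cmod \<zeta> = 1 \<Longrightarrow> cmod (f (of_real r * \<zeta>)) \<le> B"
    using hol_disc_radius_bounded[OF f r] by blast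
  have "(\<lambda>n. cnj (coef g n * of_real r ^ n) * (\<integral>\<zeta>. f (of_real r * \<zeta>) * cnj (\<zeta> ^ n) \<partial>circle_measure)) sums
      (\<integral>\<zeta>. f (of_real r * \<zeta>) * cnj (\<Sum>n. (coef g n * of_real r ^ n) * \<zeta> ^ n) \<partial>circle_measure)"
    by (rule circle_series_inner[of _ B]) (use f ab g B in auto)
  also have "(\<integral>\<zeta>. f (of_real r * \<zeta>) * cnj (\<Sum>n. (coef g n * of_real r ^ n) * \<zeta> ^ n) \<partial>circle_measure)
      = circle_mean r f g"
    unfolding circle_mean_def by (rule ae[OF g dilate_borel[OF f]])
  finally have "(\<lambda>n. cnj (coef g n * of_real r ^ n) * (coef f n * of_real r ^ n)) sums circle_mean r f g"
    unfolding mom .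
  moreover have "cnj (coef g n * of_real r ^ n) * (coef f n * of_real r ^ n)
      = coef f n * cnj (coef g n) * of_real (r ^ (2 * n))" for n
  proof -
    have "complex_of_real (r ^ (2 * n)) = of_real r ^ n * of_real r ^ n" by (simp add: mult_2 power_add)
    then show ?thesis by (simp only: complex_cnj_mult complex_cnj_power complex_cnj_complex_of_real mult_ac)
  qed
  ultimately show ?thesis by (simp only:)
qed


lemma circle_mean_self:
  assumes "f \<in> hol_disc"
  shows "circle_mean r f f = of_real (\<integral>\<zeta>. (cmod (f (of_real r * \<zeta>)))\<^sup>2 \<partial>circle_measure)"
  unfolding circle_mean_def by (simp add: complex_norm_square[symmetric] flip: of_real_power)

subsection \<open>The Hardy space as a Hilbert space\<close>

definition H2ip :: "(complex \<Rightarrow> complex) \<Rightarrow> (complex \<Rightarrow> complex) \<Rightarrow> complex" where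
  "H2ip f g = (\<Sum>n. coef f n * cnj (coef g n))"

lemma mean_square_sums:
  assumes f: "f \<in> hol_disc" and r: "0 \<le> r" "r < 1"
  shows "(\<lambda>n. (cmod (coef f n))\<^sup>2 * r ^ (2 * n)) sums (\<integral>\<zeta>. (cmod (f (of_real r * \<zeta>)))\<^sup>2 \<partial>circle_measure)"
proof -
  have "(\<lambda>n. complex_of_real ((cmod (coef f n))\<^sup>2 * r ^ (2 * n))) sums
      of_real (\<integral>\<zeta>. (cmod (f (of_real r * \<zeta>)))\<^sup>2 \<partial>circle_measure)"
    using circle_mean_sums[OF f f r] unfolding circle_mean_self[OF f]
    by (simp add: complex_norm_square[symmetric])
  then show ?thesis by (simp only: sums_of_real_iff)
qed

text \<open>
  By Parseval the integral means increase to \<open>\<Sum>\<bar>a\<^sub>n\<bar>\<^sup>2\<close> as \<open>r\<close> tends to \<open>1\<close>, so they are bounded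
  exactly if this sum is finite.
\<close>

lemma H2_iff: "f \<in> H2 \<longleftrightarrow> f \<in> hol_disc \<and> summable (\<lambda>n. (cmod (coef f n))\<^sup>2)"
proof (cases "f \<in> hol_disc")
  case f: True
  let ?I = "\<lambda>r. \<integral>\<zeta>. (cmod (f (of_real r * \<zeta>)))\<^sup>2 \<partial>circle_measure"
  have "bdd_above (?I ` {0..<1}) \<longleftrightarrow> summable (\<lambda>n. (cmod (coef f n))\<^sup>2)"
  proof
    assume "bdd_above (?I ` {0..<1})"
    then obtain B where "\<forall>x\<in>?I ` {0..<1}. x \<le> B" unfolding bdd_above_def by blast
    then have B: "?I r \<le> B" if "0 \<le> r" "r < 1" for r using that by auto
    have "(\<Sum>n<N. (cmod (coef f n))\<^sup>2) \<le> B" for N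
    proof (rule tendsto_upperbound)
      show "((\<lambda>r. \<Sum>n<N. (cmod (coef f n))\<^sup>2 * r ^ (2 * n)) \<longlongrightarrow> (\<Sum>n<N. (cmod (coef f n))\<^sup>2)) (at_left 1)"
        by (auto intro!: tendsto_eq_intros)
      have "\<forall>\<^sub>F r :: real in at_left 1. 0 < r \<and> r < 1"
        using eventually_at_left_real[of 0 1] by simp
      then show "\<forall>\<^sub>F r in at_left 1. (\<Sum>n<N. (cmod (coef f n))\<^sup>2 * r ^ (2 * n)) \<le> B"
      proof eventually_elim
        case (elim r)
        have "(\<Sum>n<N. (cmod (coef f n))\<^sup>2 * r ^ (2 * n)) \<le> ?I r"
          unfolding sums_unique[OF mean_square_sums[OF f less_imp_le[OF elim[THEN conjunct1]] elim[THEN conjunct2]]]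
          by (rule sum_le_suminf[OF sums_summable[OF mean_square_sums[OF f]]]) (use elim in auto)
        then show ?case using B[of r] elim by linarith
      qed
    qed simp
    from this[of "Suc _"] show "summable (\<lambda>n. (cmod (coef f n))\<^sup>2)"
      by (intro bounded_imp_summable[of _ B]) (simp_all only: lessThan_Suc_atMost zero_le_power2)
  next
    assume s: "summable (\<lambda>n. (cmod (coef f n))\<^sup>2)"
    have "?I r \<le> (\<Sum>n. (cmod (coef f n))\<^sup>2)" if "0 \<le> r" "r < 1" for r
    proof (rule sums_le[OF _ mean_square_sums[OF f that] summable_sums[OF s]])
      show "(cmod (coef f n))\<^sup>2 * r ^ (2 * n) \<le> (cmod (coef f n))\<^sup>2" for n
        using that by (intro mult_left_le power_le_one) auto
    qed
    then show "bdd_above (?I ` {0..<1})" by (intro bdd_aboveI2[where M = "\<Sum>n. (cmod (coef f n))\<^sup>2"]) auto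
  qed
  then show ?thesis using f by (simp add: H2_def)
qed (simp add: H2_def)

lemma H2_hol_disc: "f \<in> H2 \<Longrightarrow> f \<in> hol_disc"
  and H2_summable: "f \<in> H2 \<Longrightarrow> summable (\<lambda>n. (cmod (coef f n))\<^sup>2)"
  by (simp_all add: H2_iff)

lemma summable_mult_l2:
  fixes a b :: "nat \<Rightarrow> complex"
  assumes "summable (\<lambda>n. (cmod (a n))\<^sup>2)" "summable (\<lambda>n. (cmod (b n))\<^sup>2)"
  shows "summable (\<lambda>n. cmod (a n) * cmod (b n))" "summable (\<lambda>n. (cmod (a n + b n))\<^sup>2)"
proof -
  have s: "summable (\<lambda>n. 2 * ((cmod (a n))\<^sup>2 + (cmod (b n))\<^sup>2))"
    using assms by (intro summable_mult summable_add)
  have le: "2 * (cmod (a n) * cmod (b n)) \<le> (cmod (a n))\<^sup>2 + (cmod (b n))\<^sup>2" for n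
    using sum_squares_bound[of "cmod (a n)" "cmod (b n)"] by (simp add: mult.assoc)
  show "summable (\<lambda>n. cmod (a n) * cmod (b n))"
  proof (rule summable_comparison_test'[OF s, of 0])
    fix n
    have "0 \<le> cmod (a n) * cmod (b n)" by simp
    then have "cmod (a n) * cmod (b n) \<le> 2 * ((cmod (a n))\<^sup>2 + (cmod (b n))\<^sup>2)" using le[of n] by argo
    then show "norm (cmod (a n) * cmod (b n)) \<le> 2 * ((cmod (a n))\<^sup>2 + (cmod (b n))\<^sup>2)" by simp
  qed
  show "summable (\<lambda>n. (cmod (a n + b n))\<^sup>2)"
  proof (rule summable_comparison_test'[OF s, of 0])
    fix n
    have "(cmod (a n + b n))\<^sup>2 \<le> (cmod (a n) + cmod (b n))\<^sup>2"
      by (intro power_mono norm_triangle_ineq) auto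
    then show "norm ((cmod (a n + b n))\<^sup>2) \<le> 2 * ((cmod (a n))\<^sup>2 + (cmod (b n))\<^sup>2)"
      using le[of n] by (simp add: power2_sum)
  qed
qed

lemma H2ip_summable:
  assumes "f \<in> H2" "g \<in> H2"
  shows "summable (\<lambda>n. cmod (coef f n * cnj (coef g n)))"
  using summable_mult_l2(1)[OF H2_summable[OF assms(1)] H2_summable[OF assms(2)]] by (simp add: norm_mult)

lemma H2ip_sums: "f \<in> H2 \<Longrightarrow> g \<in> H2 \<Longrightarrow> (\<lambda>n. coef f n * cnj (coef g n)) sums H2ip f g"
  unfolding H2ip_def by (intro summable_sums summable_norm_cancel[OF H2ip_summable])

text \<open>
  The inner product as a limit of integrals inside the disc. This is how pointwise inequalities
  between functions on the disc become inequalities between norms.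
\<close>

lemma circle_mean_tendsto:
  assumes f: "f \<in> H2" and g: "g \<in> H2"
  shows "((\<lambda>r. circle_mean r f g) \<longlongrightarrow> H2ip f g) (at_left 1)"
proof -
  define a where "a n r = coef f n * cnj (coef g n) * of_real (r ^ (2 * n))" for n and r :: real
  have ev: "\<forall>\<^sub>F r :: real in at_left 1. 0 < r \<and> r < 1"
    using eventually_at_left_real[of 0 1] by simp
  have "((\<lambda>r. suminf (\<lambda>n. a n r)) \<longlongrightarrow> suminf (\<lambda>n. coef f n * cnj (coef g n))) (at_left 1)"
  proof (rule tannerys_theorem[THEN conjunct2, THEN conjunct2])
    show "((\<lambda>r. a n r) \<longlongrightarrow> coef f n * cnj (coef g n)) (at_left 1)" for n
      unfolding a_def by (auto intro!: tendsto_eq_intros)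
    have "\<forall>\<^sub>F (x, y) in sequentially \<times>\<^sub>F at_left (1::real). 0 < y \<and> y < 1"
      using eventually_prodI[OF always_eventually[of "\<lambda>_. True"] ev, of sequentially]
      by (simp add: case_prod_unfold)
    then show "\<forall>\<^sub>F (n, r) in sequentially \<times>\<^sub>F at_left 1. norm (a n r) \<le> cmod (coef f n * cnj (coef g n))"
    proof eventually_elim
      case (elim x)
      then show ?case
        by (cases x) (auto simp: a_def norm_mult norm_power intro!: mult_left_le power_le_one)
    qed
  qed (use H2ip_summable[OF f g] in auto)
  moreover have "\<forall>\<^sub>F r in at_left 1. suminf (\<lambda>n. a n r) = circle_mean r f g"
    using ev
  proof eventually_elim
    case (elim r)
    then show ?case
      using circle_mean_sums[OF H2_hol_disc[OF f] H2_hol_disc[OF g], of r] by (simp add: a_def sums_iff)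
  qed
  ultimately show ?thesis unfolding H2ip_def by (rule Lim_transform_eventually)
qed

lemma add_H2: "f \<in> H2 \<Longrightarrow> g \<in> H2 \<Longrightarrow> (\<lambda>z. f z + g z) \<in> H2"
  by (simp add: H2_iff add_hol_disc coef_add summable_mult_l2(2))

lemma scale_H2: "f \<in> H2 \<Longrightarrow> (\<lambda>z. c * f z) \<in> H2"
  by (simp add: H2_iff scale_hol_disc coef_scale norm_mult power_mult_distrib summable_mult)

lemma of_coef_H2:
  assumes "summable (\<lambda>n. (cmod (a n))\<^sup>2)"
  shows "of_coef a \<in> H2" "coef (of_coef a) = a"
proof -
  have "\<exists>B. \<forall>n. cmod (a n) \<le> B"
  proof -
    have "(\<lambda>n. (cmod (a n))\<^sup>2) \<longlonglongrightarrow> 0" using assms by (rule summable_LIMSEQ_zero)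
    then have "(\<lambda>n. sqrt ((cmod (a n))\<^sup>2)) \<longlonglongrightarrow> sqrt 0" by (rule tendsto_real_sqrt)
    then have "Bseq a" by (intro convergent_imp_Bseq convergentI[of a 0]) (simp add: tendsto_norm_zero_iff)
    then show ?thesis by (auto simp: Bseq_def)
  qed
  then obtain B where B: "\<And>n. cmod (a n) \<le> B" by blast
  show "coef (of_coef a) = a" using B by (rule coef_of_coef)
  then show "of_coef a \<in> H2" using assms of_coef_hol_disc[of a B] B by (simp add: H2_iff)
qed

lemma H2ip_self: "f \<in> H2 \<Longrightarrow> Re (H2ip f f) = (\<Sum>n. (cmod (coef f n))\<^sup>2)"
  using sums_Re[OF H2ip_sums[of f f]] by (simp add: sums_iff complex_norm_square[symmetric])

text \<open>
  Completeness of square-summable sequences: the coefficients converge one by one, and the Cauchy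
  estimate for finite partial sums passes to the limit.
\<close>

lemma H2_Cauchy_convergent:
  assumes X: "\<And>n. X n \<in> H2"
    and cau: "\<And>e. e > 0 \<Longrightarrow> \<exists>N. \<forall>m\<ge>N. \<forall>n\<ge>N. ip_norm H2ip (\<lambda>z. X m z - X n z) < e"
  shows "\<exists>f\<in>H2. (\<lambda>n. ip_norm H2ip (\<lambda>z. X n z - f z)) \<longlonglongrightarrow> 0"
proof -
  have diff: "(\<lambda>z. f z - g z) \<in> H2" if "f \<in> H2" "g \<in> H2" for f g
    using add_H2[OF that(1) scale_H2[OF that(2), of "-1"]] by simp
  define D where "D m n k = cmod (coef (X m) k - coef (X n) k)" for m n k
  have nn: "ip_norm H2ip (\<lambda>z. f z - g z) = sqrt (\<Sum>k. (cmod (coef f k - coef g k))\<^sup>2)"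
    and sm: "summable (\<lambda>k. (cmod (coef f k - coef g k))\<^sup>2)" if "f \<in> H2" "g \<in> H2" for f g
    using H2ip_self[OF diff[OF that]] H2_summable[OF diff[OF that]] that
    by (simp_all add: ip_norm_def coef_diff H2_hol_disc)
  have part: "(\<Sum>k<K. (D m n k)\<^sup>2) < e\<^sup>2" if "ip_norm H2ip (\<lambda>z. X m z - X n z) < e" for m n K e
  proof -
    have "sqrt (\<Sum>k. (D m n k)\<^sup>2) < e" using that nn[OF X X] by (simp add: D_def)
    moreover have "(\<Sum>k<K. (D m n k)\<^sup>2) \<le> (\<Sum>k. (D m n k)\<^sup>2)"
      using sm[OF X X] unfolding D_def by (intro sum_le_suminf) auto
    moreover have "0 \<le> (\<Sum>k. (D m n k)\<^sup>2)" using sm[OF X X] unfolding D_def by (intro suminf_nonneg) auto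
    ultimately show ?thesis using power_strict_mono[of "sqrt (\<Sum>k. (D m n k)\<^sup>2)" e 2] by simp
  qed
  have "Cauchy (\<lambda>n. coef (X n) k)" for k
  proof (rule metric_CauchyI)
    fix e :: real assume e: "e > 0"
    then obtain N where N: "\<And>m n. m \<ge> N \<Longrightarrow> n \<ge> N \<Longrightarrow> ip_norm H2ip (\<lambda>z. X m z - X n z) < e"
      using cau by blast
    have "dist (coef (X m) k) (coef (X n) k) < e" if "m \<ge> N" "n \<ge> N" for m n
    proof -
      have "(D m n k)\<^sup>2 \<le> (\<Sum>k<Suc k. (D m n k)\<^sup>2)" by (rule member_le_sum) auto
      also have "\<dots> < e\<^sup>2" by (rule part[OF N[OF that]])
      finally show ?thesis using e by (simp add: D_def dist_norm power2_less_imp_less)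
    qed
    then show "\<exists>N. \<forall>m\<ge>N. \<forall>n\<ge>N. dist (coef (X m) k) (coef (X n) k) < e" by blast
  qed
  then have "\<exists>l. (\<lambda>n. coef (X n) k) \<longlonglongrightarrow> l" for k
    using Cauchy_convergent convergent_def by blast
  then obtain a where a: "\<And>k. (\<lambda>n. coef (X n) k) \<longlonglongrightarrow> a k" by metis
  have bnd: "(\<Sum>k<K. (cmod (coef (X n) k - a k))\<^sup>2) \<le> e\<^sup>2"
    if "\<And>m. m \<ge> N \<Longrightarrow> ip_norm H2ip (\<lambda>z. X n z - X m z) < e" for n N K e
  proof (rule LIMSEQ_le_const2)
    show "(\<lambda>m. \<Sum>k<K. (D n m k)\<^sup>2) \<longlonglongrightarrow> (\<Sum>k<K. (cmod (coef (X n) k - a k))\<^sup>2)"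
      unfolding D_def by (intro tendsto_intros a)
    show "\<exists>N. \<forall>m\<ge>N. (\<Sum>k<K. (D n m k)\<^sup>2) \<le> e\<^sup>2"
      using part[OF that] less_imp_le by blast
  qed
  have sum_a: "summable (\<lambda>k. (cmod (coef (X n) k - a k))\<^sup>2)"
    and sum_le: "(\<Sum>k. (cmod (coef (X n) k - a k))\<^sup>2) \<le> e\<^sup>2"
    if "\<And>m. m \<ge> N \<Longrightarrow> ip_norm H2ip (\<lambda>z. X n z - X m z) < e" for n N e
  proof -
    note b = bnd[of N n e, OF that]
    show s: "summable (\<lambda>k. (cmod (coef (X n) k - a k))\<^sup>2)"
      using b[of "Suc _"]
      by (intro bounded_imp_summable[of _ "e\<^sup>2"]) (simp_all only: lessThan_Suc_atMost zero_le_power2)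
    show "(\<Sum>k. (cmod (coef (X n) k - a k))\<^sup>2) \<le> e\<^sup>2"
      by (rule suminf_le_const[OF s b])
  qed
  obtain N1 where N1: "\<And>m n. m \<ge> N1 \<Longrightarrow> n \<ge> N1 \<Longrightarrow> ip_norm H2ip (\<lambda>z. X m z - X n z) < 1"
    using cau[of 1] by auto
  have "summable (\<lambda>k. (cmod (coef (X N1) k + (-1) * (coef (X N1) k - a k)))\<^sup>2)"
    using sum_a[of N1 N1 1] N1 by (intro summable_mult_l2(2) H2_summable X) (simp add: norm_minus_commute)
  then have sa: "summable (\<lambda>k. (cmod (a k))\<^sup>2)" by simp
  define f where "f = of_coef a"
  have f: "f \<in> H2" "coef f = a" using of_coef_H2[OF sa] by (simp_all add: f_def)
  have "(\<lambda>n. ip_norm H2ip (\<lambda>z. X n z - f z)) \<longlonglongrightarrow> 0"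
  proof (rule LIMSEQ_I)
    fix e :: real assume "e > 0"
    then have e2: "e / 2 > 0" by simp
    obtain N where N: "\<And>m n. m \<ge> N \<Longrightarrow> n \<ge> N \<Longrightarrow> ip_norm H2ip (\<lambda>z. X m z - X n z) < e / 2"
      using cau[OF e2] by auto
    have "norm (ip_norm H2ip (\<lambda>z. X n z - f z) - 0) < e" if n: "n \<ge> N" for n
    proof -
      have "(\<Sum>k. (cmod (coef (X n) k - a k))\<^sup>2) \<le> (e / 2)\<^sup>2"
        using sum_le[of N n "e / 2"] N n by blast
      then have "ip_norm H2ip (\<lambda>z. X n z - f z) \<le> e / 2"
        unfolding nn[OF X f(1)] f(2) using e2 by (intro real_le_lsqrt) (auto intro: suminf_nonneg sum_a[of N n "e/2"] N n)
      moreover have "0 \<le> ip_norm H2ip (\<lambda>z. X n z - f z)"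
        unfolding nn[OF X f(1)] by (intro real_sqrt_ge_zero suminf_nonneg sm X f) auto
      ultimately show ?thesis using e2 by simp
    qed
    then show "\<exists>N. \<forall>n\<ge>N. norm (ip_norm H2ip (\<lambda>z. X n z - f z) - 0) < e" by blast
  qed
  then show ?thesis using f by blast
qed

lemma H2_analytic_hilbert_space: "analytic_hilbert_space H2 H2ip"
  unfolding analytic_hilbert_space_def
proof (intro conjI ballI allI impI)
  show "H2 \<subseteq> hol_disc" using H2_hol_disc by blast
  show "(\<lambda>z. 0) \<in> H2" by (simp add: H2_iff zero_hol_disc coef_zero)
  show "(\<lambda>z. f z + g z) \<in> H2" if "f \<in> H2" "g \<in> H2" for f g using add_H2 that .
  show "(\<lambda>z. c * f z) \<in> H2" if "f \<in> H2" for f c using scale_H2 that .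
  show "H2ip (\<lambda>z. f z + g z) h = H2ip f h + H2ip g h" if "f \<in> H2" "g \<in> H2" "h \<in> H2" for f g h
    using sums_unique2[OF H2ip_sums[OF add_H2[OF that(1,2)] that(3)]]
      sums_add[OF H2ip_sums[OF that(1,3)] H2ip_sums[OF that(2,3)]] that
    by (simp add: coef_add H2_hol_disc distrib_right)
  show "H2ip (\<lambda>z. c * f z) g = c * H2ip f g" if "f \<in> H2" "g \<in> H2" for f g c
    using sums_unique2[OF H2ip_sums[OF scale_H2[OF that(1)] that(2)]]
      sums_mult[OF H2ip_sums[OF that], of c] that
    by (simp add: coef_scale H2_hol_disc mult.assoc)
  show "H2ip g f = cnj (H2ip f g)" if "f \<in> H2" "g \<in> H2" for f g
    using sums_unique2[OF H2ip_sums[OF that(2,1)]] sums_cnj[THEN iffD2, OF H2ip_sums[OF that]]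
    by (simp add: mult.commute)
  show "0 \<le> Re (H2ip f f)" if "f \<in> H2" for f
    using H2ip_self[OF that] H2_summable[OF that] by (simp add: suminf_nonneg)
  show "f = (\<lambda>z. 0)" if f: "f \<in> H2" and "H2ip f f = 0" for f
  proof -
    have "(\<Sum>n. (cmod (coef f n))\<^sup>2) = 0" using that H2ip_self[OF f] by simp
    then have "coef f n = 0" for n using suminf_eq_zero_iff[OF H2_summable[OF f]] by simp
    then show ?thesis
      using f by (intro hol_disc_eq_if_coef_eq) (auto simp: H2_hol_disc zero_hol_disc coef_zero)
  qed
  show "\<exists>f\<in>H2. (\<lambda>n. ip_norm H2ip (\<lambda>z. X n z - f z)) \<longlonglongrightarrow> 0"
    if "(\<forall>n. X n \<in> H2) \<and>
        (\<forall>e>0. \<exists>N. \<forall>m\<ge>N. \<forall>n\<ge>N. ip_norm H2ip (\<lambda>z. X m z - X n z) < e)" for X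
    by (rule H2_Cauchy_convergent) (use that in blast)+
qed

interpretation H2: function_hilbert_space H2 H2ip
  by standard (rule H2_analytic_hilbert_space)


abbreviation H2norm :: "(complex \<Rightarrow> complex) \<Rightarrow> real" where "H2norm \<equiv> ip_norm H2ip"

lemma H2norm_sq: "f \<in> H2 \<Longrightarrow> (H2norm f)\<^sup>2 = (\<Sum>n. (cmod (coef f n))\<^sup>2)"
  using H2.ip_self[of f] H2ip_self[of f] by simp

lemma coef_le_H2norm:
  assumes "f \<in> H2" shows "cmod (coef f n) \<le> H2norm f"
proof -
  have "(cmod (coef f n))\<^sup>2 \<le> (\<Sum>n. (cmod (coef f n))\<^sup>2)"
    using sum_le_suminf[OF H2_summable[OF assms], of "{n}"] by simp
  then have "(cmod (coef f n))\<^sup>2 \<le> (H2norm f)\<^sup>2" by (simp add: H2norm_sq assms)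
  then show ?thesis using H2.nrm_nonneg[OF assms] by (rule power2_le_imp_le)
qed

lemma zpow_H2: "zpow n \<in> H2"
  by (simp add: H2_iff zpow_hol_disc coef_zpow if_distrib[of cmod] if_distrib[of "\<lambda>x. x\<^sup>2"] cong: if_cong)

lemma H2ip_zpow: "f \<in> H2 \<Longrightarrow> H2ip f (zpow n) = coef f n"
  using sums_unique2[OF H2ip_sums[OF _ zpow_H2, of f n] , of "coef f n"] sums_single[of n "\<lambda>k. coef f k"]
  by (simp add: coef_zpow if_distrib[of cnj] if_distrib[of "(*) _"] cong: if_cong)

definition taylor :: "(complex \<Rightarrow> complex) \<Rightarrow> nat \<Rightarrow> complex \<Rightarrow> complex" where
  "taylor f K z = (\<Sum>n<K. coef f n * zpow n z)"

lemma
  shows taylor_H2: "taylor f K \<in> H2"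
    and coef_taylor: "coef (taylor f K) = (\<lambda>n. if n < K then coef f n else 0)"
proof (induction K)
  case 0
  have t: "taylor f 0 = (\<lambda>z. 0)" by (simp add: taylor_def fun_eq_iff)
  show "taylor f 0 \<in> H2" "coef (taylor f 0) = (\<lambda>n. if n < 0 then coef f n else 0)"
    unfolding t by (simp_all add: H2.zero_mem coef_zero)
next
  case (Suc K)
  have t: "taylor f (Suc K) = (\<lambda>z. taylor f K z + coef f K * zpow K z)"
    by (simp add: taylor_def fun_eq_iff)
  show "taylor f (Suc K) \<in> H2"
    unfolding t by (intro H2.add_mem H2.scale_mem zpow_H2 Suc)
  show "coef (taylor f (Suc K)) = (\<lambda>n. if n < Suc K then coef f n else 0)"
    unfolding t using Suc
    by (auto simp: coef_add coef_scale coef_zpow H2_hol_disc H2.scale_mem zpow_H2 zpow_hol_disc fun_eq_iff less_Suc_eq)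
qed

lemma taylor_tendsto:
  assumes "f \<in> H2"
  shows "(\<lambda>K. H2norm (\<lambda>z. taylor f K z - f z)) \<longlonglongrightarrow> 0"
proof -
  let ?a = "\<lambda>n. (cmod (coef f n))\<^sup>2"
  have "(\<lambda>K. (\<Sum>n. ?a n) - (\<Sum>n<K. ?a n)) \<longlonglongrightarrow> (\<Sum>n. ?a n) - (\<Sum>n. ?a n)"
    by (intro tendsto_diff tendsto_const summable_LIMSEQ H2_summable assms)
  moreover have "(H2norm (\<lambda>z. taylor f K z - f z))\<^sup>2 = (\<Sum>n. ?a n) - (\<Sum>n<K. ?a n)" for K
  proof -
    have "(H2norm (\<lambda>z. taylor f K z - f z))\<^sup>2 = (\<Sum>n. (cmod (coef (\<lambda>z. taylor f K z - f z) n))\<^sup>2)"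
      by (intro H2norm_sq H2.diff_mem taylor_H2 assms)
    also have "\<dots> = (\<Sum>n. if n < K then 0 else ?a n)"
      by (intro suminf_cong) (auto simp: coef_diff coef_taylor taylor_H2 H2_hol_disc assms)
    also have "\<dots> = (\<Sum>n. ?a n) - (\<Sum>n<K. ?a n)"
    proof -
      have "(\<lambda>n. ?a n - (if n \<in> {..<K} then ?a n else 0)) sums ((\<Sum>n. ?a n) - (\<Sum>n<K. ?a n))"
        by (intro sums_diff summable_sums H2_summable assms sums_If_finite_set) auto
      moreover have "(\<lambda>n. ?a n - (if n \<in> {..<K} then ?a n else 0)) = (\<lambda>n. if n < K then 0 else ?a n)" by auto
      ultimately show ?thesis by (simp add: sums_iff)
    qed
    finally show ?thesis .
  qed
  ultimately have "(\<lambda>K. (H2norm (\<lambda>z. taylor f K z - f z))\<^sup>2) \<longlonglongrightarrow> 0" by simp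
  then have "(\<lambda>K. sqrt ((H2norm (\<lambda>z. taylor f K z - f z))\<^sup>2)) \<longlonglongrightarrow> sqrt 0" by (rule tendsto_real_sqrt)
  moreover have "sqrt ((H2norm (\<lambda>z. taylor f K z - f z))\<^sup>2) = H2norm (\<lambda>z. taylor f K z - f z)" for K
    by (simp add: H2.nrm_nonneg H2.diff_mem taylor_H2 assms)
  ultimately show ?thesis by simp
qed

lemma mean_square_le_H2norm:
  assumes f: "f \<in> H2" and r: "0 \<le> r" "r < 1"
  shows "(\<integral>\<zeta>. (cmod (f (of_real r * \<zeta>)))\<^sup>2 \<partial>circle_measure) \<le> (H2norm f)\<^sup>2"
  unfolding H2norm_sq[OF f]
proof (rule sums_le[OF _ mean_square_sums[OF H2_hol_disc[OF f] r] summable_sums[OF H2_summable[OF f]]])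
  show "(cmod (coef f n))\<^sup>2 * r ^ (2 * n) \<le> (cmod (coef f n))\<^sup>2" for n
    using r by (intro mult_left_le power_le_one) auto
qed

section \<open>Radial limits\<close>

subsection \<open>The Poisson integral is dominated by the maximal function\<close>

text \<open>
  The Poisson kernel, normalized to have integral \<open>2 pi\<close> over a period.
\<close>

definition poisson :: "real \<Rightarrow> real \<Rightarrow> real" where
  "poisson r s = (1 - r\<^sup>2) / (1 - 2 * r * cos s + r\<^sup>2)"

lemma poisson_denom_pos:
  fixes r s :: real
  assumes "0 \<le> r" "r < 1"
  shows "0 < 1 - 2 * r * cos s + r\<^sup>2"
proof -
  have "r * cos s \<le> r * 1" using assms by (intro mult_left_mono) auto
  then have "(1 - r)\<^sup>2 \<le> 1 - 2 * r * cos s + r\<^sup>2" by (simp add: power2_diff)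
  moreover have "0 < (1 - r)\<^sup>2" using assms by simp
  ultimately show ?thesis by linarith
qed

lemma poisson_nonneg: "0 \<le> r \<Longrightarrow> r < 1 \<Longrightarrow> 0 \<le> poisson r s"
  unfolding poisson_def using poisson_denom_pos[of r s] power_le_one[of r 2]
  by (intro divide_nonneg_nonneg) auto

lemma poisson_continuous: "0 \<le> r \<Longrightarrow> r < 1 \<Longrightarrow> continuous_on S (poisson r)"
  unfolding poisson_def using poisson_denom_pos[of r]
  by (intro continuous_intros) (metis less_irrefl)

lemma poisson_has_derivative:
  assumes "0 \<le> r" "r < 1"
  shows "(poisson r has_real_derivative - ((1 - r\<^sup>2) * (2 * r * sin s)) / (1 - 2 * r * cos s + r\<^sup>2)\<^sup>2) (at s within S)"
  unfolding poisson_def[abs_def] using poisson_denom_pos[OF assms, of s]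
  by (auto intro!: derivative_eq_intros simp: power2_eq_square divide_simps)

text \<open>
  Cauchy's formula at the point \<open>r\<close> for the function \<open>f u (1 - r\<^sup>2) / (1 - r u)\<close>, which agrees with
  \<open>f\<close> at \<open>r\<close>; on the unit circle the two kernels combine to the Poisson kernel.
\<close>

lemma poisson_integral:
  assumes f: "f holomorphic_on ball 0 R" and R: "1 < R" and r: "0 \<le> r" "r < 1"
  shows "((\<lambda>s. of_real (poisson r s) * f (cis s)) has_integral of_real (2 * pi) * f (of_real r)) {0..2 * pi}"
proof -
  define g where "g u = f u * of_real (1 - r\<^sup>2) / (1 - of_real r * u)" for u
  have nz: "1 - of_real r * u \<noteq> 0" if "cmod u \<le> 1" for u
  proof
    assume "1 - of_real r * u = 0"
    then have "1 = cmod (of_real r * u)" by (metis eq_iff_diff_eq_0 norm_one)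
    also have "\<dots> \<le> r * 1" unfolding norm_mult using r that by (intro mult_mono) auto
    finally show False using r by simp
  qed
  have "g holomorphic_on cball 0 1"
    unfolding g_def using nz R
    by (intro holomorphic_intros holomorphic_on_subset[OF f]) auto
  then have "((\<lambda>u. g u / (u - of_real r)) has_contour_integral (2 * of_real pi * \<i> * g (of_real r))) (circlepath 0 1)"
    by (rule Cauchy_integral_circlepath_simple) (use r in auto)
  then have A: "((\<lambda>t. g (cis t) / (cis t - of_real r) * \<i> * cis t)
      has_integral (2 * of_real pi * \<i> * g (of_real r))) {0..2 * pi}"
    unfolding circlepath_def by (subst (asm) has_contour_integral_part_circlepath_iff) auto
  have e: "- \<i> * (2 * of_real pi * \<i> * g (of_real r)) = 2 * of_real pi * g (of_real r)"
  proof -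
    have "\<i> * \<i> = - 1" by simp
    then show ?thesis by algebra
  qed
  have "((\<lambda>t. - \<i> * (g (cis t) / (cis t - of_real r) * \<i> * cis t)) has_integral (2 * of_real pi * g (of_real r))) {0..2 * pi}"
    unfolding e[symmetric] by (rule has_integral_mult_right[OF A])
  moreover have "- \<i> * (g (cis t) / (cis t - of_real r) * \<i> * cis t) = of_real (poisson r t) * f (cis t)" for t
  proof -
    define D where "D = 1 - 2 * r * cos t + r\<^sup>2"
    have D: "D \<noteq> 0" using poisson_denom_pos[OF r, of t] by (simp add: D_def)
    have e: "(1 - of_real r * cis t) * (cis t - of_real r) = of_real D * cis t"
      unfolding D_def complex_eq_iff
      using sin_cos_squared_add[of t] by (simp add: power2_eq_square) algebra
    have "cis t - of_real r \<noteq> 0"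
    proof
      assume "cis t - of_real r = 0"
      then have "of_real D * cis t = 0" using e by simp
      then show False using D by simp
    qed
    moreover have "1 - of_real r * cis t \<noteq> 0" by (rule nz) simp
    ultimately have "g (cis t) / (cis t - of_real r) * cis t = f (cis t) * of_real (1 - r\<^sup>2) * cis t / (of_real D * cis t)"
      unfolding g_def e[symmetric] by (simp add: field_simps)
    also have "\<dots> = of_real (poisson r t) * f (cis t)"
      using D by (simp add: poisson_def D_def[symmetric])
    finally show ?thesis by (simp add: mult_ac)
  qed
  moreover have "g (of_real r) = f (of_real r)"
  proof -
    have "1 - of_real r * of_real r \<noteq> (0::complex)" by (rule nz) (use r in auto)
    then show ?thesis by (simp add: g_def power2_eq_square)
  qed
  ultimately show ?thesis by simp
qed

lemma poisson_integral_symmetric: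
  assumes f: "f holomorphic_on ball 0 R" and R: "1 < R" and r: "0 \<le> r" "r < 1"
  shows "((\<lambda>s. of_real (poisson r s) * (f (cis s) + f (cis (- s)))) has_integral of_real (2 * pi) * f (of_real r)) {0..pi}"
proof -
  define q where "q s = of_real (poisson r s) * f (cis s)" for s
  have cq: "q integrable_on {a..b}" for a b
  proof (rule integrable_continuous_real)
    have "continuous_on (ball 0 R) f" using f by (rule holomorphic_on_imp_continuous_on)
    then have "continuous_on {a..b} (\<lambda>s. f (cis s))"
      by (rule continuous_on_compose2) (use R in \<open>auto intro!: continuous_intros\<close>)
    then show "continuous_on {a..b} q"
      unfolding q_def by (intro continuous_intros poisson_continuous r)
  qed
  have "integral {0..pi} q + integral {pi..2 * pi} q = integral {0..2 * pi} q"
    by (rule Henstock_Kurzweil_Integration.integral_combine) (auto simp: cq)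
  also have "\<dots> = of_real (2 * pi) * f (of_real r)"
    using poisson_integral[OF assms] unfolding q_def by (rule integral_unique)
  finally have tot: "integral {0..pi} q + integral {pi..2 * pi} q = of_real (2 * pi) * f (of_real r)" .
  have "(q has_integral integral {pi..2 * pi} q) {pi..2 * pi}" using cq by (rule integrable_integral)
  then have "((\<lambda>x. q (- x)) has_integral integral {pi..2 * pi} q) {- (2 * pi)..- pi}" by simp
  from has_integral_shift_real_ivl[OF this, of "- (2 * pi)"]
  have "((\<lambda>x. q (2 * pi - x)) has_integral integral {pi..2 * pi} q) {0..pi}" by simp
  moreover have "q (2 * pi - x) = of_real (poisson r x) * f (cis (- x))" for x
  proof -
    have "cis (2 * pi - x) = cis (- x)" by (simp add: cis.ctr)
    then show ?thesis by (simp add: q_def poisson_def)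
  qed
  ultimately have "((\<lambda>x. of_real (poisson r x) * f (cis (- x))) has_integral integral {pi..2 * pi} q) {0..pi}" by simp
  from has_integral_add[OF integrable_integral[OF cq] this]
  show ?thesis unfolding tot by (simp add: q_def distrib_left)
qed

text \<open>
  If all centred averages of \<open>\<bar>f\<bar>\<close> on the circle about \<open>\<theta>\<close> are at most \<open>M\<close>, then so are the
  averages against any symmetric kernel that decreases away from its centre and has mean \<open>1\<close>. The
  proof integrates by parts: with \<open>Hf s\<close> the integral over \<open>[\<theta> - s, \<theta> + s]\<close>, the product
  \<open>Q s\<close> of the kernel with \<open>2 s M - Hf s \<ge> 0\<close> vanishes at \<open>0\<close>, is nonnegative at \<open>pi\<close>, and its
  derivative is at most the kernel times \<open>2 M - h s\<close>.
\<close>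

lemma poisson_le_maximal:
  assumes f: "f holomorphic_on ball 0 R" and R: "1 < R" and r: "0 \<le> r" "r < 1"
    and M: "\<And>s. 0 < s \<Longrightarrow> s \<le> pi \<Longrightarrow> integral {\<theta> - s..\<theta> + s} (\<lambda>t. cmod (f (cis t))) \<le> 2 * s * M"
  shows "cmod (f (of_real r * cis \<theta>)) \<le> M"
proof -
  define G where "G t = cmod (f (cis t))" for t
  define h where "h s = G (\<theta> + s) + G (\<theta> - s)" for s
  have contf: "continuous_on S (\<lambda>s. f (cis s))" for S
    by (rule continuous_on_compose2[OF holomorphic_on_imp_continuous_on[OF f]])
       (use R in \<open>auto intro!: continuous_intros\<close>)
  have contG: "continuous_on S G" for S
    unfolding G_def by (intro continuous_intros contf)
  have conth: "continuous_on S h" for S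
    unfolding h_def by (intro continuous_intros continuous_on_compose2[OF contG[of UNIV]]) auto
  have fr: "(\<lambda>u. f (cis \<theta> * u)) holomorphic_on ball 0 R"
    by (rule holomorphic_on_compose_gen[OF _ f, unfolded o_def]) (auto intro!: holomorphic_intros simp: norm_mult)
  have one: "((\<lambda>s. poisson r s) has_integral pi) {0..pi}"
  proof -
    have "((\<lambda>s. of_real (poisson r s) * 2) has_integral of_real (2 * pi) * (1::complex)) {0..pi}"
      using poisson_integral_symmetric[OF holomorphic_on_const[of 1] R r] by simp
    then have "((\<lambda>s. Re (of_real (poisson r s) * 2)) has_integral Re (of_real (2 * pi) * (1::complex))) {0..pi}"
      by (rule has_integral_Re)
    then have "((\<lambda>s. poisson r s * 2) has_integral 2 * pi) {0..pi}" by simp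
    from has_integral_mult_right[OF this, of "1/2"] show ?thesis by simp
  qed
  define I where "I = integral {0..pi} (\<lambda>s. poisson r s * h s)"
  have intPh: "(\<lambda>s. poisson r s * h s) integrable_on {0..pi}"
    by (intro integrable_continuous_real continuous_intros poisson_continuous r conth)
  have "cmod (of_real (2 * pi) * f (cis \<theta> * of_real r)) \<le> I"
  proof -
    have hs: "((\<lambda>s. of_real (poisson r s) * (f (cis \<theta> * cis s) + f (cis \<theta> * cis (- s)))) has_integral
        of_real (2 * pi) * f (cis \<theta> * of_real r)) {0..pi}"
      by (rule poisson_integral_symmetric[OF fr R r])
    show ?thesis
      unfolding I_def integral_unique[OF hs, symmetric]
    proof (rule integral_norm_bound_integral)
      show "(\<lambda>s. of_real (poisson r s) * (f (cis \<theta> * cis s) + f (cis \<theta> * cis (- s)))) integrable_on {0..pi}"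
        using hs by blast
      show "norm (of_real (poisson r s) * (f (cis \<theta> * cis s) + f (cis \<theta> * cis (- s)))) \<le> poisson r s * h s" for s
        unfolding norm_mult h_def G_def using poisson_nonneg[OF r, of s]
        by (auto simp: cis_mult intro!: mult_left_mono norm_triangle_ineq)
    qed (rule intPh)
  qed
  moreover have "I \<le> 2 * pi * M"
  proof -
    \<comment> \<open>a primitive on an interval that contains \<open>[\<theta> - pi, \<theta> + pi]\<close> in its interior\<close>
    define A where "A x = integral {\<theta> - 4..x} G" for x
    define Hf where "Hf s = A (\<theta> + s) - A (\<theta> - s)" for s
    have pi4: "pi < 4" using pi_less_4 .
    have dA: "(A has_real_derivative G x) (at x)" if "\<theta> - 4 < x" "x < \<theta> + 4" for x
    proof -
      have "(A has_real_derivative G x) (at x within {\<theta> - 4..\<theta> + 4})"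
        unfolding A_def by (rule integral_has_real_derivative[OF contG]) (use that in auto)
      then show ?thesis using that by (simp add: at_within_Icc_at)
    qed
    have dH: "(Hf has_real_derivative h s) (at s)" if "s \<in> {0..pi}" for s
    proof -
      have "((\<lambda>z. A (\<theta> + z)) has_real_derivative G (\<theta> + s) * 1) (at s)"
        by (rule DERIV_chain2[OF dA]) (use that pi4 in \<open>auto intro!: derivative_eq_intros\<close>)
      moreover have "((\<lambda>z. A (\<theta> - z)) has_real_derivative G (\<theta> - s) * (- 1)) (at s)"
        by (rule DERIV_chain2[OF dA]) (use that pi4 in \<open>auto intro!: derivative_eq_intros\<close>)
      ultimately show ?thesis
        unfolding Hf_def h_def by (auto intro!: derivative_eq_intros)
    qed
    have Hf: "Hf s = integral {\<theta> - s..\<theta> + s} G" if "0 \<le> s" "s \<le> pi" for s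
    proof -
      have "integral {\<theta> - 4..\<theta> - s} G + integral {\<theta> - s..\<theta> + s} G = integral {\<theta> - 4..\<theta> + s} G"
        using that pi4 by (intro Henstock_Kurzweil_Integration.integral_combine integrable_continuous_real contG) auto
      then show ?thesis by (simp add: Hf_def A_def)
    qed
    define P' where "P' s = - ((1 - r\<^sup>2) * (2 * r * sin s)) / (1 - 2 * r * cos s + r\<^sup>2)\<^sup>2" for s
    have P': "P' s \<le> 0" if "s \<in> {0..pi}" for s
      unfolding P'_def using that r power_le_one[of r 2] sin_ge_zero[of s]
      by (auto intro!: divide_nonpos_nonneg mult_nonneg_nonneg)
    define Q where "Q s = poisson r s * (2 * s * M - Hf s)" for s
    have dQ: "(Q has_vector_derivative P' s * (2 * s * M - Hf s) + poisson r s * (2 * M - h s)) (at s within {0..pi})"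
      if "s \<in> {0..pi}" for s
      unfolding Q_def has_real_derivative_iff_has_vector_derivative[symmetric] P'_def
      by (rule derivative_eq_intros poisson_has_derivative[OF r] has_field_derivative_at_within[OF dH[OF that]] refl
          | simp add: algebra_simps)+
    have Hle: "Hf s \<le> 2 * s * M" if "s \<in> {0..pi}" for s
    proof (cases "s = 0")
      case True
      then show ?thesis by (simp add: Hf_def)
    next
      case False
      then show ?thesis using that M[of s] Hf[of s] by (simp add: G_def[abs_def])
    qed
    have "((\<lambda>s. P' s * (2 * s * M - Hf s) + poisson r s * (2 * M - h s)) has_integral (Q pi - Q 0)) {0..pi}"
      by (rule fundamental_theorem_of_calculus) (use dQ in auto)
    moreover have "((\<lambda>s. poisson r s * (2 * M - h s)) has_integral (pi * (2 * M) - I)) {0..pi}"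
    proof -
      have "((\<lambda>s. poisson r s * (2 * M) - poisson r s * h s) has_integral (pi * (2 * M) - I)) {0..pi}"
        unfolding I_def by (intro has_integral_diff has_integral_mult_left one integrable_integral intPh)
      then show ?thesis by (simp add: right_diff_distrib)
    qed
    ultimately have "Q pi - Q 0 \<le> pi * (2 * M) - I"
      by (rule has_integral_le) (use P' Hle in \<open>auto intro!: mult_nonpos_nonneg\<close>)
    moreover have "Q 0 = 0" by (simp add: Q_def Hf_def)
    moreover have "0 \<le> Q pi"
      unfolding Q_def using poisson_nonneg[OF r, of pi] Hle[of pi] by (intro mult_nonneg_nonneg) auto
    ultimately show ?thesis by (simp add: algebra_simps)
  qed
  moreover have "cmod (of_real (2 * pi) * f (cis \<theta> * of_real r)) = 2 * pi * cmod (f (cis \<theta> * of_real r))"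
    by (simp add: norm_mult)
  ultimately have "2 * pi * cmod (f (cis \<theta> * of_real r)) \<le> 2 * pi * M" by linarith
  then have "cmod (f (cis \<theta> * of_real r)) \<le> M"
    by (rule mult_left_le_imp_le) simp
  then show ?thesis by (simp add: mult.commute)
qed

subsection \<open>The weak-type estimate\<close>

lemma emeasure_density_continuous:
  fixes G :: "real \<Rightarrow> real"
  assumes cont: "continuous_on UNIV G" and nn: "\<And>x. 0 \<le> G x"
  shows "emeasure (density lborel (\<lambda>x. ennreal (G x))) {a..b} = ennreal (integral {a..b} G)"
proof -
  have [measurable]: "G \<in> borel_measurable borel" using cont by (rule borel_measurable_continuous_onI)
  have si: "set_integrable lborel {a..b} G"
    by (rule borel_integrable_atLeastAtMost') (rule continuous_on_subset[OF cont], simp)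
  have "emeasure (density lborel (\<lambda>x. ennreal (G x))) {a..b} = (\<integral>\<^sup>+x. ennreal (indicator {a..b} x *\<^sub>R G x) \<partial>lborel)"
    by (subst emeasure_density) (auto intro!: nn_integral_cong split: split_indicator)
  also have "\<dots> = ennreal (\<integral>x. indicator {a..b} x *\<^sub>R G x \<partial>lborel)"
    using si nn unfolding set_integrable_def by (intro nn_integral_eq_integral) auto
  also have "(\<integral>x. indicator {a..b} x *\<^sub>R G x \<partial>lborel) = integral {a..b} G"
    using set_borel_integral_eq_integral(2)[OF si] by (simp add: set_lebesgue_integral_def)
  finally show ?thesis .
qed

text \<open>
  The weak-type estimate for the centred maximal function. By the Vitali covering lemma the set is covered
  by fivefold enlargements of disjoint intervals on each of which the mean of \<open>G\<close> exceeds \<open>l\<close>; the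
  total length of the disjoint intervals is at most the integral of \<open>G\<close> divided by \<open>l\<close>. The
  intervals have centres in \<open>[0, 2 pi]\<close> and radius at most \<open>pi\<close>, which explains the domain of
  integration.
\<close>

lemma maximal_weak_type:
  fixes G :: "real \<Rightarrow> real"
  assumes cont: "continuous_on UNIV G" and nn: "\<And>x. 0 \<le> G x" and l: "l > 0"
    and E: "E \<subseteq> {0..2 * pi}" "\<And>t. t \<in> E \<Longrightarrow> \<exists>s. 0 < s \<and> s \<le> pi \<and> 2 * s * l < integral {t - s..t + s} G"
  shows "\<exists>T\<in>sets borel. E \<subseteq> T \<and> emeasure lborel T \<le> ennreal (5 / l * integral {- pi..3 * pi} G)"
proof -
  obtain s where s: "\<And>t. t \<in> E \<Longrightarrow> 0 < s t \<and> s t \<le> pi \<and> 2 * s t * l < integral {t - s t..t + s t} G"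
    using E(2) by metis
  have cover: "E \<subseteq> (\<Union>i\<in>E. cball (id i) (s i))"
  proof
    fix x assume "x \<in> E"
    then show "x \<in> (\<Union>i\<in>E. cball (id i) (s i))" using s[of x] by (intro UN_I[of x]) auto
  qed
  obtain C where C: "countable C" "C \<subseteq> E"
      "pairwise (\<lambda>i j. disjnt (cball (id i) (s i)) (cball (id j) (s j))) C"
      "E \<subseteq> (\<Union>i\<in>C. cball (id i) (5 * s i))"
    by (rule Vitali_covering_lemma_cballs[OF cover, of pi]) (use s in auto)
  \<comment> \<open>the countable family of intervals, enlarged by the factor \<open>k\<close> and indexed by the natural numbers\<close>
  define J where "J k n = (if n \<in> to_nat_on C ` C then cball (from_nat_into C n) (k * s (from_nat_into C n)) else {})"
    for k :: real and n
  have fn: "from_nat_into C n \<in> C" if "n \<in> to_nat_on C ` C" for n using that C(1) by auto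
  have JU: "(\<Union>n. J k n) = (\<Union>i\<in>C. cball i (k * s i))" for k
  proof
    show "(\<Union>n. J k n) \<subseteq> (\<Union>i\<in>C. cball i (k * s i))" using fn by (auto simp: J_def split: if_splits)
    show "(\<Union>i\<in>C. cball i (k * s i)) \<subseteq> (\<Union>n. J k n)"
    proof
      fix x assume "x \<in> (\<Union>i\<in>C. cball i (k * s i))"
      then obtain i where "i \<in> C" "x \<in> cball i (k * s i)" by blast
      then have "x \<in> J k (to_nat_on C i)" using C(1) by (simp add: J_def)
      then show "x \<in> (\<Union>n. J k n)" by blast
    qed
  qed
  have Jm [measurable]: "J k n \<in> sets borel" for k n by (simp add: J_def)
  have disj: "disjoint_family (J 1)"
    unfolding disjoint_family_on_def
  proof (intro ballI impI)
    fix m n :: nat assume "m \<noteq> n"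
    show "J 1 m \<inter> J 1 n = {}"
    proof (cases "m \<in> to_nat_on C ` C \<and> n \<in> to_nat_on C ` C")
      case True
      then have "from_nat_into C m \<noteq> from_nat_into C n" using \<open>m \<noteq> n\<close> C(1) by auto
      then show ?thesis
        using True C(3) fn unfolding pairwise_def disjnt_def by (auto simp: J_def)
    qed (auto simp: J_def)
  qed
  let ?\<mu> = "density lborel (\<lambda>x. ennreal (G x))"
  let ?I = "integral {- pi..3 * pi} G"
  have ll: "ennreal l * emeasure lborel (J 1 n) \<le> emeasure ?\<mu> (J 1 n)" for n
  proof (cases "n \<in> to_nat_on C ` C")
    case True
    define i where "i = from_nat_into C n"
    have i: "i \<in> E" using fn[OF True] C(2) by (auto simp: i_def)
    have J: "J 1 n = {i - s i..i + s i}" using True by (simp add: J_def i_def cball_eq_atLeastAtMost)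
    have "ennreal l * emeasure lborel (J 1 n) = ennreal (2 * s i * l)"
      unfolding J using s[OF i] l by (simp add: ennreal_mult[symmetric] mult_ac)
    also have "\<dots> \<le> ennreal (integral {i - s i..i + s i} G)" using s[OF i] by (intro ennreal_leI) auto
    also have "\<dots> = emeasure ?\<mu> (J 1 n)" unfolding J by (rule emeasure_density_continuous[OF cont nn, symmetric])
    finally show ?thesis .
  qed (simp add: J_def)
  have "ennreal l * emeasure lborel (\<Union>n. J 1 n) = (\<Sum>n. ennreal l * emeasure lborel (J 1 n))"
    using suminf_emeasure[of "J 1" lborel] disj by (simp add: image_subset_iff)
  also have "\<dots> \<le> (\<Sum>n. emeasure ?\<mu> (J 1 n))" by (intro suminf_le ll) auto
  also have "\<dots> = emeasure ?\<mu> (\<Union>n. J 1 n)" using disj by (intro suminf_emeasure) auto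
  also have "\<dots> \<le> emeasure ?\<mu> {- pi..3 * pi}"
  proof (intro emeasure_mono)
    show "(\<Union>n. J 1 n) \<subseteq> {- pi..3 * pi}"
      unfolding JU using C(2) E(1) s by (fastforce simp: cball_eq_atLeastAtMost)
  qed simp
  also have "\<dots> = ennreal ?I" by (rule emeasure_density_continuous[OF cont nn])
  finally have main: "ennreal l * emeasure lborel (\<Union>n. J 1 n) \<le> ennreal ?I" .
  have five: "emeasure lborel (J 5 n) = 5 * emeasure lborel (J 1 n)" for n
  proof (cases "n \<in> to_nat_on C ` C")
    case True
    define i where "i = from_nat_into C n"
    have "s i > 0" using fn[OF True] C(2) s by (auto simp: i_def)
    then show ?thesis
      using True by (simp add: J_def i_def[symmetric] cball_eq_atLeastAtMost ennreal_mult[symmetric] flip: ennreal_numeral)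
  qed (simp add: J_def)
  have "emeasure lborel (\<Union>n. J 5 n) \<le> (\<Sum>n. emeasure lborel (J 5 n))"
    by (rule emeasure_subadditive_countably) auto
  also have "\<dots> = 5 * emeasure lborel (\<Union>n. J 1 n)"
    unfolding five using suminf_emeasure[of "J 1" lborel] disj by (simp add: image_subset_iff)
  also have "\<dots> = ennreal (5 / l) * (ennreal l * emeasure lborel (\<Union>n. J 1 n))"
    using l by (simp add: mult.assoc[symmetric] ennreal_mult[symmetric])
  also have "\<dots> \<le> ennreal (5 / l) * ennreal ?I" by (intro mult_left_mono main) simp
  also have "\<dots> = ennreal (5 / l * ?I)"
    using l nn by (subst ennreal_mult) (auto intro!: integral_nonneg integrable_continuous_real continuous_on_subset[OF cont])
  finally have "emeasure lborel (\<Union>n. J 5 n) \<le> ennreal (5 / l * ?I)" .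
  moreover have "(\<Union>n. J 5 n) \<in> sets borel" by measurable
  moreover have "E \<subseteq> (\<Union>n. J 5 n)" using C(4) by (simp add: JU)
  ultimately show ?thesis by blast
qed

lemma dilate_holomorphic:
  assumes "f \<in> hol_disc" "0 < R"
  shows "(\<lambda>u. f (of_real R * u)) holomorphic_on ball 0 (1 / R)"
  by (rule holomorphic_on_compose_gen[OF _ hol_disc_holomorphic[OF assms(1)], unfolded o_def])
     (use assms(2) in \<open>auto intro!: holomorphic_intros simp: norm_mult field_simps\<close>)

lemma circle_curve_continuous:
  assumes "f \<in> hol_disc" "0 \<le> \<rho>" "\<rho> < 1"
  shows "continuous_on S (\<lambda>t. f (of_real \<rho> * cis t))"
  by (rule continuous_on_compose2[OF holomorphic_on_imp_continuous_on[OF hol_disc_holomorphic[OF assms(1)]]])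
     (use assms in \<open>auto intro!: continuous_intros simp: norm_mult\<close>)

text \<open>
  On a circle of radius \<open>R < 1\<close> the function is analytic across the boundary, so the Poisson and covering
  estimates apply. The integral over \<open>[- pi, 3 pi]\<close> covers two periods, and the mean of \<open>\<bar>f\<bar>\<close>
  over one period is at most \<open>N\<close> by the inequality of arithmetic and geometric means. It matters that
  the bound does not depend on \<open>R\<close>.
\<close>

lemma maximal_dilate:
  assumes f: "f \<in> H2" and N: "0 < N" "H2norm f \<le> N" and l: "0 < l" and R: "0 < R" "R < 1"
  shows "\<exists>T\<in>sets borel. {t \<in> {0..2 * pi}. \<exists>r. 0 \<le> r \<and> r < 1 \<and> l < cmod (f (of_real R * (of_real r * cis t)))} \<subseteq> T
    \<and> emeasure lborel T \<le> ennreal (20 * pi * N / l)"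
proof -
  have fh: "f \<in> hol_disc" using f by (rule H2_hol_disc)
  define F where "F u = f (of_real R * u)" for u
  have hF: "F holomorphic_on ball 0 (1 / R)" unfolding F_def by (rule dilate_holomorphic[OF fh R(1)])
  have R1: "1 < 1 / R" using R by simp
  define G where "G t = cmod (F (cis t))" for t
  have contG: "continuous_on S G" for S
    unfolding G_def F_def by (intro continuous_intros circle_curve_continuous fh) (use R in auto)
  let ?E = "{t \<in> {0..2 * pi}. \<exists>r. 0 \<le> r \<and> r < 1 \<and> l < cmod (f (of_real R * (of_real r * cis t)))}"
  have "\<exists>T\<in>sets borel. ?E \<subseteq> T \<and> emeasure lborel T \<le> ennreal (5 / l * integral {- pi..3 * pi} G)"
  proof (rule maximal_weak_type[OF contG _ l])
    fix t assume "t \<in> ?E"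
    then obtain r where r: "0 \<le> r" "r < 1" "l < cmod (F (of_real r * cis t))" by (auto simp: F_def)
    show "\<exists>s. 0 < s \<and> s \<le> pi \<and> 2 * s * l < integral {t - s..t + s} G"
    proof (rule ccontr)
      assume "\<nexists>s. 0 < s \<and> s \<le> pi \<and> 2 * s * l < integral {t - s..t + s} G"
      then have "cmod (F (of_real r * cis t)) \<le> l"
        by (intro poisson_le_maximal[OF hF R1 r(1,2)]) (auto simp: G_def[abs_def] not_less)
      then show False using r by simp
    qed
  qed (auto simp: G_def)
  moreover have "5 / l * integral {- pi..3 * pi} G \<le> 20 * pi * N / l"
  proof -
    have per: "G (x + 2 * pi) = G x" "G (x + - (2 * pi)) = G x" for x
      by (simp_all add: G_def cis.ctr cos_diff sin_diff)
    have io: "G integrable_on {a..b}" for a b by (intro integrable_continuous_real contG)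
    have "integral {- pi..3 * pi} G = integral {- pi..0} G + integral {0..2 * pi} G + integral {2 * pi..3 * pi} G"
      using Henstock_Kurzweil_Integration.integral_combine[OF _ _ io, of "-pi" 0 "3 * pi"]
        Henstock_Kurzweil_Integration.integral_combine[OF _ _ io, of 0 "2 * pi" "3 * pi"] by simp
    also have "integral {- pi..0} G = integral {pi..2 * pi} G"
      using integral_shift_real_ivl[of pi "2 * pi" "2 * pi" G] unfolding per by simp
    also have "integral {2 * pi..3 * pi} G = integral {0..pi} G"
      using integral_shift_real_ivl[of 0 "- (2 * pi)" pi G] unfolding per by simp
    also have "integral {pi..2 * pi} G + integral {0..2 * pi} G + integral {0..pi} G = 2 * integral {0..2 * pi} G"
      using Henstock_Kurzweil_Integration.integral_combine[OF _ _ io, of 0 pi "2 * pi"] by simp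
    finally have "integral {- pi..3 * pi} G = 2 * integral {0..2 * pi} G" .
    moreover have "integral {0..2 * pi} G \<le> 2 * pi * N"
    proof -
      have [measurable]: "(\<lambda>\<zeta>. f (of_real R * \<zeta>)) \<in> borel_measurable borel" by (rule dilate_borel[OF fh])
      have "(1 / (2 * pi)) *\<^sub>R integral {0..2 * pi} G = (\<integral>\<zeta>. cmod (F \<zeta>) \<partial>circle_measure)"
        unfolding G_def by (rule integral_circle[symmetric]) (use contG in \<open>auto simp: F_def G_def\<close>)
      also have "\<dots> \<le> (\<integral>\<zeta>. (N + (cmod (F \<zeta>))\<^sup>2 / N) / 2 \<partial>circle_measure)"
      proof -
        obtain B where B: "\<And>\<zeta>. cmod \<zeta> = 1 \<Longrightarrow> cmod (F \<zeta>) \<le> B"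
          unfolding F_def using hol_disc_radius_bounded[OF fh, of R] R by auto
        have i1: "integrable circle_measure F"
          by (rule circle_integrableI[OF _ B]) (auto simp: F_def)
        have "integrable circle_measure (\<lambda>\<zeta>. F \<zeta> * cnj (F \<zeta>))"
          unfolding F_def using circle_mean_integrable[OF fh fh, of R] R by auto
        from integrable_norm[OF this] have i2: "integrable circle_measure (\<lambda>\<zeta>. (cmod (F \<zeta>))\<^sup>2)"
          by (simp add: norm_mult power2_eq_square)
        have "cmod (F \<zeta>) \<le> (N + (cmod (F \<zeta>))\<^sup>2 / N) / 2" for \<zeta>
        proof -
          have "0 \<le> (N - cmod (F \<zeta>))\<^sup>2 / N" using N by simp
          also have "\<dots> = N - 2 * cmod (F \<zeta>) + (cmod (F \<zeta>))\<^sup>2 / N"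
            using N by (simp add: field_simps power2_eq_square)
          finally show ?thesis by simp
        qed
        then show ?thesis using i1 i2 by (intro integral_mono) auto
      qed
      also have "\<dots> = (N + (\<integral>\<zeta>. (cmod (F \<zeta>))\<^sup>2 \<partial>circle_measure) / N) / 2"
      proof -
        have "integrable circle_measure (\<lambda>\<zeta>. F \<zeta> * cnj (F \<zeta>))"
          unfolding F_def using circle_mean_integrable[OF fh fh, of R] R by auto
        from integrable_norm[OF this] have i2: "integrable circle_measure (\<lambda>\<zeta>. (cmod (F \<zeta>))\<^sup>2)"
          by (simp add: norm_mult power2_eq_square)
        then show ?thesis by simp
      qed
      also have "\<dots> \<le> N"
      proof -
        have "(\<integral>\<zeta>. (cmod (F \<zeta>))\<^sup>2 \<partial>circle_measure) \<le> (H2norm f)\<^sup>2"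
          unfolding F_def using mean_square_le_H2norm[OF f, of R] R by simp
        also have "\<dots> \<le> N\<^sup>2" using N H2.nrm_nonneg[OF f] by (simp add: power_mono)
        finally have "(\<integral>\<zeta>. (cmod (F \<zeta>))\<^sup>2 \<partial>circle_measure) / N \<le> N"
          using N by (simp add: field_simps power2_eq_square)
        then show ?thesis by simp
      qed
      finally show ?thesis by (simp add: field_simps)
    qed
    ultimately have "integral {- pi..3 * pi} G \<le> 4 * pi * N" by linarith
    then have "5 / l * integral {- pi..3 * pi} G \<le> 5 / l * (4 * pi * N)" using l by (intro mult_left_mono) auto
    then show ?thesis by simp
  qed
  ultimately show ?thesis using ennreal_leI order_trans by meson
qed

text \<open>
  The radial maximal function is of weak type on the Hardy space: exhaust the radii below \<open>1\<close> by those
  below \<open>R n\<close>.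
\<close>

lemma radial_maximal:
  assumes f: "f \<in> H2" and N: "0 < N" "H2norm f \<le> N" and l: "0 < l"
  defines "E \<equiv> {t \<in> {0..2 * pi}. \<exists>\<rho>. 0 \<le> \<rho> \<and> \<rho> < 1 \<and> l < cmod (f (of_real \<rho> * cis t))}"
  shows "E \<in> lmeasurable" "measure lebesgue E \<le> 20 * pi * N / l"
proof -
  have fh: "f \<in> hol_disc" using f by (rule H2_hol_disc)
  define R where "R n = 1 - 1 / (real n + 2)" for n
  have R: "0 < R n" "R n < 1" for n by (auto simp: R_def field_simps)
  define A where "A n = {t \<in> {0..2 * pi}. \<exists>\<rho>. 0 \<le> \<rho> \<and> \<rho> < R n \<and> l < cmod (f (of_real \<rho> * cis t))}" for n
  have Am: "A n \<in> sets borel" for n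
  proof -
    have "A n = {0..2 * pi} \<inter> (\<Union>\<rho>\<in>{0..<R n}. {t. l < cmod (f (of_real \<rho> * cis t))})"
      by (auto simp: A_def)
    moreover have "open (\<Union>\<rho>\<in>{0..<R n}. {t. l < cmod (f (of_real \<rho> * cis t))})"
    proof (intro open_UN ballI open_Collect_less continuous_intros circle_curve_continuous fh)
      fix \<rho> assume "\<rho> \<in> {0..<R n}"
      then show "0 \<le> \<rho>" "\<rho> < 1" using R(2)[of n] by auto
    qed
    ultimately show ?thesis by auto
  qed
  have inc: "incseq A"
  proof (rule incseq_SucI)
    fix n
    have "R n \<le> R (Suc n)" by (simp add: R_def frac_le)
    then show "A n \<subseteq> A (Suc n)" unfolding A_def using order_less_le_trans by blast
  qed
  have EU: "E = (\<Union>n. A n)"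
  proof
    show "(\<Union>n. A n) \<subseteq> E" unfolding A_def E_def using R(2) order_less_trans by blast
    show "E \<subseteq> (\<Union>n. A n)"
    proof
      fix t assume "t \<in> E"
      then obtain \<rho> where \<rho>: "t \<in> {0..2 * pi}" "0 \<le> \<rho>" "\<rho> < 1" "l < cmod (f (of_real \<rho> * cis t))"
        by (auto simp: E_def)
      obtain n where "inverse (real (Suc n)) < 1 - \<rho>" using reals_Archimedean[of "1 - \<rho>"] \<rho> by auto
      moreover have "1 / (real n + 2) \<le> inverse (real (Suc n))" by (simp add: field_simps)
      ultimately have "\<rho> < R n" by (simp add: R_def)
      then show "t \<in> (\<Union>n. A n)" using \<rho> by (auto simp: A_def)
    qed
  qed
  have Ab: "emeasure lborel (A n) \<le> ennreal (20 * pi * N / l)" for n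
  proof -
    obtain T where T: "T \<in> sets borel" "emeasure lborel T \<le> ennreal (20 * pi * N / l)"
      "{t \<in> {0..2 * pi}. \<exists>r. 0 \<le> r \<and> r < 1 \<and> l < cmod (f (of_real (R n) * (of_real r * cis t)))} \<subseteq> T"
      using maximal_dilate[OF f N l R] by blast
    have "A n \<subseteq> T"
    proof
      fix t assume "t \<in> A n"
      then obtain \<rho> where \<rho>: "t \<in> {0..2 * pi}" "0 \<le> \<rho>" "\<rho> < R n" "l < cmod (f (of_real \<rho> * cis t))"
        by (auto simp: A_def)
      have "complex_of_real (R n) * (of_real (\<rho> / R n) * cis t) = of_real \<rho> * cis t"
        using R(1)[of n] by simp
      then have "0 \<le> \<rho> / R n \<and> \<rho> / R n < 1 \<and> l < cmod (f (of_real (R n) * (of_real (\<rho> / R n) * cis t)))"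
        using \<rho> R(1)[of n] by simp
      then show "t \<in> T" using T(3) \<rho>(1) by blast
    qed
    then show ?thesis using emeasure_mono[of "A n" T lborel] T by (auto intro: order_trans)
  qed
  have "emeasure lborel E = (SUP n. emeasure lborel (A n))"
    unfolding EU by (rule SUP_emeasure_incseq[symmetric]) (use Am inc in auto)
  then have em: "emeasure lborel E \<le> ennreal (20 * pi * N / l)" by (simp add: SUP_least Ab)
  have Em: "E \<in> sets borel" unfolding EU using Am by auto
  show "E \<in> lmeasurable"
  proof (rule bounded_set_imp_lmeasurable)
    show "bounded E" by (rule bounded_subset[of "{0..2 * pi}"]) (auto simp: E_def)
    show "E \<in> sets lebesgue" using Em by simp
  qed
  have "measure lborel E \<le> 20 * pi * N / l"
    unfolding measure_def by (rule enn2real_leI[OF _ em]) (use N l in auto)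
  then show "measure lebesgue E \<le> 20 * pi * N / l" using Em by (simp add: measure_completion)
qed

subsection \<open>Existence of radial limits\<close>

lemma at_left_one_eventually: "d < 1 \<Longrightarrow> \<forall>\<^sub>F r :: real in at_left 1. d < r \<and> r < 1"
  using eventually_at_left_real[of d 1] by simp

text \<open>
  A Cauchy criterion with countably many conditions, from which both measurability and the
  almost-everywhere statement can be read off.
\<close>

lemma radial_limit_iff_Cauchy:
  fixes g :: "real \<Rightarrow> complex"
  shows "(\<exists>l. (g \<longlongrightarrow> l) (at_left 1)) \<longleftrightarrow>
    (\<forall>k::nat. \<exists>d::nat. \<forall>r s. 1 - 1 / (real d + 1) < r \<and> r < 1 \<and> 1 - 1 / (real d + 1) < s \<and> s < 1 \<longrightarrow>
       dist (g r) (g s) \<le> 1 / (real k + 1))"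
proof
  assume "\<exists>l. (g \<longlongrightarrow> l) (at_left 1)"
  then obtain l where l: "(g \<longlongrightarrow> l) (at_left 1)" by blast
  show "\<forall>k::nat. \<exists>d::nat. \<forall>r s. 1 - 1 / (real d + 1) < r \<and> r < 1 \<and> 1 - 1 / (real d + 1) < s \<and> s < 1 \<longrightarrow>
       dist (g r) (g s) \<le> 1 / (real k + 1)"
  proof
    fix k :: nat
    have "\<forall>\<^sub>F r in at_left 1. dist (g r) l < 1 / (2 * (real k + 1))"
      by (rule tendstoD[OF l]) simp
    then obtain b where b: "b < 1" "\<And>r. b < r \<Longrightarrow> r < 1 \<Longrightarrow> dist (g r) l < 1 / (2 * (real k + 1))"
      unfolding eventually_at_left_field by blast
    obtain d where "inverse (real (Suc d)) < 1 - b" using reals_Archimedean[of "1 - b"] b by auto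
    then have d: "b < 1 - 1 / (real d + 1)" by (simp add: inverse_eq_divide add.commute)
    have "dist (g r) (g s) \<le> 1 / (real k + 1)"
      if "1 - 1 / (real d + 1) < r" "r < 1" "1 - 1 / (real d + 1) < s" "s < 1" for r s
    proof -
      have "dist (g r) (g s) \<le> dist (g r) l + dist (g s) l" by (rule dist_triangle2)
      also have "\<dots> \<le> 1 / (2 * (real k + 1)) + 1 / (2 * (real k + 1))"
        using b(2)[of r] b(2)[of s] that d by linarith
      also have "\<dots> = 1 / (real k + 1)" by (simp add: field_simps)
      finally show ?thesis .
    qed
    then show "\<exists>d::nat. \<forall>r s. 1 - 1 / (real d + 1) < r \<and> r < 1 \<and> 1 - 1 / (real d + 1) < s \<and> s < 1 \<longrightarrow>
       dist (g r) (g s) \<le> 1 / (real k + 1)" by blast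
  qed
next
  assume c: "\<forall>k::nat. \<exists>d::nat. \<forall>r s. 1 - 1 / (real d + 1) < r \<and> r < 1 \<and> 1 - 1 / (real d + 1) < s \<and> s < 1 \<longrightarrow>
       dist (g r) (g s) \<le> 1 / (real k + 1)"
  define x where "x n = 1 - 1 / (real n + 2)" for n
  have x1: "x n < 1" for n by (simp add: x_def)
  have xd: "1 - 1 / (real d + 1) < x n" if "n \<ge> d" for n d
    using that by (simp add: x_def frac_less2)
  have ck: "\<exists>k. 1 / (real k + 1) < e" if "e > 0" for e
    using reals_Archimedean[OF that] by (auto simp: inverse_eq_divide add.commute)
  have "Cauchy (\<lambda>n. g (x n))"
  proof (rule metric_CauchyI)
    fix e :: real assume "e > 0"
    then obtain k where k: "1 / (real k + 1) < e" using ck by blast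
    obtain d where d: "\<And>r s. 1 - 1 / (real d + 1) < r \<and> r < 1 \<and> 1 - 1 / (real d + 1) < s \<and> s < 1 \<Longrightarrow>
       dist (g r) (g s) \<le> 1 / (real k + 1)" using c by meson
    have "dist (g (x m)) (g (x n)) < e" if "m \<ge> d" "n \<ge> d" for m n
      using d[of "x m" "x n"] xd[of d m] xd[of d n] that x1[of m] x1[of n] k by linarith
    then show "\<exists>M. \<forall>m\<ge>M. \<forall>n\<ge>M. dist (g (x m)) (g (x n)) < e" by blast
  qed
  then obtain l where l: "(\<lambda>n. g (x n)) \<longlonglongrightarrow> l" using Cauchy_convergent convergent_def by blast
  have "(g \<longlongrightarrow> l) (at_left 1)"
  proof (rule tendstoI)
    fix e :: real assume "e > 0"
    then obtain k where k: "1 / (real k + 1) < e" using ck by blast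
    obtain d where d: "\<And>r s. 1 - 1 / (real d + 1) < r \<and> r < 1 \<and> 1 - 1 / (real d + 1) < s \<and> s < 1 \<Longrightarrow>
       dist (g r) (g s) \<le> 1 / (real k + 1)" using c by meson
    have "dist (g r) l < e" if "1 - 1 / (real d + 1) < r" "r < 1" for r
    proof -
      have "dist (g r) l \<le> 1 / (real k + 1)"
      proof (rule LIMSEQ_le_const2)
        show "(\<lambda>n. dist (g r) (g (x n))) \<longlonglongrightarrow> dist (g r) l" by (intro tendsto_intros l)
        show "\<exists>N. \<forall>n\<ge>N. dist (g r) (g (x n)) \<le> 1 / (real k + 1)"
            using d[of r "x _"] that xd[of d] x1 by (intro exI[of _ d]) auto
      qed
      then show ?thesis using k by simp
    qed
    moreover have "\<forall>\<^sub>F r in at_left 1. 1 - 1 / (real d + 1) < r \<and> r < 1" by (rule at_left_one_eventually) simp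
    ultimately show "\<forall>\<^sub>F r in at_left 1. dist (g r) l < e" by (auto elim: eventually_mono)
  qed
  then show "\<exists>l. (g \<longlongrightarrow> l) (at_left 1)" by blast
qed

definition has_radial_limit :: "(complex \<Rightarrow> complex) \<Rightarrow> complex \<Rightarrow> bool" where
  "has_radial_limit f \<zeta> \<longleftrightarrow> (\<exists>l. ((\<lambda>r::real. f (of_real r * \<zeta>)) \<longlongrightarrow> l) (at_left 1))"

lemma boundary_value_tendsto:
  "has_radial_limit f \<zeta> \<Longrightarrow> ((\<lambda>r::real. f (of_real r * \<zeta>)) \<longlongrightarrow> boundary_value f \<zeta>) (at_left 1)"
  unfolding has_radial_limit_def boundary_value_def by (auto simp: tendsto_Lim)

lemma boundary_value_eqI:
  "((\<lambda>r::real. f (of_real r * \<zeta>)) \<longlongrightarrow> l) (at_left 1) \<Longrightarrow> boundary_value f \<zeta> = l"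
  unfolding boundary_value_def by (rule tendsto_Lim) auto

lemma taylor_radial: "cmod \<zeta> = 1 \<Longrightarrow> 0 \<le> r \<Longrightarrow> r < 1 \<Longrightarrow>
    taylor f K (of_real r * \<zeta>) = (\<Sum>n<K. coef f n * (of_real r * \<zeta>) ^ n)"
  by (simp add: taylor_def zpow_def norm_mult)

text \<open>
  Fatou's theorem for the Hardy space. Subtracting a Taylor polynomial leaves the oscillation at the
  boundary point unchanged and makes the norm of the function small; by the maximal estimate the
  oscillation is then large only on a set of small measure.
\<close>

lemma negligible_no_radial_limit:
  assumes f: "f \<in> H2"
  shows "negligible {t \<in> {0..2 * pi}. \<not> has_radial_limit f (cis t)}"
proof -
  define B where "B k = {t \<in> {0..2 * pi}. \<not> (\<exists>d::nat. \<forall>r s. 1 - 1 / (real d + 1) < r \<and> r < 1 \<and> 1 - 1 / (real d + 1) < s \<and> s < 1 \<longrightarrow>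
       dist (f (of_real r * cis t)) (f (of_real s * cis t)) \<le> 1 / (real k + 1))}" for k :: nat
  have "negligible (B k)" for k
    unfolding negligible_outer_le
  proof (intro allI impI)
    fix e :: real assume e: "e > 0"
    \<comment> \<open>a quarter of the permitted oscillation: two shares for the polynomial, two for the remainder\<close>
    define l where "l = 1 / (4 * (real k + 1))"
    have l: "l > 0" by (simp add: l_def)
    \<comment> \<open>chosen such that the maximal estimate bounds the exceptional set by \<open>e\<close>\<close>
    define N where "N = e * l / (20 * pi)"
    have N: "N > 0" using e l by (simp add: N_def)
    have "\<forall>\<^sub>F K in sequentially. H2norm (\<lambda>z. taylor f K z - f z) < N"
      using order_tendstoD(2)[OF taylor_tendsto[OF f] N] .
    then obtain K where K: "H2norm (\<lambda>z. taylor f K z - f z) < N" by (auto simp: eventually_sequentially)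
    define g where "g = (\<lambda>z. taylor f K z - f z)"
    have g: "g \<in> H2" unfolding g_def by (intro H2.diff_mem taylor_H2 f)
    have gN: "H2norm g \<le> N" using K by (simp add: g_def)
    define E where "E = {t \<in> {0..2 * pi}. \<exists>\<rho>. 0 \<le> \<rho> \<and> \<rho> < 1 \<and> l < cmod (g (of_real \<rho> * cis t))}"
    have E: "E \<in> lmeasurable" "measure lebesgue E \<le> 20 * pi * N / l"
      unfolding E_def using radial_maximal[OF g N gN l] by auto
    have "B k \<subseteq> E"
    proof
      fix t assume t: "t \<in> B k"
      show "t \<in> E"
      proof (rule ccontr)
        assume "t \<notin> E"
        then have gl: "cmod (g (of_real \<rho> * cis t)) \<le> l" if "0 \<le> \<rho>" "\<rho> < 1" for \<rho>
          using t that by (auto simp: E_def B_def not_less)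
        define q where "q r = (\<Sum>n<K. coef f n * (complex_of_real r * cis t) ^ n)" for r
        have "(q \<longlongrightarrow> q 1) (at_left 1)" unfolding q_def by (intro tendsto_intros)
        then have "\<forall>\<^sub>F r in at_left 1. dist (q r) (q 1) < l" using l by (rule tendstoD)
        then obtain b where b: "b < 1" "\<And>r. b < r \<Longrightarrow> r < 1 \<Longrightarrow> dist (q r) (q 1) < l"
          unfolding eventually_at_left_field by blast
        obtain d where "inverse (real (Suc d)) < 1 - b" using reals_Archimedean[of "1 - b"] b by auto
        then have d: "b < 1 - 1 / (real d + 1)" by (simp add: inverse_eq_divide add.commute)
        have d0: "0 \<le> 1 - 1 / (real d + 1)" by (simp add: field_simps)
        have "dist (f (of_real r * cis t)) (f (of_real s * cis t)) \<le> 1 / (real k + 1)"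
          if rs: "1 - 1 / (real d + 1) < r" "r < 1" "1 - 1 / (real d + 1) < s" "s < 1" for r s
        proof -
          have r0: "0 \<le> r" "0 \<le> s" using rs d0 by linarith+
          have fq: "f (of_real x * cis t) = q x - g (of_real x * cis t)" if "0 \<le> x" "x < 1" for x
            using taylor_radial[of "cis t" x f K] that by (simp add: g_def q_def)
          have "dist (f (of_real r * cis t)) (f (of_real s * cis t))
              \<le> dist (q r) (q 1) + dist (q s) (q 1) + cmod (g (of_real r * cis t)) + cmod (g (of_real s * cis t))"
          proof -
            have "f (of_real r * cis t) - f (of_real s * cis t)
                = (q r - q 1) - (q s - q 1) - (g (of_real r * cis t) - g (of_real s * cis t))"
              using fq[of r] fq[of s] rs r0 by simp
            then have "cmod (f (of_real r * cis t) - f (of_real s * cis t))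
                \<le> cmod ((q r - q 1) - (q s - q 1)) + cmod (g (of_real r * cis t) - g (of_real s * cis t))"
              by (simp only: norm_triangle_ineq4)
            also have "\<dots> \<le> (cmod (q r - q 1) + cmod (q s - q 1)) + (cmod (g (of_real r * cis t)) + cmod (g (of_real s * cis t)))"
              by (intro add_mono norm_triangle_ineq4)
            finally show ?thesis by (simp add: dist_norm)
          qed
          also have "\<dots> \<le> l + l + l + l"
            using r0 b(2)[of r] b(2)[of s] gl[of r] gl[of s] rs d d0 by (intro add_mono) auto
          also have "\<dots> = 1 / (real k + 1)" by (simp add: l_def field_simps)
          finally show ?thesis .
        qed
        then show False using t unfolding B_def by blast
      qed
    qed
    moreover have "20 * pi * N / l = e" using l by (simp add: N_def)
    ultimately show "\<exists>T. B k \<subseteq> T \<and> T \<in> lmeasurable \<and> measure lebesgue T \<le> e" using E by metis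
  qed
  then have "negligible (\<Union>k. B k)" by (rule negligible_Union_nat)
  moreover have "{t \<in> {0..2 * pi}. \<not> has_radial_limit f (cis t)} \<subseteq> (\<Union>k. B k)"
    unfolding has_radial_limit_def radial_limit_iff_Cauchy B_def by blast
  ultimately show ?thesis by (rule negligible_subset)
qed

text \<open>
  For fixed \<open>k\<close> and \<open>d\<close> the Cauchy condition cuts a closed set out of the circle, as an intersection of
  closed sets over all radii.
\<close>

lemma has_radial_limit_sets:
  assumes f: "f \<in> hol_disc"
  shows "{\<zeta>. cmod \<zeta> = 1 \<and> has_radial_limit f \<zeta>} \<in> sets borel"
proof -
  define F where "F k d = (\<Inter>r\<in>{max 0 (1 - 1 / (real d + 1))<..<1}. \<Inter>s\<in>{max 0 (1 - 1 / (real d + 1))<..<1}.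
      {\<zeta> \<in> sphere 0 1. dist (f (of_real r * \<zeta>)) (f (of_real s * \<zeta>)) \<le> 1 / (real k + 1)})" for k d :: nat
  have "closed (F k d)" for k d
    unfolding F_def
  proof (intro closed_INT ballI)
    fix r s assume "r \<in> {max 0 (1 - 1 / (real d + 1))<..<1}" "s \<in> {max 0 (1 - 1 / (real d + 1))<..<1}"
    then have rs: "0 \<le> r" "r < 1" "0 \<le> s" "s < 1"
      by (simp_all only: greaterThanLessThan_iff max_less_iff_conj less_imp_le)
    have c: "continuous_on (sphere 0 1) (\<lambda>\<zeta>. f (of_real x * \<zeta>))" if "0 \<le> x" "x < 1" for x
      by (rule continuous_on_compose2[OF holomorphic_on_imp_continuous_on[OF hol_disc_holomorphic[OF f]]])
         (use that in \<open>auto intro!: continuous_intros simp: norm_mult\<close>)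
    have "closed {\<zeta> \<in> sphere 0 1. dist (f (of_real r * \<zeta>)) (f (of_real s * \<zeta>)) - 1 / (real k + 1) \<le> 0}"
      by (rule continuous_on_closed_Collect_le) (use c rs in \<open>auto intro!: continuous_intros\<close>)
    then show "closed {\<zeta> \<in> sphere 0 1. dist (f (of_real r * \<zeta>)) (f (of_real s * \<zeta>)) \<le> 1 / (real k + 1)}"
      by simp
  qed
  then have "(\<Inter>k. \<Union>d. F k d) \<in> sets borel" by (intro sets.countable_INT'' sets.countable_UN) auto
  moreover have "(\<Inter>k. \<Union>d. F k d) = {\<zeta>. cmod \<zeta> = 1 \<and> has_radial_limit f \<zeta>}"
  proof -
    have "\<zeta> \<in> F k d \<longleftrightarrow> cmod \<zeta> = 1 \<and> (\<forall>r s. 1 - 1 / (real d + 1) < r \<and> r < 1 \<and> 1 - 1 / (real d + 1) < s \<and> s < 1 \<longrightarrow>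
       dist (f (of_real r * \<zeta>)) (f (of_real s * \<zeta>)) \<le> 1 / (real k + 1))" for \<zeta> k d
    proof -
      have m: "max 0 (1 - 1 / (real d + 1)) = 1 - 1 / (real d + 1)" by (simp add: field_simps max_def)
      define x where "x = (1 + (1 - 1 / (real d + 1))) / 2"
      have "x \<in> {1 - 1 / (real d + 1)<..<1}" by (simp add: x_def field_simps)
      then show ?thesis unfolding F_def m by auto
    qed
    then show ?thesis unfolding has_radial_limit_def radial_limit_iff_Cauchy by auto
  qed
  ultimately show ?thesis by simp
qed

lemma AE_has_radial_limit:
  assumes f: "f \<in> H2"
  shows "AE \<zeta> in circle_measure. has_radial_limit f \<zeta>"
proof -
  have "AE \<zeta> in circle_measure. cmod \<zeta> = 1 \<and> has_radial_limit f \<zeta>"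
  proof (rule AE_circleI)
    show "{\<zeta>. cmod \<zeta> = 1 \<and> has_radial_limit f \<zeta>} \<in> sets borel"
      by (rule has_radial_limit_sets[OF H2_hol_disc[OF f]])
    have "AE t in lebesgue. t \<notin> {t \<in> {0..2 * pi}. \<not> has_radial_limit f (cis t)}"
      using negligible_no_radial_limit[OF f] unfolding negligible_iff_null_sets by (rule AE_not_in)
    then have "AE t in lborel. t \<notin> {t \<in> {0..2 * pi}. \<not> has_radial_limit f (cis t)}"
      by (simp only: AE_completion_iff)
    then show "AE t in lborel. t \<in> {0..<2 * pi} \<longrightarrow> cmod (cis t) = 1 \<and> has_radial_limit f (cis t)"
      by (rule eventually_mono) auto
  qed
  then show ?thesis by (rule eventually_mono) blast
qed

text \<open>
  Off the circle the radial limit is the value of \<open>f\<close>. On the circle it is a limit of a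
  sequence where it exists, and one and the same constant \<open>c\<close> where it does not.
\<close>

lemma boundary_value_borel:
  assumes f: "f \<in> hol_disc"
  shows "boundary_value f \<in> borel_measurable borel"
proof -
  define A where "A = {\<zeta>. cmod \<zeta> = 1 \<and> has_radial_limit f \<zeta>}"
  define c where "c = (THE l::complex. False)"
  define g where "g \<zeta> = lim (\<lambda>n. f (of_real (1 - 1 / (real n + 2)) * \<zeta>))" for \<zeta>
  have [measurable]: "A \<in> sets borel" unfolding A_def by (rule has_radial_limit_sets[OF f])
  have [measurable]: "f \<in> borel_measurable borel" by (rule hol_disc_borel[OF f])
  have [measurable]: "g \<in> borel_measurable borel"
    unfolding g_def by (intro borel_measurable_lim_metric dilate_borel f)
  have seq: "filterlim (\<lambda>n. 1 - 1 / (real n + 2)) (at_left 1) sequentially"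
    unfolding filterlim_at by (auto intro!: always_eventually) real_asymp
  have "boundary_value f \<zeta> = (if \<zeta> \<in> A then g \<zeta> else if \<zeta> \<in> sphere 0 1 then c else f \<zeta>)" for \<zeta>
  proof (cases "cmod \<zeta> = 1")
    case True
    show ?thesis
    proof (cases "\<zeta> \<in> A")
      case True
      then have "((\<lambda>r::real. f (of_real r * \<zeta>)) \<longlongrightarrow> boundary_value f \<zeta>) (at_left 1)"
        by (intro boundary_value_tendsto) (simp add: A_def)
      from filterlim_compose[OF this seq] have "g \<zeta> = boundary_value f \<zeta>"
        unfolding g_def by (rule limI)
      then show ?thesis using True by simp
    next
      case False
      then have "\<And>l. \<not> ((\<lambda>r::real. f (of_real r * \<zeta>)) \<longlongrightarrow> l) (at_left 1)"
        using True by (auto simp: A_def has_radial_limit_def)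
      then have "boundary_value f \<zeta> = c" by (simp add: boundary_value_def Topological_Spaces.Lim_def c_def)
      then show ?thesis using False True by simp
    qed
  next
    case False
    have "((\<lambda>r::real. f (of_real r * \<zeta>)) \<longlongrightarrow> f \<zeta>) (at_left 1)"
    proof (cases "cmod \<zeta> < 1")
      case True
      have "continuous (at \<zeta>) f"
        using holomorphic_on_imp_continuous_on[OF hol_disc_holomorphic[OF f]] True
        by (simp add: continuous_on_eq_continuous_at)
      moreover have "((\<lambda>r::real. of_real r * \<zeta>) \<longlongrightarrow> \<zeta>) (at_left 1)" by (auto intro!: tendsto_eq_intros)
      ultimately show ?thesis by (rule isCont_tendsto_compose)
    next
      case F: False
      then have z: "1 < cmod \<zeta>" using False by simp
      then have zp: "0 < cmod \<zeta>" by linarith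
      then have z': "1 / cmod \<zeta> < 1" using z by (subst divide_less_eq_1_pos) auto
      have "\<forall>\<^sub>F r in at_left 1. f (of_real r * \<zeta>) = f \<zeta>"
        using at_left_one_eventually[OF z']
      proof eventually_elim
        case (elim r)
        have "0 < 1 / cmod \<zeta>" using zp by (rule divide_pos_pos[OF zero_less_one])
        then have "0 < r" using elim by linarith
        then have "1 < cmod (of_real r * \<zeta>)" using elim zp by (simp add: norm_mult pos_divide_less_eq)
        then show ?case using hol_disc_zero[OF f] z by simp
      qed
      then show ?thesis by (rule tendsto_eventually)
    qed
    then have "boundary_value f \<zeta> = f \<zeta>" by (rule boundary_value_eqI)
    then show ?thesis using False by (simp add: A_def)
  qed
  then have "boundary_value f = (\<lambda>\<zeta>. if \<zeta> \<in> A then g \<zeta> else if \<zeta> \<in> sphere 0 1 then c else f \<zeta>)" by blast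
  moreover have [measurable]: "sphere (0::complex) 1 \<in> sets borel" by (simp add: borel_closed)
  moreover have "(\<lambda>\<zeta>. if \<zeta> \<in> A then g \<zeta> else if \<zeta> \<in> sphere 0 1 then c else f \<zeta>) \<in> borel_measurable borel"
    by measurable
  ultimately show ?thesis by simp
qed

subsection \<open>The boundary embedding is isometric\<close>

text \<open>
  Fatou's lemma along a sequence of radii.
\<close>

lemma boundary_value_square:
  assumes f: "f \<in> H2"
  shows "integrable circle_measure (\<lambda>\<zeta>. (cmod (boundary_value f \<zeta>))\<^sup>2)"
    and "(\<integral>\<zeta>. (cmod (boundary_value f \<zeta>))\<^sup>2 \<partial>circle_measure) \<le> (H2norm f)\<^sup>2"
proof -
  have fh: "f \<in> hol_disc" using f by (rule H2_hol_disc)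
  have [measurable]: "boundary_value f \<in> borel_measurable borel" by (rule boundary_value_borel[OF fh])
  have dm: "(\<lambda>\<zeta>. f (of_real r * \<zeta>)) \<in> borel_measurable borel" for r by (rule dilate_borel[OF fh])
  define x where "x n = 1 - 1 / (real n + 2)" for n
  have x: "0 \<le> x n" "x n < 1" for n by (auto simp: x_def field_simps)
  have seq: "filterlim x (at_left 1) sequentially"
    unfolding filterlim_at x_def by (auto intro!: always_eventually) real_asymp
  have "(\<integral>\<^sup>+\<zeta>. ennreal ((cmod (boundary_value f \<zeta>))\<^sup>2) \<partial>circle_measure)
      = (\<integral>\<^sup>+\<zeta>. liminf (\<lambda>n. ennreal ((cmod (f (of_real (x n) * \<zeta>)))\<^sup>2)) \<partial>circle_measure)"
  proof (rule nn_integral_cong_AE)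
    show "AE \<zeta> in circle_measure. ennreal ((cmod (boundary_value f \<zeta>))\<^sup>2)
        = liminf (\<lambda>n. ennreal ((cmod (f (of_real (x n) * \<zeta>)))\<^sup>2))"
      using AE_has_radial_limit[OF f]
    proof eventually_elim
      case (elim \<zeta>)
      have "(\<lambda>n. f (of_real (x n) * \<zeta>)) \<longlonglongrightarrow> boundary_value f \<zeta>"
        by (rule filterlim_compose[OF boundary_value_tendsto[OF elim] seq])
      then have "(\<lambda>n. ennreal ((cmod (f (of_real (x n) * \<zeta>)))\<^sup>2)) \<longlonglongrightarrow> ennreal ((cmod (boundary_value f \<zeta>))\<^sup>2)"
        by (intro tendsto_ennrealI tendsto_intros)
      then show ?case by (intro lim_imp_Liminf[symmetric]) auto
    qed
  qed
  also have "\<dots> \<le> liminf (\<lambda>n. \<integral>\<^sup>+\<zeta>. ennreal ((cmod (f (of_real (x n) * \<zeta>)))\<^sup>2) \<partial>circle_measure)"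
    using dm fh by (intro nn_integral_liminf) measurable
  also have "\<dots> \<le> ennreal ((H2norm f)\<^sup>2)"
  proof (rule Liminf_le)
    have "(\<integral>\<^sup>+\<zeta>. ennreal ((cmod (f (of_real (x n) * \<zeta>)))\<^sup>2) \<partial>circle_measure) \<le> ennreal ((H2norm f)\<^sup>2)" for n
    proof -
      have "integrable circle_measure (\<lambda>\<zeta>. (cmod (f (of_real (x n) * \<zeta>)))\<^sup>2)"
        using integrable_norm[OF circle_mean_integrable[OF fh fh x[of n]]] by (simp add: norm_mult power2_eq_square)
      then have "(\<integral>\<^sup>+\<zeta>. ennreal ((cmod (f (of_real (x n) * \<zeta>)))\<^sup>2) \<partial>circle_measure)
          = ennreal (\<integral>\<zeta>. (cmod (f (of_real (x n) * \<zeta>)))\<^sup>2 \<partial>circle_measure)"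
        by (intro nn_integral_eq_integral) auto
      then show ?thesis using mean_square_le_H2norm[OF f x[of n]] by (simp add: ennreal_leI)
    qed
    then show "\<forall>\<^sub>F n in sequentially. (\<integral>\<^sup>+\<zeta>. ennreal ((cmod (f (of_real (x n) * \<zeta>)))\<^sup>2) \<partial>circle_measure)
        \<le> ennreal ((H2norm f)\<^sup>2)" by simp
  qed simp
  finally have le: "(\<integral>\<^sup>+\<zeta>. ennreal ((cmod (boundary_value f \<zeta>))\<^sup>2) \<partial>circle_measure) \<le> ennreal ((H2norm f)\<^sup>2)" .
  show int: "integrable circle_measure (\<lambda>\<zeta>. (cmod (boundary_value f \<zeta>))\<^sup>2)"
  proof (rule integrableI_bounded)
    show "(\<integral>\<^sup>+\<zeta>. ennreal (norm ((cmod (boundary_value f \<zeta>))\<^sup>2)) \<partial>circle_measure) < \<infinity>"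
      using le by (simp add: le_less_trans[OF _ ennreal_less_top])
  qed measurable
  have "ennreal (\<integral>\<zeta>. (cmod (boundary_value f \<zeta>))\<^sup>2 \<partial>circle_measure) \<le> ennreal ((H2norm f)\<^sup>2)"
    using le nn_integral_eq_integral[OF int] by simp
  then show "(\<integral>\<zeta>. (cmod (boundary_value f \<zeta>))\<^sup>2 \<partial>circle_measure) \<le> (H2norm f)\<^sup>2"
    by (simp add: ennreal_le_iff)
qed

text \<open>
  The inner product of boundary functions; it will turn out to equal \<open>H2ip\<close>.
\<close>

definition boundary_ip :: "(complex \<Rightarrow> complex) \<Rightarrow> (complex \<Rightarrow> complex) \<Rightarrow> complex" where
  "boundary_ip f g = (\<integral>\<zeta>. boundary_value f \<zeta> * cnj (boundary_value g \<zeta>) \<partial>circle_measure)"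

lemma
  assumes f: "f \<in> H2" and g: "g \<in> H2"
  shows boundary_ip_integrable: "integrable circle_measure (\<lambda>\<zeta>. boundary_value f \<zeta> * cnj (boundary_value g \<zeta>))"
    and boundary_ip_le: "H2norm f \<le> a \<Longrightarrow> H2norm g \<le> b \<Longrightarrow> 0 < a \<Longrightarrow> 0 < b \<Longrightarrow> cmod (boundary_ip f g) \<le> a * b"
proof -
  have [measurable]: "boundary_value f \<in> borel_measurable borel" "boundary_value g \<in> borel_measurable borel"
    using f g by (simp_all add: boundary_value_borel H2_hol_disc)
  let ?F = "\<lambda>\<zeta>. cmod (boundary_value f \<zeta>)" and ?G = "\<lambda>\<zeta>. cmod (boundary_value g \<zeta>)"
  have amgm: "?F \<zeta> * ?G \<zeta> \<le> (b / a * (?F \<zeta>)\<^sup>2 + a / b * (?G \<zeta>)\<^sup>2) / 2" if "0 < a" "0 < b" for a b :: real and \<zeta>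
  proof -
    have "0 \<le> (b * ?F \<zeta> - a * ?G \<zeta>)\<^sup>2 / (a * b)" using that by simp
    also have "\<dots> = b / a * (?F \<zeta>)\<^sup>2 + a / b * (?G \<zeta>)\<^sup>2 - 2 * (?F \<zeta> * ?G \<zeta>)"
      using that by (simp add: field_simps power2_eq_square)
    finally show ?thesis by simp
  qed
  have ib: "integrable circle_measure (\<lambda>\<zeta>. (b / a * (?F \<zeta>)\<^sup>2 + a / b * (?G \<zeta>)\<^sup>2) / 2)" for a b :: real
    by (intro integrable_divide Bochner_Integration.integrable_add integrable_mult_right boundary_value_square(1) f g)
  show int: "integrable circle_measure (\<lambda>\<zeta>. boundary_value f \<zeta> * cnj (boundary_value g \<zeta>))"
    using amgm[of 1 1] by (intro Bochner_Integration.integrable_bound[OF ib[of 1 1]]) (auto simp: norm_mult)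
  assume le: "H2norm f \<le> a" "H2norm g \<le> b" and ab: "0 < a" "0 < b"
  have "cmod (boundary_ip f g) \<le> (\<integral>\<zeta>. cmod (boundary_value f \<zeta> * cnj (boundary_value g \<zeta>)) \<partial>circle_measure)"
    unfolding boundary_ip_def by (rule integral_norm_bound)
  also have "\<dots> \<le> (\<integral>\<zeta>. (b / a * (?F \<zeta>)\<^sup>2 + a / b * (?G \<zeta>)\<^sup>2) / 2 \<partial>circle_measure)"
    using amgm[OF ab] by (intro integral_mono integrable_norm int ib) (simp add: norm_mult)
  also have "\<dots> = (b / a * (\<integral>\<zeta>. (?F \<zeta>)\<^sup>2 \<partial>circle_measure) + a / b * (\<integral>\<zeta>. (?G \<zeta>)\<^sup>2 \<partial>circle_measure)) / 2"
    by (simp add: boundary_value_square(1) f g)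
  also have "\<dots> \<le> (b / a * a\<^sup>2 + a / b * b\<^sup>2) / 2"
  proof -
    have "(H2norm f)\<^sup>2 \<le> a\<^sup>2" "(H2norm g)\<^sup>2 \<le> b\<^sup>2"
      using le H2.nrm_nonneg f g by (auto intro: power_mono)
    then show ?thesis
      using boundary_value_square(2)[OF f] boundary_value_square(2)[OF g] ab
      by (intro divide_right_mono add_mono mult_left_mono) auto
  qed
  also have "\<dots> = a * b" using ab by (simp add: power2_eq_square)
  finally show "cmod (boundary_ip f g) \<le> a * b" .
qed

lemma AE_boundary_value_lincomb:
  assumes "f \<in> H2" "g \<in> H2"
  shows "AE \<zeta> in circle_measure. boundary_value (\<lambda>z. f z + c * g z) \<zeta> = boundary_value f \<zeta> + c * boundary_value g \<zeta>"
  using AE_has_radial_limit[OF assms(1)] AE_has_radial_limit[OF assms(2)]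
proof eventually_elim
  case (elim \<zeta>)
  show ?case by (intro boundary_value_eqI tendsto_intros boundary_value_tendsto elim)
qed

lemma AE_boundary_value_mult:
  assumes "f \<in> H2" "g \<in> H2"
  shows "AE \<zeta> in circle_measure. boundary_value (\<lambda>z. f z * g z) \<zeta> = boundary_value f \<zeta> * boundary_value g \<zeta>"
  using AE_has_radial_limit[OF assms(1)] AE_has_radial_limit[OF assms(2)]
proof eventually_elim
  case (elim \<zeta>)
  show ?case by (intro boundary_value_eqI tendsto_intros boundary_value_tendsto elim)
qed

lemma boundary_ip_lincomb_right:
  assumes f: "f \<in> H2" and g: "g \<in> H2" and h: "h \<in> H2"
  shows "boundary_ip f (\<lambda>z. g z + c * h z) = boundary_ip f g + cnj c * boundary_ip f h"
proof -
  have [measurable]: "boundary_value f \<in> borel_measurable borel" "boundary_value g \<in> borel_measurable borel"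
    "boundary_value h \<in> borel_measurable borel" "boundary_value (\<lambda>z. g z + c * h z) \<in> borel_measurable borel"
    using assms by (simp_all add: boundary_value_borel H2_hol_disc H2.add_mem H2.scale_mem)
  have "boundary_ip f (\<lambda>z. g z + c * h z) = (\<integral>\<zeta>. boundary_value f \<zeta> * cnj (boundary_value g \<zeta>)
      + cnj c * (boundary_value f \<zeta> * cnj (boundary_value h \<zeta>)) \<partial>circle_measure)"
    unfolding boundary_ip_def
  proof (rule integral_cong_AE)
    show "AE \<zeta> in circle_measure. boundary_value f \<zeta> * cnj (boundary_value (\<lambda>z. g z + c * h z) \<zeta>)
        = boundary_value f \<zeta> * cnj (boundary_value g \<zeta>) + cnj c * (boundary_value f \<zeta> * cnj (boundary_value h \<zeta>))"
      using AE_boundary_value_lincomb[OF g h, of c] by eventually_elim (simp add: algebra_simps)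
  qed measurable
  then show ?thesis by (simp add: boundary_ip_def boundary_ip_integrable assms)
qed

lemma boundary_ip_cnj: "boundary_ip u v = cnj (boundary_ip v u)"
  unfolding boundary_ip_def by (subst Bochner_Integration.integral_cnj[symmetric]) (simp add: mult.commute)

lemma boundary_value_zpow: "cmod \<zeta> = 1 \<Longrightarrow> boundary_value (zpow n) \<zeta> = \<zeta> ^ n"
proof (rule boundary_value_eqI)
  assume z: "cmod \<zeta> = 1"
  have "\<forall>\<^sub>F r in at_left 1. (of_real r * \<zeta>) ^ n = zpow n (of_real r * \<zeta>)"
    using at_left_one_eventually[of 0] by (auto simp: zpow_def norm_mult z elim!: eventually_mono)
  moreover have "((\<lambda>r::real. (of_real r * \<zeta>) ^ n) \<longlongrightarrow> \<zeta> ^ n) (at_left 1)"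
    by (auto intro!: tendsto_eq_intros)
  ultimately show "((\<lambda>r::real. zpow n (of_real r * \<zeta>)) \<longlongrightarrow> \<zeta> ^ n) (at_left 1)"
    by (rule Lim_transform_eventually[rotated])
qed

lemma boundary_ip_zpow_zpow: "boundary_ip (zpow j) (zpow k) = (if j = k then 1 else 0)"
proof -
  have [measurable]: "boundary_value (zpow n) \<in> borel_measurable borel" for n
    by (simp add: boundary_value_borel zpow_hol_disc)
  have "boundary_ip (zpow j) (zpow k) = (\<integral>\<zeta>. \<zeta> ^ j * cnj (\<zeta> ^ k) \<partial>circle_measure)"
    unfolding boundary_ip_def
  proof (rule integral_cong_AE)
    show "AE \<zeta> in circle_measure. boundary_value (zpow j) \<zeta> * cnj (boundary_value (zpow k) \<zeta>) = \<zeta> ^ j * cnj (\<zeta> ^ k)"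
      using AE_circle_norm by eventually_elim (simp add: boundary_value_zpow)
  qed measurable
  then show ?thesis by (simp only: circle_orthonormal)
qed

lemma taylor_0: "taylor f 0 = (\<lambda>z. 0)"
  and taylor_Suc: "taylor f (Suc K) = (\<lambda>z. taylor f K z + coef f K * zpow K z)"
  by (simp_all add: taylor_def fun_eq_iff)

lemma boundary_ip_zero: "boundary_ip f (\<lambda>z. 0) = 0" "boundary_ip (\<lambda>z. 0) f = 0"
proof -
  have "boundary_value (\<lambda>z. 0) \<zeta> = 0" for \<zeta> by (rule boundary_value_eqI) simp
  then show "boundary_ip f (\<lambda>z. 0) = 0" "boundary_ip (\<lambda>z. 0) f = 0" by (simp_all add: boundary_ip_def)
qed

lemma boundary_ip_tendsto_right:
  assumes f: "f \<in> H2" and X: "\<And>n. X n \<in> H2" and g: "g \<in> H2" and lim: "(\<lambda>n. H2norm (\<lambda>z. X n z - g z)) \<longlonglongrightarrow> 0"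
  shows "(\<lambda>n. boundary_ip f (X n)) \<longlonglongrightarrow> boundary_ip f g"
proof -
  define a where "a = H2norm f + 1"
  have a: "0 < a" "H2norm f \<le> a" using H2.nrm_nonneg[OF f] by (auto simp: a_def)
  have "(\<lambda>n. boundary_ip f (X n) - boundary_ip f g) \<longlonglongrightarrow> 0"
  proof (rule Lim_null_comparison)
    have "cmod (boundary_ip f (X n) - boundary_ip f g) \<le> a * (H2norm (\<lambda>z. X n z - g z) + 1 / real (Suc n))" for n
    proof -
      have "boundary_ip f (\<lambda>z. X n z - g z) = boundary_ip f (X n) - boundary_ip f g"
        using boundary_ip_lincomb_right[OF f X g, of n "-1"] by simp
      moreover have "cmod (boundary_ip f (\<lambda>z. X n z - g z)) \<le> a * (H2norm (\<lambda>z. X n z - g z) + 1 / real (Suc n))"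
        using H2.nrm_nonneg[OF H2.diff_mem[OF X g], of n]
        by (intro boundary_ip_le f H2.diff_mem X g a) (auto intro: add_nonneg_pos)
      ultimately show ?thesis by simp
    qed
    then show "\<forall>\<^sub>F n in sequentially. norm (boundary_ip f (X n) - boundary_ip f g) \<le> a * (H2norm (\<lambda>z. X n z - g z) + 1 / real (Suc n))"
      by simp
    have "(\<lambda>n. 1 / real (Suc n)) \<longlonglongrightarrow> 0"
      using LIMSEQ_inverse_real_of_nat by (simp add: inverse_eq_divide)
    from tendsto_mult_left[OF tendsto_add[OF lim this], of a]
    show "(\<lambda>n. a * (H2norm (\<lambda>z. X n z - g z) + 1 / real (Suc n))) \<longlonglongrightarrow> 0" by simp
  qed
  then show ?thesis by (simp add: LIM_zero_cancel)
qed

lemma boundary_ip_zpow: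
  assumes f: "f \<in> H2"
  shows "boundary_ip (zpow k) f = cnj (coef f k)"
proof -
  have "boundary_ip (zpow k) (taylor f K) = (if k < K then cnj (coef f k) else 0)" for K
  proof (induction K)
    case (Suc K)
    then show ?case
      unfolding taylor_Suc
      by (subst boundary_ip_lincomb_right) (auto simp: taylor_H2 zpow_H2 boundary_ip_zpow_zpow less_Suc_eq)
  qed (simp add: taylor_0 boundary_ip_zero)
  moreover have "(\<lambda>K. boundary_ip (zpow k) (taylor f K)) \<longlonglongrightarrow> boundary_ip (zpow k) f"
    by (intro boundary_ip_tendsto_right zpow_H2 taylor_H2 f taylor_tendsto)
  moreover have "(\<lambda>K. if k < K then cnj (coef f k) else 0) \<longlonglongrightarrow> cnj (coef f k)"
    by (rule tendsto_eventually, rule eventually_mono[OF eventually_gt_at_top[of k]]) simp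
  ultimately show ?thesis using LIMSEQ_unique by auto
qed

text \<open>
  Boundary values turn monomials into the orthonormal characters of the circle, so both sides agree on
  polynomials; they are continuous in each argument, and Taylor polynomials converge.
\<close>

lemma boundary_ip_eq_H2ip:
  assumes f: "f \<in> H2" and g: "g \<in> H2"
  shows "boundary_ip f g = H2ip f g"
proof -
  have e: "boundary_ip f (taylor g K) = (\<Sum>n<K. coef f n * cnj (coef g n))" for K
  proof (induction K)
    case (Suc K)
    have "boundary_ip f (zpow K) = coef f K" using boundary_ip_zpow[OF f, of K] boundary_ip_cnj[of f "zpow K"] by simp
    then show ?case
      unfolding taylor_Suc using Suc
      by (subst boundary_ip_lincomb_right) (auto simp: f taylor_H2 zpow_H2 mult.commute)
  qed (simp add: taylor_0 boundary_ip_zero)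
  have "(\<lambda>K. boundary_ip f (taylor g K)) \<longlonglongrightarrow> boundary_ip f g"
    by (intro boundary_ip_tendsto_right taylor_H2 f g taylor_tendsto)
  moreover have "(\<lambda>K. boundary_ip f (taylor g K)) \<longlonglongrightarrow> H2ip f g"
    using H2ip_sums[OF f g] unfolding e sums_def .
  ultimately show ?thesis by (rule LIMSEQ_unique)
qed

section \<open>Co-analytic Toeplitz operators\<close>

lemma mean_square_tendsto:
  assumes f: "f \<in> H2"
  shows "((\<lambda>r. \<integral>\<zeta>. (cmod (f (of_real r * \<zeta>)))\<^sup>2 \<partial>circle_measure) \<longlongrightarrow> (H2norm f)\<^sup>2) (at_left 1)"
proof -
  have "((\<lambda>r. Re (circle_mean r f f)) \<longlongrightarrow> Re (H2ip f f)) (at_left 1)"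
    by (intro tendsto_Re circle_mean_tendsto f)
  then show ?thesis by (simp add: circle_mean_self H2_hol_disc f H2.ip_self)
qed

lemma
  assumes p: "\<phi> \<in> hol_disc" and c: "\<And>z. cmod z < 1 \<Longrightarrow> cmod (\<phi> z) \<le> c" and u: "u \<in> H2"
  shows mult_H2: "(\<lambda>z. \<phi> z * u z) \<in> H2"
    and mult_H2norm_le: "H2norm (\<lambda>z. \<phi> z * u z) \<le> c * H2norm u"
proof -
  let ?v = "\<lambda>z. \<phi> z * u z"
  have c0: "0 \<le> c" using order_trans[OF norm_ge_zero c[of 0]] by simp
  have uh: "u \<in> hol_disc" using u by (rule H2_hol_disc)
  have vh: "?v \<in> hol_disc" using p uh by (rule mult_hol_disc)
  have sq: "integrable circle_measure (\<lambda>\<zeta>. (cmod (f (of_real r * \<zeta>)))\<^sup>2)"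
    if "f \<in> hol_disc" "0 \<le> r" "r < 1" for f and r
    using integrable_norm[OF circle_mean_integrable[OF that(1,1,2,3)]] by (simp add: norm_mult power2_eq_square)
  have le: "(\<integral>\<zeta>. (cmod (?v (of_real r * \<zeta>)))\<^sup>2 \<partial>circle_measure) \<le> c\<^sup>2 * (H2norm u)\<^sup>2"
    if r: "0 \<le> r" "r < 1" for r
  proof -
    have "(\<integral>\<zeta>. (cmod (?v (of_real r * \<zeta>)))\<^sup>2 \<partial>circle_measure)
        \<le> (\<integral>\<zeta>. c\<^sup>2 * (cmod (u (of_real r * \<zeta>)))\<^sup>2 \<partial>circle_measure)"
    proof (rule integral_mono_AE[OF sq[OF vh r] integrable_mult_right[OF sq[OF uh r]]])
      show "AE \<zeta> in circle_measure. (cmod (?v (of_real r * \<zeta>)))\<^sup>2 \<le> c\<^sup>2 * (cmod (u (of_real r * \<zeta>)))\<^sup>2"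
        using AE_circle_norm
      proof eventually_elim
        case (elim \<zeta>)
        have "cmod (\<phi> (of_real r * \<zeta>)) \<le> c" using r elim by (intro c) (simp add: norm_mult)
        then have "(cmod (\<phi> (of_real r * \<zeta>)))\<^sup>2 \<le> c\<^sup>2" by (rule power_mono) simp
        then show ?case unfolding norm_mult power_mult_distrib by (rule mult_right_mono) simp
      qed
    qed
    also have "\<dots> = c\<^sup>2 * (\<integral>\<zeta>. (cmod (u (of_real r * \<zeta>)))\<^sup>2 \<partial>circle_measure)"
      by (rule integral_mult_right_zero)
    also have "\<dots> \<le> c\<^sup>2 * (H2norm u)\<^sup>2"
      by (rule mult_left_mono[OF mean_square_le_H2norm[OF u r] zero_le_power2])
    finally show ?thesis .
  qed
  have "bdd_above ((\<lambda>r. \<integral>\<zeta>. (cmod (?v (of_real r * \<zeta>)))\<^sup>2 \<partial>circle_measure) ` {0..<1})"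
    by (rule bdd_aboveI2[where M = "c\<^sup>2 * (H2norm u)\<^sup>2"], rule le) simp_all
  then show v: "?v \<in> H2" using vh by (simp only: H2_def mem_Collect_eq simp_thms)
  have "(H2norm ?v)\<^sup>2 \<le> c\<^sup>2 * (H2norm u)\<^sup>2"
  proof (rule tendsto_upperbound[OF mean_square_tendsto[OF v]])
    show "\<forall>\<^sub>F r in at_left 1. (\<integral>\<zeta>. (cmod (?v (of_real r * \<zeta>)))\<^sup>2 \<partial>circle_measure) \<le> c\<^sup>2 * (H2norm u)\<^sup>2"
      using at_left_one_eventually[OF zero_less_one] by eventually_elim (rule le, simp_all)
  qed simp
  then show "H2norm ?v \<le> c * H2norm u"
    using mult_nonneg_nonneg[OF c0 H2.nrm_nonneg[OF u]]
    unfolding power_mult_distrib[symmetric] by (rule power2_le_imp_le)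
qed

lemma Hinf_hol_disc: "\<phi> \<in> Hinf \<Longrightarrow> \<phi> \<in> hol_disc"
  by (simp add: Hinf_def)

lemma HinfI: "\<phi> \<in> hol_disc \<Longrightarrow> (\<And>z. cmod z < 1 \<Longrightarrow> cmod (\<phi> z) \<le> c) \<Longrightarrow> \<phi> \<in> Hinf"
  unfolding Hinf_def by (auto simp: bounded_iff intro!: exI[of _ c])

lemma Hinf_bound:
  assumes "\<phi> \<in> Hinf"
  obtains c where "0 < c" "\<And>z. cmod z < 1 \<Longrightarrow> cmod (\<phi> z) \<le> c"
proof -
  obtain B where "0 < B" "\<forall>x\<in>\<phi> ` ball 0 1. cmod x \<le> B"
    using assms unfolding Hinf_def bounded_pos by blast
  then show thesis by (intro that[of B]) auto
qed

lemma Hinf_mult_H2: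
  assumes "\<phi> \<in> Hinf" "u \<in> H2"
  shows "(\<lambda>z. \<phi> z * u z) \<in> H2"
proof -
  obtain c where c: "0 < c" "\<And>z. cmod z < 1 \<Longrightarrow> cmod (\<phi> z) \<le> c"
    using Hinf_bound[OF assms(1)] by blast
  show ?thesis by (rule mult_H2[OF Hinf_hol_disc[OF assms(1)] c(2) assms(2)])
qed

lemma Hinf_mult_zpow0: "\<phi> \<in> hol_disc \<Longrightarrow> (\<lambda>z. \<phi> z * zpow 0 z) = \<phi>"
  by (auto simp: zpow_def fun_eq_iff hol_disc_zero)

lemma Hinf_H2: "\<phi> \<in> Hinf \<Longrightarrow> \<phi> \<in> H2"
  using Hinf_mult_H2[of \<phi>, OF _ zpow_H2[of 0]] Hinf_mult_zpow0[of \<phi>] Hinf_hol_disc[of \<phi>] by simp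

text \<open>
  The adjoint of multiplication by \<open>\<phi>\<close>, given by its Taylor coefficients. For bounded \<open>\<phi>\<close> it agrees with
  \<open>toeplitz_cnj \<phi>\<close> on the Hardy space.
\<close>

definition toep :: "(complex \<Rightarrow> complex) \<Rightarrow> (complex \<Rightarrow> complex) \<Rightarrow> complex \<Rightarrow> complex" where
  "toep \<phi> f = of_coef (\<lambda>n. H2ip f (\<lambda>z. \<phi> z * zpow n z))"

lemma toep_taylor:
  assumes p: "\<phi> \<in> Hinf" and f: "f \<in> H2"
  shows "H2ip f (\<lambda>z. \<phi> z * taylor u K z) = (\<Sum>n<K. H2ip f (\<lambda>z. \<phi> z * zpow n z) * cnj (coef u n))"
proof (induction K)
  case (Suc K)
  have "H2ip f (\<lambda>z. \<phi> z * taylor u (Suc K) z)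
      = H2ip f (\<lambda>z. \<phi> z * taylor u K z + coef u K * (\<phi> z * zpow K z))"
    by (simp add: taylor_Suc algebra_simps)
  also have "\<dots> = H2ip f (\<lambda>z. \<phi> z * taylor u K z) + cnj (coef u K) * H2ip f (\<lambda>z. \<phi> z * zpow K z)"
    by (simp add: H2.ip_add_right H2.ip_scale_right H2.scale_mem Hinf_mult_H2 p f taylor_H2 zpow_H2)
  finally show ?case by (simp add: Suc mult.commute)
qed (use H2.ip_zero_left[OF f] H2.ip_commute[OF H2.zero_mem f] in \<open>simp add: taylor_0\<close>)

lemma
  assumes p: "\<phi> \<in> Hinf" and f: "f \<in> H2"
  shows toep_H2: "toep \<phi> f \<in> H2"
    and coef_toep: "coef (toep \<phi> f) n = H2ip f (\<lambda>z. \<phi> z * zpow n z)"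
    and toep_adjoint: "u \<in> H2 \<Longrightarrow> H2ip (toep \<phi> f) u = H2ip f (\<lambda>z. \<phi> z * u z)"
proof -
  obtain c where c: "0 < c" "\<And>z. cmod z < 1 \<Longrightarrow> cmod (\<phi> z) \<le> c" using Hinf_bound[OF p] by blast
  have ph: "\<phi> \<in> hol_disc" using p by (rule Hinf_hol_disc)
  define h where "h n = H2ip f (\<lambda>z. \<phi> z * zpow n z)" for n
  have bd: "cmod (H2ip f (\<lambda>z. \<phi> z * u z)) \<le> H2norm f * (c * H2norm u)" if u: "u \<in> H2" for u
    by (rule order_trans[OF H2.Cauchy_Schwarz[OF f Hinf_mult_H2[OF p u]]
        mult_left_mono[OF mult_H2norm_le[OF ph c(2) u] H2.nrm_nonneg[OF f]]])
  have "H2norm (zpow n) = 1" for n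
  proof -
    have "complex_of_real ((H2norm (zpow n))\<^sup>2) = 1"
      using H2.ip_self[OF zpow_H2, of n] H2ip_zpow[OF zpow_H2, of n n] by (simp add: coef_zpow)
    then have "(H2norm (zpow n))\<^sup>2 = 1" by (simp only: of_real_eq_1_iff)
    then show ?thesis using H2.nrm_nonneg[OF zpow_H2, of n] by (auto simp: power2_eq_1_iff)
  qed
  then have hb: "cmod (h n) \<le> H2norm f * c" for n using bd[OF zpow_H2, of n] by (simp add: h_def)
  have t: "toep \<phi> f = of_coef h" by (simp add: toep_def h_def[abs_def])
  have ch: "coef (of_coef h) = h" by (rule coef_of_coef[OF hb])
  have "(\<Sum>n<K. (cmod (h n))\<^sup>2) \<le> (H2norm f * c)\<^sup>2" for K
  proof -
    define S where "S = (\<Sum>n<K. (cmod (h n))\<^sup>2)"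
    \<comment> \<open>testing against the partial sum \<open>q\<close> of the candidate gives \<open>\<parallel>q\<parallel>\<^sup>2 \<le> \<parallel>f\<parallel> c \<parallel>q\<parallel>\<close>\<close>
    define q where "q = taylor (of_coef h) K"
    have q: "q \<in> H2" by (simp add: q_def taylor_H2)
    have "H2ip f (\<lambda>z. \<phi> z * q z) = of_real S"
      unfolding q_def toep_taylor[OF p f] ch by (simp add: S_def h_def complex_norm_square del: of_real_power)
    then have "S \<le> H2norm f * c * H2norm q"
      using bd[OF q] by (simp add: mult.assoc)
    moreover have "(H2norm q)\<^sup>2 = S"
    proof -
      have "(H2norm q)\<^sup>2 = (\<Sum>n. if n \<in> {..<K} then (cmod (h n))\<^sup>2 else 0)"
        unfolding H2norm_sq[OF q] unfolding q_def coef_taylor ch by (intro suminf_cong) auto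
      also have "\<dots> = S" unfolding S_def by (rule sums_unique[OF sums_If_finite_set, symmetric]) simp
      finally show ?thesis .
    qed
    moreover have "0 \<le> H2norm q" by (rule H2.nrm_nonneg[OF q])
    ultimately have "H2norm q * H2norm q \<le> H2norm f * c * H2norm q" by (simp add: power2_eq_square)
    then have "H2norm q \<le> H2norm f * c"
      using \<open>0 \<le> H2norm q\<close> H2.nrm_nonneg[OF f] c(1) by (cases "H2norm q = 0") auto
    then have "(H2norm q)\<^sup>2 \<le> (H2norm f * c)\<^sup>2" using \<open>0 \<le> H2norm q\<close> by (rule power_mono)
    then show ?thesis using \<open>(H2norm q)\<^sup>2 = S\<close> by (simp add: S_def)
  qed
  from this[of "Suc _"] have "summable (\<lambda>n. (cmod (h n))\<^sup>2)"
    by (intro bounded_imp_summable[of _ "(H2norm f * c)\<^sup>2"]) (simp_all only: lessThan_Suc_atMost zero_le_power2)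
  then have hH: "of_coef h \<in> H2" by (rule of_coef_H2)
  then show "toep \<phi> f \<in> H2" by (simp add: t)
  show "coef (toep \<phi> f) n = H2ip f (\<lambda>z. \<phi> z * zpow n z)" by (simp add: t ch h_def)
  assume u: "u \<in> H2"
  have A: "(\<lambda>K. \<Sum>n<K. h n * cnj (coef u n)) \<longlonglongrightarrow> H2ip (of_coef h) u"
    using H2ip_sums[OF hH u] unfolding ch sums_def .
  have B: "(\<lambda>K. H2ip f (\<lambda>z. \<phi> z * taylor u K z)) \<longlonglongrightarrow> H2ip f (\<lambda>z. \<phi> z * u z)"
  proof (rule H2.tendsto_ip_right)
    show "(\<lambda>K. H2norm (\<lambda>z. \<phi> z * taylor u K z - \<phi> z * u z)) \<longlonglongrightarrow> 0"
    proof (rule Lim_null_comparison)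
      have "H2norm (\<lambda>z. \<phi> z * taylor u K z - \<phi> z * u z) \<le> c * H2norm (\<lambda>z. taylor u K z - u z)" for K
        using mult_H2norm_le[OF ph c(2) H2.diff_mem[OF taylor_H2 u], of u K] by (simp add: right_diff_distrib)
      then show "\<forall>\<^sub>F K in sequentially. norm (H2norm (\<lambda>z. \<phi> z * taylor u K z - \<phi> z * u z)) \<le> c * H2norm (\<lambda>z. taylor u K z - u z)"
        using H2.nrm_nonneg[OF H2.diff_mem[OF Hinf_mult_H2[OF p taylor_H2] Hinf_mult_H2[OF p u]]] by simp
      show "(\<lambda>K. c * H2norm (\<lambda>z. taylor u K z - u z)) \<longlonglongrightarrow> 0"
        using tendsto_mult_left[OF taylor_tendsto[OF u], of c] by simp
    qed
  qed (simp_all add: Hinf_mult_H2 p f u taylor_H2)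
  show "H2ip (toep \<phi> f) u = H2ip f (\<lambda>z. \<phi> z * u z)"
    unfolding t by (rule LIMSEQ_unique[OF A]) (rule B[unfolded toep_taylor[OF p f] h_def[symmetric]])
qed

lemma H2_eqI:
  assumes "f \<in> H2" "g \<in> H2" "\<And>u. u \<in> H2 \<Longrightarrow> H2ip f u = H2ip g u"
  shows "f = g"
proof (rule hol_disc_eq_if_coef_eq)
  show "coef f = coef g"
    using assms(3)[OF zpow_H2] by (simp add: H2ip_zpow assms(1,2) fun_eq_iff)
qed (use assms H2_hol_disc in auto)

text \<open>
  The orthogonality that characterizes the projection of \<open>cnj \<phi> f\<close> reads \<open>\<langle>h, u\<rangle> = \<langle>f, \<phi> u\<rangle>\<close> for all \<open>u\<close>
  once boundary inner products are replaced by \<open>H2ip\<close>; its only solution is the adjoint.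
\<close>

lemma toeplitz_cnj_eq_toep:
  assumes p: "\<phi> \<in> Hinf" and f: "f \<in> H2"
  shows "toeplitz_cnj \<phi> f = toep \<phi> f"
proof -
  let ?g = "\<lambda>\<zeta>. cnj (boundary_value \<phi> \<zeta>) * boundary_value f \<zeta>"
  have pH: "\<phi> \<in> H2" using p by (rule Hinf_H2)
  have eq: "(\<integral>\<zeta>. (?g \<zeta> - boundary_value h \<zeta>) * cnj (boundary_value u \<zeta>) \<partial>circle_measure)
      = H2ip f (\<lambda>z. \<phi> z * u z) - H2ip h u" if h: "h \<in> H2" and u: "u \<in> H2" for h u
  proof -
    have pu: "(\<lambda>z. \<phi> z * u z) \<in> H2" using p u by (rule Hinf_mult_H2)
    have [measurable]: "boundary_value f \<in> borel_measurable borel" "boundary_value h \<in> borel_measurable borel"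
      "boundary_value u \<in> borel_measurable borel" "boundary_value \<phi> \<in> borel_measurable borel"
      "boundary_value (\<lambda>z. \<phi> z * u z) \<in> borel_measurable borel"
      using h u f pH pu by (simp_all add: boundary_value_borel H2_hol_disc)
    have "(\<integral>\<zeta>. (?g \<zeta> - boundary_value h \<zeta>) * cnj (boundary_value u \<zeta>) \<partial>circle_measure)
        = (\<integral>\<zeta>. boundary_value f \<zeta> * cnj (boundary_value (\<lambda>z. \<phi> z * u z) \<zeta>)
            - boundary_value h \<zeta> * cnj (boundary_value u \<zeta>) \<partial>circle_measure)"
    proof (rule integral_cong_AE)
      show "AE \<zeta> in circle_measure. (?g \<zeta> - boundary_value h \<zeta>) * cnj (boundary_value u \<zeta>)
          = boundary_value f \<zeta> * cnj (boundary_value (\<lambda>z. \<phi> z * u z) \<zeta>) - boundary_value h \<zeta> * cnj (boundary_value u \<zeta>)"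
        using AE_boundary_value_mult[OF pH u] by eventually_elim (simp add: algebra_simps)
    qed measurable
    also have "\<dots> = boundary_ip f (\<lambda>z. \<phi> z * u z) - boundary_ip h u"
      unfolding boundary_ip_def by (intro Bochner_Integration.integral_diff boundary_ip_integrable f h u pu)
    finally show ?thesis by (simp add: boundary_ip_eq_H2ip f h u pu)
  qed
  show ?thesis
    unfolding toeplitz_cnj_def P_plus_def
  proof (rule the_equality)
    show "toep \<phi> f \<in> H2 \<and> (\<forall>u\<in>H2. (\<integral>\<zeta>. (?g \<zeta> - boundary_value (toep \<phi> f) \<zeta>) * cnj (boundary_value u \<zeta>) \<partial>circle_measure) = 0)"
      using toep_H2[OF p f] toep_adjoint[OF p f] by (simp add: eq)
    fix h assume h: "h \<in> H2 \<and> (\<forall>u\<in>H2. (\<integral>\<zeta>. (?g \<zeta> - boundary_value h \<zeta>) * cnj (boundary_value u \<zeta>) \<partial>circle_measure) = 0)"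
    then have "H2ip h u = H2ip (toep \<phi> f) u" if "u \<in> H2" for u
      using eq[of h u] toep_adjoint[OF p f that] that by simp
    then show "h = toep \<phi> f" using h toep_H2[OF p f] by (intro H2_eqI) auto
  qed
qed

subsection \<open>Norm inequalities from pointwise inequalities\<close>

text \<open>
  A sesquilinear expression that is pointwise nonnegative on the disc has nonnegative integral means,
  and these converge to the same expression in the inner product. Triples \<open>(c, f, g)\<close> stand for
  \<open>c f cnj g\<close>.
\<close>

lemma H2ip_form_nonneg:
  assumes L: "\<And>c f g. (c, f, g) \<in> set L \<Longrightarrow> f \<in> H2 \<and> g \<in> H2"
    and pos: "\<And>z. cmod z < 1 \<Longrightarrow> 0 \<le> Re (\<Sum>(c, f, g)\<leftarrow>L. c * (f z * cnj (g z)))"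
  shows "0 \<le> Re (\<Sum>(c, f, g)\<leftarrow>L. c * H2ip f g)"
proof (rule tendsto_lowerbound)
  show "((\<lambda>r. Re (\<Sum>(c, f, g)\<leftarrow>L. c * circle_mean r f g)) \<longlongrightarrow> Re (\<Sum>(c, f, g)\<leftarrow>L. c * H2ip f g)) (at_left 1)"
  proof (rule tendsto_Re)
    show "((\<lambda>r. \<Sum>(c, f, g)\<leftarrow>L. c * circle_mean r f g) \<longlongrightarrow> (\<Sum>(c, f, g)\<leftarrow>L. c * H2ip f g)) (at_left 1)"
      using L
    proof (induction L)
      case (Cons x L)
      obtain c f g where x: "x = (c, f, g)" by (cases x)
      have fg: "f \<in> H2" "g \<in> H2" using Cons.prems[of c f g] x by auto
      have "((\<lambda>r. \<Sum>(c, f, g)\<leftarrow>L. c * circle_mean r f g) \<longlongrightarrow> (\<Sum>(c, f, g)\<leftarrow>L. c * H2ip f g)) (at_left 1)"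
        by (rule Cons.IH) (use Cons.prems in auto)
      then show ?case
        unfolding x by (simp, intro tendsto_add tendsto_mult_left circle_mean_tendsto fg)
    qed simp
  qed
  have int: "integrable circle_measure (\<lambda>\<zeta>. \<Sum>(c, f, g)\<leftarrow>L. c * (f (of_real r * \<zeta>) * cnj (g (of_real r * \<zeta>))))
     \<and> (\<integral>\<zeta>. (\<Sum>(c, f, g)\<leftarrow>L. c * (f (of_real r * \<zeta>) * cnj (g (of_real r * \<zeta>)))) \<partial>circle_measure)
      = (\<Sum>(c, f, g)\<leftarrow>L. c * circle_mean r f g)" if r: "0 < r \<and> r < 1" for r :: real
    using L
  proof (induction L)
    case (Cons x L)
    obtain c f g where x: "x = (c, f, g)" by (cases x)
    have fg: "f \<in> hol_disc" "g \<in> hol_disc" using Cons.prems[of c f g] x H2_hol_disc by auto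
    have i: "integrable circle_measure (\<lambda>\<zeta>. f (of_real r * \<zeta>) * cnj (g (of_real r * \<zeta>)))"
      by (rule circle_mean_integrable[OF fg]) (use r in auto)
    have IH: "integrable circle_measure (\<lambda>\<zeta>. \<Sum>(c, f, g)\<leftarrow>L. c * (f (of_real r * \<zeta>) * cnj (g (of_real r * \<zeta>))))
     \<and> (\<integral>\<zeta>. (\<Sum>(c, f, g)\<leftarrow>L. c * (f (of_real r * \<zeta>) * cnj (g (of_real r * \<zeta>)))) \<partial>circle_measure)
      = (\<Sum>(c, f, g)\<leftarrow>L. c * circle_mean r f g)"
      by (rule Cons.IH) (use Cons.prems in auto)
    then show ?case
      unfolding x using i by (simp add: circle_mean_def)
  qed simp
  show "\<forall>\<^sub>F r in at_left 1. 0 \<le> Re (\<Sum>(c, f, g)\<leftarrow>L. c * circle_mean r f g)"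
    using at_left_one_eventually[of 0, OF zero_less_one]
  proof eventually_elim
    case (elim r)
    have "0 \<le> (\<integral>\<zeta>. Re (\<Sum>(c, f, g)\<leftarrow>L. c * (f (of_real r * \<zeta>) * cnj (g (of_real r * \<zeta>)))) \<partial>circle_measure)"
    proof (rule integral_nonneg_AE)
      show "AE \<zeta> in circle_measure. 0 \<le> Re (\<Sum>(c, f, g)\<leftarrow>L. c * (f (of_real r * \<zeta>) * cnj (g (of_real r * \<zeta>))))"
        using AE_circle_norm
      proof eventually_elim
        case z: (elim \<zeta>)
        show ?case by (rule pos) (use elim z in \<open>simp add: norm_mult\<close>)
      qed
    qed
    also have "\<dots> = Re (\<Sum>(c, f, g)\<leftarrow>L. c * circle_mean r f g)"
      using integral_Re[OF conjunct1[OF int[OF elim]]] conjunct2[OF int[OF elim]] by (simp only:)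
    finally show ?case .
  qed
qed simp

lemma H2_contractive_column:
  assumes b: "b \<in> Hinf" and h: "h \<in> Hinf" and le: "\<And>z. cmod z < 1 \<Longrightarrow> (cmod (b z))\<^sup>2 + (cmod (h z))\<^sup>2 \<le> 1"
    and u: "u \<in> H2"
  shows "(H2norm (\<lambda>z. b z * u z))\<^sup>2 + (H2norm (\<lambda>z. h z * u z))\<^sup>2 \<le> (H2norm u)\<^sup>2"
proof -
  let ?B = "\<lambda>z. b z * u z" and ?G = "\<lambda>z. h z * u z"
  have m: "?B \<in> H2" "?G \<in> H2" using b h u by (auto intro: Hinf_mult_H2)
  have "0 \<le> Re (\<Sum>(c, f, g)\<leftarrow>[(1, u, u), (-1, ?B, ?B), (-1, ?G, ?G)]. c * H2ip f g)"
  proof (rule H2ip_form_nonneg)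
    fix z :: complex assume z: "cmod z < 1"
    have e: "Re (w * cnj w) = (cmod w)\<^sup>2" for w by (simp only: complex_norm_square[symmetric] Re_complex_of_real)
    have "Re (\<Sum>(c, f, g)\<leftarrow>[(1, u, u), (-1, ?B, ?B), (-1, ?G, ?G)]. c * (f z * cnj (g z)))
        = (cmod (u z))\<^sup>2 * (1 - ((cmod (b z))\<^sup>2 + (cmod (h z))\<^sup>2))"
      using e[of "u z"] e[of "b z * u z"] e[of "h z * u z"]
      by (simp add: norm_mult power_mult_distrib algebra_simps del: complex_cnj_mult)
    then show "0 \<le> Re (\<Sum>(c, f, g)\<leftarrow>[(1, u, u), (-1, ?B, ?B), (-1, ?G, ?G)]. c * (f z * cnj (g z)))"
      using le[OF z] by simp
  qed (use m u in auto)
  then show ?thesis using m u by (simp add: H2.ip_self)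
qed

text \<open>
  Expand \<open>\<bar>cnj b u - t\<bar>\<^sup>2 \<ge> 0\<close> with \<open>t = toep b u\<close>; the cross terms have inner product \<open>\<parallel>t\<parallel>\<^sup>2\<close>.
\<close>

lemma toep_norm_le:
  assumes b: "b \<in> Hinf" and u: "u \<in> H2"
  shows "H2norm (toep b u) \<le> H2norm (\<lambda>z. b z * u z)"
proof -
  let ?T = "toep b u"
  let ?B = "\<lambda>z. b z * u z" and ?BT = "\<lambda>z. b z * ?T z"
  have T: "?T \<in> H2" using b u by (rule toep_H2)
  have m: "?B \<in> H2" "?BT \<in> H2" using b u T by (auto intro: Hinf_mult_H2)
  have "0 \<le> Re (\<Sum>(c, f, g)\<leftarrow>[(1, ?B, ?B), (-1, u, ?BT), (-1, ?BT, u), (1, ?T, ?T)]. c * H2ip f g)"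
  proof (rule H2ip_form_nonneg)
    fix z :: complex
    have "(\<Sum>(c, f, g)\<leftarrow>[(1, ?B, ?B), (-1, u, ?BT), (-1, ?BT, u), (1, ?T, ?T)]. c * (f z * cnj (g z)))
        = (cnj (b z) * u z - ?T z) * cnj (cnj (b z) * u z - ?T z)"
      by (simp add: algebra_simps)
    also have "\<dots> = of_real ((cmod (cnj (b z) * u z - ?T z))\<^sup>2)" by (simp only: complex_norm_square)
    finally show "0 \<le> Re (\<Sum>(c, f, g)\<leftarrow>[(1, ?B, ?B), (-1, u, ?BT), (-1, ?BT, u), (1, ?T, ?T)]. c * (f z * cnj (g z)))"
      by simp
  qed (use m u T in auto)
  moreover have "H2ip u ?BT = of_real ((H2norm ?T)\<^sup>2)"
    using toep_adjoint[OF b u T] H2.ip_self[OF T] by simp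
  moreover have "H2ip ?BT u = of_real ((H2norm ?T)\<^sup>2)"
    using H2.ip_commute[OF u m(2)] calculation(2) by simp
  ultimately have "(H2norm ?T)\<^sup>2 \<le> (H2norm ?B)\<^sup>2"
    using m T by (simp add: H2.ip_self)
  then show ?thesis using H2.nrm_nonneg[OF m(1)] by (rule power2_le_imp_le)
qed

text \<open>
  The defect \<open>\<parallel>u\<parallel>\<^sup>2 - \<parallel>toep b u\<parallel>\<^sup>2\<close> grows at most by the factor \<open>c\<^sup>2\<close> under multiplication by \<open>\<phi>\<close>. On the circle
  it is the integral of \<open>(1 - \<bar>b\<bar>\<^sup>2) \<bar>u\<bar>\<^sup>2 + \<bar>cnj b u - t\<bar>\<^sup>2\<close> with \<open>t = toep b u\<close>, and \<open>\<phi> t\<close> is a competitor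
  for the best approximation of \<open>cnj b \<phi> u\<close> by analytic functions. In the form used here: the pointwise
  quantity \<open>(c\<^sup>2 - \<bar>\<phi>\<bar>\<^sup>2) (\<bar>u\<bar>\<^sup>2 - 2 Re (u cnj (b t)) + \<bar>t\<bar>\<^sup>2)\<close> is nonnegative and consists of eight
  products of an analytic with a conjugate analytic function.
\<close>

lemma defect_mult_le:
  assumes b: "b \<in> Hinf" "\<And>z. cmod z < 1 \<Longrightarrow> cmod (b z) \<le> 1"
    and p: "\<phi> \<in> Hinf" "\<And>z. cmod z < 1 \<Longrightarrow> cmod (\<phi> z) \<le> c" and u: "u \<in> H2"
  shows "(H2norm (\<lambda>z. \<phi> z * u z))\<^sup>2 - (H2norm (toep b (\<lambda>z. \<phi> z * u z)))\<^sup>2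
    \<le> c\<^sup>2 * ((H2norm u)\<^sup>2 - (H2norm (toep b u))\<^sup>2)"
proof -
  let ?T = "toep b u" and ?v = "\<lambda>z. \<phi> z * u z"
  let ?BT = "\<lambda>z. b z * ?T z" and ?PT = "\<lambda>z. \<phi> z * ?T z"
  let ?S = "toep b ?v"
  let ?BPT = "\<lambda>z. b z * (\<phi> z * ?T z)"
  have T: "?T \<in> H2" using b(1) u by (rule toep_H2)
  have v: "?v \<in> H2" using p(1) u by (rule Hinf_mult_H2)
  have S: "?S \<in> H2" using b(1) v by (rule toep_H2)
  have m: "?BT \<in> H2" "?PT \<in> H2" "?BPT \<in> H2" using b(1) p(1) T by (auto intro: Hinf_mult_H2)
  let ?C = "complex_of_real (c\<^sup>2)"
  let ?L = "[(?C, u, u), (- ?C, u, ?BT), (- ?C, ?BT, u), (?C, ?T, ?T),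
     (-1, ?v, ?v), (1, ?v, ?BPT), (1, ?BPT, ?v), (-1, ?PT, ?PT)]"
  have e: "w * cnj w = of_real ((cmod w)\<^sup>2)" for w by (simp only: complex_norm_square)
  have re: "Re (of_real x * w) = x * Re w" for x w by simp
  have "0 \<le> Re (\<Sum>(c, f, g)\<leftarrow>?L. c * H2ip f g)"
  proof (rule H2ip_form_nonneg)
    fix z :: complex assume z: "cmod z < 1"
    define U where "U = u z"
    define W where "W = b z * ?T z"
    define t where "t = ?T z"
    have tr: "Re (U * cnj U - U * cnj W - W * cnj U + t * cnj t) \<ge> 0"
    proof -
      have "cmod W \<le> cmod t" using b(2)[OF z] by (simp add: W_def t_def norm_mult mult_left_le_one_le)
      then have sq: "(cmod W)\<^sup>2 \<le> (cmod t)\<^sup>2" by (simp add: power_mono)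
      have eq: "U * cnj U - U * cnj W - W * cnj U + t * cnj t
          = (U - W) * cnj (U - W) - W * cnj W + t * cnj t"
        by (simp add: algebra_simps)
      have "U * cnj U - U * cnj W - W * cnj U + t * cnj t
          = of_real ((cmod (U - W))\<^sup>2 - (cmod W)\<^sup>2 + (cmod t)\<^sup>2)"
        unfolding eq unfolding e by (simp only: of_real_add of_real_diff)
      then show ?thesis using sq by (simp only: Re_complex_of_real) (smt (verit) zero_le_power2)
    qed
    have "(\<Sum>(c, f, g)\<leftarrow>?L. c * (f z * cnj (g z)))
        = (?C - \<phi> z * cnj (\<phi> z)) * (U * cnj U - U * cnj W - W * cnj U + t * cnj t)"
      by (simp add: U_def W_def t_def algebra_simps)
    also have "?C - \<phi> z * cnj (\<phi> z) = of_real (c\<^sup>2 - (cmod (\<phi> z))\<^sup>2)" by (simp add: e)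
    finally have "Re (\<Sum>(c, f, g)\<leftarrow>?L. c * (f z * cnj (g z)))
        = (c\<^sup>2 - (cmod (\<phi> z))\<^sup>2) * Re (U * cnj U - U * cnj W - W * cnj U + t * cnj t)"
      by (simp only: re)
    moreover have "0 \<le> c\<^sup>2 - (cmod (\<phi> z))\<^sup>2" using p(2)[OF z] by (simp add: power_mono)
    ultimately show "0 \<le> Re (\<Sum>(c, f, g)\<leftarrow>?L. c * (f z * cnj (g z)))" using tr by simp
  qed (use m u T v in auto)
  moreover have q1: "H2ip u ?BT = of_real ((H2norm ?T)\<^sup>2)"
    using toep_adjoint[OF b(1) u T] H2.ip_self[OF T] by simp
  moreover have "H2ip ?BT u = of_real ((H2norm ?T)\<^sup>2)" using H2.ip_commute[OF u m(1)] q1 by simp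
  moreover have q2: "H2ip ?v ?BPT = H2ip ?S ?PT" using toep_adjoint[OF b(1) v m(2)] by simp
  moreover have "H2ip ?BPT ?v = cnj (H2ip ?S ?PT)" using H2.ip_commute[OF v m(3)] q2 by simp
  ultimately have "0 \<le> c\<^sup>2 * (H2norm u)\<^sup>2 - c\<^sup>2 * (H2norm ?T)\<^sup>2 - (H2norm ?v)\<^sup>2 + 2 * Re (H2ip ?S ?PT) - (H2norm ?PT)\<^sup>2"
    using m u T v by (simp add: H2.ip_self)
  moreover have "0 \<le> (H2norm (\<lambda>z. ?S z - ?PT z))\<^sup>2" by simp
  ultimately show ?thesis unfolding H2.nrm_diff_sq[OF S m(2)] by (simp add: right_diff_distrib)
qed

subsection \<open>The Szego kernel\<close>

definition szego :: "complex \<Rightarrow> complex \<Rightarrow> complex" where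
  "szego l = of_coef (\<lambda>n. cnj l ^ n)"

lemma
  assumes l: "cmod l < 1"
  shows szego_H2: "szego l \<in> H2"
    and H2ip_szego: "f \<in> H2 \<Longrightarrow> H2ip f (szego l) = f l"
    and szego_eq: "cmod z < 1 \<Longrightarrow> szego l z = 1 / (1 - cnj l * z)"
proof -
  have s: "summable (\<lambda>n. (cmod (cnj l ^ n))\<^sup>2)"
  proof -
    have "summable (\<lambda>n. ((cmod l)\<^sup>2) ^ n)"
      using l by (intro summable_geometric) (simp add: power_less_one_iff abs_square_less_1)
    then show ?thesis by (simp add: norm_power power_mult[symmetric] mult.commute)
  qed
  have H: "szego l \<in> H2" and c: "coef (szego l) = (\<lambda>n. cnj l ^ n)"
    unfolding szego_def using of_coef_H2[OF s] by auto
  show "szego l \<in> H2" by (rule H)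
  show "H2ip f (szego l) = f l" if f: "f \<in> H2"
    using sums_unique2[OF H2ip_sums[OF f H] ] coef_sums[OF H2_hol_disc[OF f] l] by (simp add: c)
  assume z: "cmod z < 1"
  have "cmod (cnj l * z) < 1"
    using mult_strict_mono'[of "cmod l" 1 "cmod z" 1] l z by (simp add: norm_mult)
  then have "(\<lambda>n. (cnj l * z) ^ n) sums (1 / (1 - cnj l * z))" by (rule geometric_sums)
  moreover have "(\<lambda>n. (cnj l * z) ^ n) sums szego l z"
    using coef_sums[OF H2_hol_disc[OF H] z] by (simp add: c power_mult_distrib)
  ultimately show "szego l z = 1 / (1 - cnj l * z)" by (simp only: sums_unique2)
qed

lemma szego_Hinf:
  assumes l: "cmod l < 1"
  shows "szego l \<in> Hinf"
proof (rule HinfI[OF H2_hol_disc[OF szego_H2[OF l]]])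
  fix z :: complex assume z: "cmod z < 1"
  have "cmod l * cmod z \<le> cmod l * 1" using z by (intro mult_left_mono) auto
  then have "1 - cmod l \<le> cmod (1 - cnj l * z)"
    using norm_triangle_ineq2[of 1 "cnj l * z"] by (simp add: norm_mult)
  then have "1 / cmod (1 - cnj l * z) \<le> 1 / (1 - cmod l)"
    using l by (intro divide_left_mono mult_pos_pos) auto
  then show "cmod (szego l z) \<le> 1 / (1 - cmod l)"
    by (simp add: szego_eq[OF l z] norm_divide)
qed

lemma toep_szego:
  assumes p: "\<phi> \<in> Hinf" and l: "cmod l < 1"
  shows "toep \<phi> (szego l) = (\<lambda>z. cnj (\<phi> l) * szego l z)"
proof (rule H2_eqI)
  fix u assume u: "u \<in> H2"
  have "H2ip (toep \<phi> (szego l)) u = cnj (H2ip (\<lambda>z. \<phi> z * u z) (szego l))"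
    using toep_adjoint[OF p szego_H2[OF l] u] H2.ip_commute[OF Hinf_mult_H2[OF p u] szego_H2[OF l]] by simp
  also have "\<dots> = cnj (\<phi> l) * cnj (H2ip u (szego l))"
    using H2ip_szego[OF l Hinf_mult_H2[OF p u]] H2ip_szego[OF l u] by simp
  also have "\<dots> = H2ip (\<lambda>z. cnj (\<phi> l) * szego l z) u"
    using H2.ip_commute[OF u szego_H2[OF l]] by (simp add: H2.ip_scale_left szego_H2 l u)
  finally show "H2ip (toep \<phi> (szego l)) u = H2ip (\<lambda>z. cnj (\<phi> l) * szego l z) u" .
qed (use p l in \<open>auto intro: toep_H2 szego_H2 H2.scale_mem\<close>)

lemma toep_add:
  assumes p: "\<phi> \<in> Hinf" and f: "f \<in> H2" and g: "g \<in> H2"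
  shows "toep \<phi> (\<lambda>z. f z + g z) = (\<lambda>z. toep \<phi> f z + toep \<phi> g z)"
  by (rule H2_eqI)
     (simp_all add: toep_adjoint p f g toep_H2 H2.add_mem H2.ip_add_left Hinf_mult_H2)

lemma toep_scale:
  assumes p: "\<phi> \<in> Hinf" and f: "f \<in> H2"
  shows "toep \<phi> (\<lambda>z. c * f z) = (\<lambda>z. c * toep \<phi> f z)"
  by (rule H2_eqI)
     (simp_all add: toep_adjoint p f toep_H2 H2.scale_mem H2.ip_scale_left Hinf_mult_H2)

lemma Hinf_mult: "\<phi> \<in> Hinf \<Longrightarrow> \<psi> \<in> Hinf \<Longrightarrow> (\<lambda>z. \<phi> z * \<psi> z) \<in> Hinf"
proof -
  assume p: "\<phi> \<in> Hinf" and q: "\<psi> \<in> Hinf"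
  obtain c where c: "0 < c" "\<And>z. cmod z < 1 \<Longrightarrow> cmod (\<phi> z) \<le> c" using Hinf_bound[OF p] by blast
  obtain d where d: "0 < d" "\<And>z. cmod z < 1 \<Longrightarrow> cmod (\<psi> z) \<le> d" using Hinf_bound[OF q] by blast
  show ?thesis
  proof (rule HinfI)
    show "(\<lambda>z. \<phi> z * \<psi> z) \<in> hol_disc" using p q by (intro mult_hol_disc Hinf_hol_disc)
    show "cmod (\<phi> z * \<psi> z) \<le> c * d" if "cmod z < 1" for z
      unfolding norm_mult using c(1) c(2)[OF that] d(2)[OF that] by (intro mult_mono) auto
  qed
qed

lemma toep_toep:
  assumes p: "\<phi> \<in> Hinf" and q: "\<psi> \<in> Hinf" and f: "f \<in> H2"
  shows "toep \<phi> (toep \<psi> f) = toep (\<lambda>z. \<psi> z * \<phi> z) f"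
  by (rule H2_eqI)
     (simp_all add: toep_adjoint p q f toep_H2 Hinf_mult_H2 Hinf_mult mult.assoc)

lemma zpow_Hinf: "zpow n \<in> Hinf"
  by (rule HinfI[OF zpow_hol_disc, of _ 1]) (auto simp: zpow_def norm_power power_le_one)

subsection \<open>The shift and products\<close>

lemma shift_H2: "f \<in> H2 \<Longrightarrow> (\<lambda>z. z ^ k * f z) \<in> H2"
  using Hinf_mult_H2[OF zpow_Hinf, of f k] by (simp add: zpow_mult_hol_disc H2_hol_disc)

lemma H2ip_shift:
  assumes f: "f \<in> H2" and g: "g \<in> H2"
  shows "H2ip (\<lambda>z. z ^ k * f z) (\<lambda>z. z ^ k * g z) = H2ip f g"
proof -
  have "(\<lambda>n. coef f n * cnj (coef g n)) sums H2ip f g" by (rule H2ip_sums[OF f g])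
  then have "(\<lambda>n. coef (\<lambda>z. z ^ k * f z) (n + k) * cnj (coef (\<lambda>z. z ^ k * g z) (n + k))) sums H2ip f g"
    by (simp add: coef_shift H2_hol_disc f g)
  then have "(\<lambda>n. coef (\<lambda>z. z ^ k * f z) n * cnj (coef (\<lambda>z. z ^ k * g z) n)) sums H2ip f g"
    by (subst (asm) sums_iff_shift) (simp add: coef_shift H2_hol_disc f g)
  then show ?thesis by (rule sums_unique2[OF H2ip_sums[OF shift_H2[OF f] shift_H2[OF g]]])
qed

lemma coef_mult:
  assumes f: "f \<in> hol_disc" and g: "g \<in> hol_disc"
  shows "coef (\<lambda>z. f z * g z) = (\<lambda>k. \<Sum>i\<le>k. coef f i * coef g (k - i))"
proof (rule coef_unique[OF mult_hol_disc[OF f g]])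
  fix z :: complex assume z: "cmod z < 1"
  have ab: "summable (\<lambda>n. norm (coef h n * z ^ n))" if "h \<in> hol_disc" for h
    using coef_abs_summable[OF that, of "cmod z"] z by (simp add: norm_mult norm_power)
  have "(\<lambda>k. \<Sum>i\<le>k. (coef f i * z ^ i) * (coef g (k - i) * z ^ (k - i))) sums
      ((\<Sum>n. coef f n * z ^ n) * (\<Sum>n. coef g n * z ^ n))"
    by (rule Cauchy_product_sums[OF ab[OF f] ab[OF g]])
  moreover have "(\<Sum>i\<le>k. (coef f i * z ^ i) * (coef g (k - i) * z ^ (k - i)))
      = (\<Sum>i\<le>k. coef f i * coef g (k - i)) * z ^ k" for k
    unfolding sum_distrib_right
  proof (rule sum.cong[OF refl])
    fix i assume "i \<in> {..k}"
    then have "z ^ k = z ^ i * z ^ (k - i)" by (simp add: power_add[symmetric])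
    then show "(coef f i * z ^ i) * (coef g (k - i) * z ^ (k - i)) = coef f i * coef g (k - i) * z ^ k"
      by (simp add: mult_ac)
  qed
  ultimately show "(\<lambda>k. (\<Sum>i\<le>k. coef f i * coef g (k - i)) * z ^ k) sums (f z * g z)"
    using sums_unique[OF coef_sums[OF f z]] sums_unique[OF coef_sums[OF g z]] by simp
qed

lemma taylor_eq_lin_comb: "taylor u K = lin_comb zpow (map (\<lambda>n. (coef u n, n)) [0..<K])"
  by (induction K) (auto simp: taylor_0 taylor_Suc lin_comb_Nil lin_comb_append lin_comb_Cons)

text \<open>
  Removing one component after the other leaves a remainder whose squared norm is the difference.
\<close>

lemma Bessel:
  fixes e :: "nat \<Rightarrow> complex \<Rightarrow> complex"
  assumes e: "\<And>k. e k \<in> H2" "\<And>j k. H2ip (e j) (e k) = (if j = k then 1 else 0)" and q: "q \<in> H2"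
  shows "(\<Sum>k<K. (cmod (H2ip q (e k)))\<^sup>2) \<le> (H2norm q)\<^sup>2"
proof -
  have "\<exists>r\<in>H2. (\<forall>j. H2ip r (e j) = (if j < K then 0 else H2ip q (e j))) \<and>
      (H2norm r)\<^sup>2 = (H2norm q)\<^sup>2 - (\<Sum>k<K. (cmod (H2ip q (e k)))\<^sup>2)"
  proof (induction K)
    case 0
    show ?case using q by (intro bexI[of _ q]) auto
  next
    case (Suc K)
    then obtain r where r: "r \<in> H2" "\<And>j. H2ip r (e j) = (if j < K then 0 else H2ip q (e j))"
      "(H2norm r)\<^sup>2 = (H2norm q)\<^sup>2 - (\<Sum>k<K. (cmod (H2ip q (e k)))\<^sup>2)" by blast
    define c where "c = H2ip q (e K)"
    let ?r = "\<lambda>z. r z - c * e K z"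
    have "(H2norm ?r)\<^sup>2 = (H2norm r)\<^sup>2 - 2 * Re (cnj c * c) + (cmod c)\<^sup>2 * (H2norm (e K))\<^sup>2"
      using r(1,2) e(1) by (simp add: H2.nrm_diff_sq H2.scale_mem H2.ip_scale_right H2.nrm_scale_sq c_def)
    moreover have "(H2norm (e K))\<^sup>2 = 1"
    proof -
      have "complex_of_real ((H2norm (e K))\<^sup>2) = 1" using H2.ip_self[OF e(1), of K] e(2)[of K K] by simp
      then show ?thesis by (simp only: of_real_eq_1_iff)
    qed
    moreover have "Re (cnj c * c) = (cmod c)\<^sup>2"
    proof -
      have "cnj c * c = of_real ((cmod c)\<^sup>2)" by (simp only: complex_norm_square mult.commute)
      then show ?thesis by (simp only: Re_complex_of_real)
    qed
    ultimately have "(H2norm ?r)\<^sup>2 = (H2norm q)\<^sup>2 - (\<Sum>k<Suc K. (cmod (H2ip q (e k)))\<^sup>2)"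
      using r(3) by (simp add: c_def)
    moreover have "H2ip ?r (e j) = (if j < Suc K then 0 else H2ip q (e j))" for j
      using r(1,2) e by (auto simp: H2.ip_diff_left H2.ip_scale_left H2.scale_mem c_def less_Suc_eq)
    moreover have "?r \<in> H2" by (intro H2.diff_mem H2.scale_mem r(1) e(1))
    ultimately show ?case by (intro bexI[of _ ?r] conjI allI)
  qed
  then obtain r where "(H2norm r)\<^sup>2 = (H2norm q)\<^sup>2 - (\<Sum>k<K. (cmod (H2ip q (e k)))\<^sup>2)" by blast
  then show ?thesis using zero_le_power2[of "H2norm r"] by linarith
qed


subsection \<open>The outer part of a bounded function\<close>

lemma Hinf_mult_tendsto:
  assumes p: "\<phi> \<in> Hinf" and X: "\<And>n. X n \<in> H2" and f: "f \<in> H2"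
    and lim: "(\<lambda>n. H2norm (\<lambda>z. X n z - f z)) \<longlonglongrightarrow> 0"
  shows "(\<lambda>n. H2norm (\<lambda>z. \<phi> z * X n z - \<phi> z * f z)) \<longlonglongrightarrow> 0"
proof -
  obtain c where c: "0 < c" "\<And>z. cmod z < 1 \<Longrightarrow> cmod (\<phi> z) \<le> c" using Hinf_bound[OF p] by blast
  show ?thesis
  proof (rule Lim_null_comparison)
    have "H2norm (\<lambda>z. \<phi> z * X n z - \<phi> z * f z) \<le> c * H2norm (\<lambda>z. X n z - f z)" for n
      using mult_H2norm_le[OF Hinf_hol_disc[OF p] c(2) H2.diff_mem[OF X f], of n]
      by (simp add: right_diff_distrib)
    then show "\<forall>\<^sub>F n in sequentially. norm (H2norm (\<lambda>z. \<phi> z * X n z - \<phi> z * f z)) \<le> c * H2norm (\<lambda>z. X n z - f z)"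
      using H2.nrm_nonneg[OF H2.diff_mem[OF Hinf_mult_H2[OF p X] Hinf_mult_H2[OF p f]]] by simp
    show "(\<lambda>n. c * H2norm (\<lambda>z. X n z - f z)) \<longlonglongrightarrow> 0"
      using tendsto_mult_left[OF lim, of c] by simp
  qed
qed

lemma shift_tendsto:
  assumes "\<And>n. X n \<in> H2" "f \<in> H2" "(\<lambda>n. H2norm (\<lambda>z. X n z - f z)) \<longlonglongrightarrow> 0"
  shows "(\<lambda>n. H2norm (\<lambda>z. z ^ k * X n z - z ^ k * f z)) \<longlonglongrightarrow> 0"
  using Hinf_mult_tendsto[OF zpow_Hinf[of k] assms]
  by (simp add: zpow_mult_hol_disc H2_hol_disc assms(1,2))

lemma polynomial_H2: "lin_comb zpow xs \<in> H2"
  by (rule H2.lin_comb_mem[of UNIV]) (auto simp: zpow_H2)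

lemma shift_polynomial:
  "z ^ k * lin_comb zpow xs z = lin_comb zpow (map (\<lambda>(c, i). (c, i + k)) xs) z"
proof (induction xs)
  case (Cons x xs)
  then show ?case by (cases x) (simp add: lin_comb_Cons distrib_left zpow_def power_add mult_ac)
qed (simp add: lin_comb_Nil)

lemma H2_from_partial_sums:
  assumes f: "f \<in> hol_disc" and le: "\<And>N. (\<Sum>k<N. (cmod (coef f k))\<^sup>2) \<le> C\<^sup>2" and C: "0 \<le> C"
  shows "f \<in> H2" "H2norm f \<le> C"
proof -
  have s: "summable (\<lambda>k. (cmod (coef f k))\<^sup>2)"
    using le[of "Suc _"] by (intro bounded_imp_summable[of _ "C\<^sup>2"]) (simp_all only: lessThan_Suc_atMost zero_le_power2)
  then show fH: "f \<in> H2" using f by (simp add: H2_iff)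
  have "(H2norm f)\<^sup>2 \<le> C\<^sup>2" unfolding H2norm_sq[OF fH] by (rule suminf_le_const[OF s le])
  then show "H2norm f \<le> C" using C by (rule power2_le_imp_le)
qed

lemma partial_sum_le_H2norm: "f \<in> H2 \<Longrightarrow> (\<Sum>k<N. (cmod (coef f k))\<^sup>2) \<le> (H2norm f)\<^sup>2"
  unfolding H2norm_sq by (rule sum_le_suminf[OF H2_summable]) auto

text \<open>
  The outer part \<open>g\<close> of \<open>h\<close>: it is dominated by \<open>h\<close> as a multiplier, and its polynomial multiples
  approximate the constant \<open>1\<close>. Beurling's argument produces the inner factor \<open>\<theta>\<close> as a unit
  vector in the closed span of the functions \<open>z\<^sup>k h\<close> that is orthogonal to all \<open>z\<^sup>k h\<close> with \<open>k \<ge> 1\<close>; then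
  the functions \<open>z\<^sup>k \<theta>\<close> are orthonormal. Passing to the coefficients with respect to this system is a
  contraction \<open>A\<close> that commutes with multiplication by polynomials on the span, maps \<open>\<theta>\<close> to \<open>1\<close>, and
  maps \<open>h\<close> to \<open>g\<close>.
\<close>

theorem outer_part:
  assumes h: "h \<in> Hinf" and h0: "h \<noteq> (\<lambda>z. 0)" and h1: "\<And>z. cmod z < 1 \<Longrightarrow> cmod (h z) \<le> 1"
  obtains g xs where "g \<in> Hinf" "\<And>z. cmod z < 1 \<Longrightarrow> cmod (g z) \<le> 1"
    "\<And>u. u \<in> H2 \<Longrightarrow> H2norm (\<lambda>z. g z * u z) \<le> H2norm (\<lambda>z. h z * u z)"
    "(\<lambda>n. H2norm (\<lambda>z. g z * lin_comb zpow (xs n) z - zpow 0 z)) \<longlonglongrightarrow> 0"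
proof -
  have hh: "h \<in> hol_disc" using h by (rule Hinf_hol_disc)
  have hH: "h \<in> H2" using h by (rule Hinf_H2)
  have "\<exists>n. coef h n \<noteq> 0"
  proof (rule ccontr)
    assume "\<not> (\<exists>n. coef h n \<noteq> 0)"
    then have "coef h = coef (\<lambda>z. 0)" by (simp add: coef_zero fun_eq_iff)
    then show False using h0 hol_disc_eq_if_coef_eq[OF hh zero_hol_disc] by blast
  qed
  define m where "m = (LEAST n. coef h n \<noteq> 0)"
  have m: "coef h m \<noteq> 0" unfolding m_def using \<open>\<exists>n. coef h n \<noteq> 0\<close> by (rule LeastI_ex)
  have mless: "coef h j = 0" if "j < m" for j using not_less_Least that unfolding m_def by blast
  define hp where "hp xs = (\<lambda>z. h z * lin_comb zpow xs z)" for xs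
  have hpH: "hp xs \<in> H2" for xs unfolding hp_def by (rule Hinf_mult_H2[OF h polynomial_H2])
  have hpless: "coef (hp xs) j = 0" if "j < m" for xs j
    unfolding hp_def using that by (simp add: coef_mult hh H2_hol_disc polynomial_H2 mless)
  have shift0: "coef (\<lambda>z. z ^ k * hp xs z) m = 0" if "1 \<le> k" for k xs
    using hpless[of "m - k"] that by (cases "m < k") (auto simp: coef_shift H2_hol_disc hpH)
  have shp: "(\<lambda>z. z ^ k * hp xs z) = hp (map (\<lambda>(c, i). (c, i + k)) xs)" for k xs
    by (simp add: hp_def fun_eq_iff shift_polynomial[symmetric] mult_ac)
  have hp1: "hp [(1, 0)] = h"
    using Hinf_mult_zpow0[OF hh] by (simp add: hp_def lin_comb_Cons lin_comb_Nil)
  \<comment> \<open>the leading coefficient, at the order \<open>m\<close> of the zero of \<open>h\<close> at the origin, is a bounded functional;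
    its representing vector is orthogonal to \<open>z h\<close>, \<open>z\<^sup>2 h\<close> and so on\<close>
  define G where "G = (\<lambda>xs. (hp xs, coef (hp xs) m)) ` UNIV"
  have Gin: "(hp xs, coef (hp xs) m) \<in> G" for xs by (auto simp: G_def)
  obtain F X where F: "F \<in> H2" "\<And>v d. (v, d) \<in> G \<Longrightarrow> H2ip v F = d" "H2norm F \<le> 1 \<or> F = (\<lambda>z. 0)"
    and X: "\<And>n. \<exists>c. (X n, c) \<in> G" "(\<lambda>n. H2norm (\<lambda>z. X n z - F z)) \<longlonglongrightarrow> 0"
  proof (rule H2.Riesz_relation[of G 1])
    show "G \<noteq> {}" using Gin by blast
    show "u \<in> H2" if "(u, c) \<in> G" for u c using that hpH by (auto simp: G_def)
    show "cmod c \<le> 1 * H2norm u" if "(u, c) \<in> G" for u c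
      using that coef_le_H2norm[OF hpH] by (auto simp: G_def)
    show "(\<lambda>z. u z + a * v z, c + a * d) \<in> G" if uv: "(u, c) \<in> G" "(v, d) \<in> G" for u c v d a
    proof -
      obtain xs ys where xy: "u = hp xs" "c = coef (hp xs) m" "v = hp ys" "d = coef (hp ys) m"
        using uv by (auto simp: G_def)
      have e: "(\<lambda>z. u z + a * v z) = hp (xs @ map (\<lambda>(c, i). (a * c, i)) ys)"
        unfolding xy hp_def lin_comb_append lin_comb_scale by (simp add: fun_eq_iff algebra_simps)
      have "coef (\<lambda>z. u z + a * v z) m = c + a * d"
        unfolding xy by (simp add: coef_add coef_scale H2_hol_disc hpH H2.scale_mem)
      then show ?thesis using Gin[of "xs @ map (\<lambda>(c, i). (a * c, i)) ys"] by (simp add: e[symmetric])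
    qed
  qed (rule that)
  have rep: "H2ip (hp xs) F = coef (hp xs) m" for xs using F(2) Gin by blast
  have "\<exists>xs. X n = hp xs" for n using X(1)[of n] by (auto simp: G_def)
  then obtain xs where xs: "\<And>n. X n = hp (xs n)" by metis
  have XH: "X n \<in> H2" for n by (simp add: xs hpH)
  define nF where "nF = H2norm F"
  have "nF \<noteq> 0"
  proof
    assume "nF = 0"
    then have "F = (\<lambda>z. 0)" using H2.nrm_eq_0 F(1) by (simp add: nF_def)
    then have "H2ip (hp [(1, 0)]) F = 0"
      using H2.ip_commute[OF H2.zero_mem hpH] H2.ip_zero_left[OF hpH] by simp
    then show False using rep[of "[(1, 0)]"] m by (simp add: hp1)
  qed
  then have nF: "nF > 0" using H2.nrm_nonneg[OF F(1)] by (simp add: nF_def)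
  have Forth: "H2ip (\<lambda>z. z ^ k * F z) F = 0" if k: "1 \<le> k" for k
  proof -
    have "(\<lambda>n. H2ip (\<lambda>z. z ^ k * X n z) F) \<longlonglongrightarrow> H2ip (\<lambda>z. z ^ k * F z) F"
      by (rule H2.tendsto_ip_left[OF shift_H2[OF XH] shift_H2[OF F(1)] F(1) shift_tendsto[OF XH F(1) X(2)]])
    moreover have "H2ip (\<lambda>z. z ^ k * X n z) F = 0" for n
      using rep[of "map (\<lambda>(c, i). (c, i + k)) (xs n)"] shift0[OF k, of "xs n"] by (simp add: xs shp)
    ultimately show ?thesis by (simp add: LIMSEQ_const_iff)
  qed
  define \<kappa> where "\<kappa> = complex_of_real (1 / nF)"
  have ck: "cnj \<kappa> = \<kappa>" by (simp add: \<kappa>_def)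
  define \<theta> where "\<theta> = (\<lambda>z. \<kappa> * F z)"
  have \<theta>: "\<theta> \<in> H2" unfolding \<theta>_def by (rule H2.scale_mem[OF F(1)])
  have \<theta>orth: "H2ip (\<lambda>z. z ^ k * \<theta> z) \<theta> = (if k = 0 then 1 else 0)" for k
  proof -
    have "(\<lambda>z. z ^ k * \<theta> z) = (\<lambda>z. \<kappa> * (z ^ k * F z))" by (simp add: \<theta>_def fun_eq_iff)
    then have "H2ip (\<lambda>z. z ^ k * \<theta> z) \<theta> = \<kappa> * (\<kappa> * H2ip (\<lambda>z. z ^ k * F z) F)"
      by (simp add: \<theta>_def H2.ip_scale_left H2.ip_scale_right shift_H2 F(1) H2.scale_mem ck)
    also have "\<dots> = (if k = 0 then 1 else 0)"
      using Forth[of k] nF H2.ip_self[OF F(1)] by (auto simp: nF_def[symmetric] power2_eq_square \<kappa>_def)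
    finally show ?thesis .
  qed
  define e where "e k = (\<lambda>z. z ^ k * \<theta> z)" for k
  have eH: "e k \<in> H2" for k unfolding e_def by (rule shift_H2[OF \<theta>])
  have eshift: "(\<lambda>z. z ^ k * e j z) = e (k + j)" for k j by (simp add: e_def power_add mult.assoc)
  have eorth: "H2ip (e j) (e k) = (if j = k then 1 else 0)" for j k
  proof -
    have *: "H2ip (e (k + i)) (e k) = (if i = 0 then 1 else 0)" for k i
      using H2ip_shift[OF eH[of i] eH[of 0], of k] \<theta>orth[of i] unfolding eshift by (simp add: e_def)
    show ?thesis
    proof (cases "k \<le> j")
      case True
      then show ?thesis using *[of k "j - k"] by auto
    next
      case False
      then show ?thesis using *[of j "k - j"] H2.ip_commute[OF eH[of k] eH[of j]] by auto
    qed
  qed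
  \<comment> \<open>the contraction to the coefficients with respect to the orthonormal system\<close>
  define A where "A q = of_coef (\<lambda>k. H2ip q (e k))" for q
  have A_all: "A q \<in> H2 \<and> coef (A q) = (\<lambda>k. H2ip q (e k)) \<and> H2norm (A q) \<le> H2norm q" if q: "q \<in> H2" for q
  proof -
    have b: "(\<Sum>k<N. (cmod (H2ip q (e k)))\<^sup>2) \<le> (H2norm q)\<^sup>2" for N by (rule Bessel[OF eH eorth q])
    from b[of "Suc _"] have s: "summable (\<lambda>k. (cmod (H2ip q (e k)))\<^sup>2)"
      by (intro bounded_imp_summable[of _ "(H2norm q)\<^sup>2"]) (simp_all only: lessThan_Suc_atMost zero_le_power2)
    have c: "A q \<in> H2" "coef (A q) = (\<lambda>k. H2ip q (e k))" unfolding A_def using of_coef_H2[OF s] by auto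
    have "H2norm (A q) \<le> H2norm q"
      by (rule H2_from_partial_sums(2)[OF H2_hol_disc[OF c(1)] _ H2.nrm_nonneg[OF q]]) (simp add: c(2) b)
    then show ?thesis using c by blast
  qed
  have AH: "A q \<in> H2" and Ac: "coef (A q) = (\<lambda>k. H2ip q (e k))" and An: "H2norm (A q) \<le> H2norm q"
    if "q \<in> H2" for q using A_all[OF that] by blast+
  have A_lin: "A (\<lambda>z. c * p z + q z) = (\<lambda>z. c * A p z + A q z)" if p: "p \<in> H2" and q: "q \<in> H2" for c p q
  proof (rule hol_disc_eq_if_coef_eq)
    show "coef (A (\<lambda>z. c * p z + q z)) = coef (\<lambda>z. c * A p z + A q z)"
      using p q eH by (simp add: Ac AH H2.add_mem H2.scale_mem H2.ip_add_left H2.ip_scale_left coef_add coef_scale H2_hol_disc)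
  qed (use p q in \<open>auto intro!: H2_hol_disc AH H2.add_mem H2.scale_mem\<close>)
  define g where "g = A h"
  have gH: "g \<in> H2" unfolding g_def by (rule AH[OF hH])
  have gh: "g \<in> hol_disc" using gH by (rule H2_hol_disc)
  have A_zpow: "A (\<lambda>z. h z * zpow i z) = (\<lambda>z. g z * zpow i z)" for i
  proof -
    have 1: "(\<lambda>z. h z * zpow i z) = (\<lambda>z. z ^ i * h z)" "(\<lambda>z. g z * zpow i z) = (\<lambda>z. z ^ i * g z)"
      using zpow_mult_hol_disc[OF hh, of i] zpow_mult_hol_disc[OF gh, of i] by (simp_all only: mult.commute[of "h _"] mult.commute[of "g _"])
    show ?thesis
      unfolding 1
    proof (rule hol_disc_eq_if_coef_eq)
      show "coef (A (\<lambda>z. z ^ i * h z)) = coef (\<lambda>z. z ^ i * g z)"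
      proof
        fix k
        show "coef (A (\<lambda>z. z ^ i * h z)) k = coef (\<lambda>z. z ^ i * g z) k"
        proof (cases "k < i")
          case True
          have "H2ip (\<lambda>z. z ^ i * h z) (e k) = H2ip (\<lambda>z. z ^ k * (z ^ (i - k) * h z)) (\<lambda>z. z ^ k * \<theta> z)"
            using True by (simp add: e_def mult.assoc[symmetric] power_add[symmetric])
          also have "\<dots> = H2ip (\<lambda>z. z ^ (i - k) * h z) \<theta>" by (rule H2ip_shift[OF shift_H2[OF hH] \<theta>])
          also have "\<dots> = \<kappa> * H2ip (\<lambda>z. z ^ (i - k) * h z) F"
            by (simp add: \<theta>_def H2.ip_scale_right shift_H2 hH F(1) ck)
          also have "H2ip (\<lambda>z. z ^ (i - k) * h z) F = 0"
            using rep[of "map (\<lambda>(c, l). (c, l + (i - k))) [(1, 0)]"] shift0[of "i - k" "[(1, 0)]"] shp[of "i - k" "[(1, 0)]"] True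
            by (simp add: hp1)
          finally show ?thesis using True by (simp add: Ac shift_H2 hH coef_shift gh)
        next
          case False
          have "e k = (\<lambda>z. z ^ i * e (k - i) z)" using False eshift[of i "k - i"] by simp
          then have "H2ip (\<lambda>z. z ^ i * h z) (e k) = H2ip h (e (k - i))"
            using H2ip_shift[OF hH eH[of "k - i"], of i] by simp
          then show ?thesis using False by (simp add: Ac shift_H2 hH coef_shift gh) (simp add: g_def Ac hH)
        qed
      qed
    qed (auto intro!: H2_hol_disc AH shift_H2 hH gH)
  qed
  have A_hp: "A (hp ys) = (\<lambda>z. g z * lin_comb zpow ys z)" for ys
  proof (induction ys)
    case Nil
    have "coef (A (\<lambda>z. 0)) = coef (\<lambda>z. 0)" using H2.ip_zero_left[OF eH] by (simp add: Ac H2.zero_mem coef_zero)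
    then have "A (\<lambda>z. 0) = (\<lambda>z. 0)"
      by (intro hol_disc_eq_if_coef_eq H2_hol_disc AH H2.zero_mem)
    then show ?case by (simp add: hp_def lin_comb_Nil)
  next
    case (Cons y ys)
    obtain c i where y: "y = (c, i)" by (cases y)
    have "hp (y # ys) = (\<lambda>z. c * (h z * zpow i z) + hp ys z)"
      by (simp add: hp_def y lin_comb_Cons algebra_simps)
    then have "A (hp (y # ys)) = (\<lambda>z. c * (g z * zpow i z) + g z * lin_comb zpow ys z)"
      using A_lin[OF Hinf_mult_H2[OF h zpow_H2] hpH, of c i ys] Cons A_zpow by simp
    then show ?case by (simp add: y lin_comb_Cons algebra_simps)
  qed
  have gp: "H2norm (\<lambda>z. g z * lin_comb zpow ys z) \<le> H2norm (\<lambda>z. h z * lin_comb zpow ys z)"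
    "(\<lambda>z. g z * lin_comb zpow ys z) \<in> H2" for ys
    using An[OF hpH] AH[OF hpH] unfolding A_hp by (simp_all add: hp_def)
  \<comment> \<open>from polynomials to all of the Hardy space, one partial sum of coefficients at a time\<close>
  have gu: "(\<lambda>z. g z * u z) \<in> H2" "H2norm (\<lambda>z. g z * u z) \<le> H2norm (\<lambda>z. h z * u z)" if u: "u \<in> H2" for u
  proof -
    have hu: "(\<lambda>z. h z * u z) \<in> H2" by (rule Hinf_mult_H2[OF h u])
    have le: "(\<Sum>k<N. (cmod (coef (\<lambda>z. g z * u z) k))\<^sup>2) \<le> (H2norm (\<lambda>z. h z * u z))\<^sup>2" for N
    proof (rule LIMSEQ_le_const)
      show "(\<lambda>K. (H2norm (\<lambda>z. h z * taylor u K z))\<^sup>2) \<longlonglongrightarrow> (H2norm (\<lambda>z. h z * u z))\<^sup>2"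
        by (intro tendsto_power H2.tendsto_nrm Hinf_mult_H2 h taylor_H2 u Hinf_mult_tendsto taylor_tendsto)
      have "(\<Sum>k<N. (cmod (coef (\<lambda>z. g z * u z) k))\<^sup>2) \<le> (H2norm (\<lambda>z. h z * taylor u K z))\<^sup>2" if "K \<ge> N" for K
      proof -
        have "coef (\<lambda>z. g z * u z) k = coef (\<lambda>z. g z * taylor u K z) k" if "k < N" for k
          using that \<open>K \<ge> N\<close> by (auto simp: coef_mult gh H2_hol_disc u taylor_H2 coef_taylor intro!: sum.cong)
        then have "(\<Sum>k<N. (cmod (coef (\<lambda>z. g z * u z) k))\<^sup>2) = (\<Sum>k<N. (cmod (coef (\<lambda>z. g z * taylor u K z) k))\<^sup>2)"
          by simp
        also have "\<dots> \<le> (H2norm (\<lambda>z. g z * taylor u K z))\<^sup>2"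
          unfolding taylor_eq_lin_comb by (rule partial_sum_le_H2norm[OF gp(2)])
        also have "\<dots> \<le> (H2norm (\<lambda>z. h z * taylor u K z))\<^sup>2"
          unfolding taylor_eq_lin_comb by (rule power_mono[OF gp(1) H2.nrm_nonneg[OF gp(2)]])
        finally show ?thesis .
      qed
      then show "\<exists>N'. \<forall>K\<ge>N'. (\<Sum>k<N. (cmod (coef (\<lambda>z. g z * u z) k))\<^sup>2) \<le> (H2norm (\<lambda>z. h z * taylor u K z))\<^sup>2"
        by (intro exI[of _ N]) simp
    qed
    show "(\<lambda>z. g z * u z) \<in> H2" "H2norm (\<lambda>z. g z * u z) \<le> H2norm (\<lambda>z. h z * u z)"
      using H2_from_partial_sums[OF mult_hol_disc[OF gh H2_hol_disc[OF u]] le H2.nrm_nonneg[OF hu]] by auto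
  qed
  \<comment> \<open>kernels are eigenvectors of the adjoint, so a contractive multiplier is bounded by 1\<close>
  have g1: "cmod (g z) \<le> 1" if z: "cmod z < 1" for z
  proof -
    have sz: "szego z \<in> H2" by (rule szego_H2[OF z])
    define N where "N = H2norm (szego z)"
    have szz: "szego z z = of_real (N\<^sup>2)" using H2ip_szego[OF z sz] H2.ip_self[OF sz] by (simp add: N_def)
    have "szego z z \<noteq> 0" using szego_eq[OF z z] z
      by (simp add: complex_norm_square[symmetric] mult.commute)
         (metis abs_norm_cancel abs_square_eq_1 less_irrefl of_real_eq_1_iff of_real_power)
    then have N: "0 < N" using szz H2.nrm_nonneg[OF sz] by (auto simp: N_def less_le)
    have "cmod (g z * szego z z) = cmod (H2ip (\<lambda>w. g w * szego z w) (szego z))"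
      using H2ip_szego[OF z gu(1)[OF sz]] by simp
    also have "\<dots> \<le> H2norm (\<lambda>w. g w * szego z w) * N"
      unfolding N_def by (rule H2.Cauchy_Schwarz[OF gu(1)[OF sz] sz])
    also have "\<dots> \<le> (1 * N) * N"
      using order_trans[OF gu(2)[OF sz] mult_H2norm_le[OF hh h1 sz]] N unfolding N_def by (intro mult_right_mono) auto
    finally have "cmod (g z) * N\<^sup>2 \<le> 1 * N\<^sup>2" by (simp add: szz norm_mult power2_eq_square)
    then show ?thesis using N by (simp only: mult_le_cancel_right_pos zero_less_power)
  qed
  have cyc: "(\<lambda>n. H2norm (\<lambda>z. g z * lin_comb zpow (map (\<lambda>(c, i). (\<kappa> * c, i)) (xs n)) z - zpow 0 z)) \<longlonglongrightarrow> 0"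
  proof (rule Lim_null_comparison)
    have A\<theta>: "A \<theta> = zpow 0"
    proof (rule hol_disc_eq_if_coef_eq)
      have \<theta>e: "\<theta> = e 0" by (simp add: e_def)
      show "coef (A \<theta>) = coef (zpow 0)"
        unfolding \<theta>e Ac[OF eH] eorth coef_zpow by auto
    qed (auto intro!: H2_hol_disc AH \<theta> zpow_H2)
    have "H2norm (\<lambda>z. g z * lin_comb zpow (map (\<lambda>(c, i). (\<kappa> * c, i)) (xs n)) z - zpow 0 z)
        \<le> 1 / nF * H2norm (\<lambda>z. X n z - F z)" for n
    proof -
      let ?ys = "map (\<lambda>(c, i). (\<kappa> * c, i)) (xs n)"
      have "A (\<lambda>z. (-1) * \<theta> z + hp ?ys z) = (\<lambda>z. (-1) * zpow 0 z + g z * lin_comb zpow ?ys z)"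
        by (simp only: A_lin[OF \<theta> hpH] A\<theta> A_hp)
      then have "(\<lambda>z. g z * lin_comb zpow ?ys z - zpow 0 z) = A (\<lambda>z. (-1) * \<theta> z + hp ?ys z)"
        by (simp add: fun_eq_iff)
      moreover have "(\<lambda>z. (-1) * \<theta> z + hp ?ys z) = (\<lambda>z. \<kappa> * (X n z - F z))"
        unfolding hp_def lin_comb_scale xs \<theta>_def by (simp add: fun_eq_iff hp_def algebra_simps)
      moreover have "H2norm (\<lambda>z. \<kappa> * (X n z - F z)) = 1 / nF * H2norm (\<lambda>z. X n z - F z)"
        using H2.nrm_scale[OF H2.diff_mem[OF XH F(1)], of "\<kappa>" n] nF by (simp add: norm_divide \<kappa>_def)
      ultimately show ?thesis
        using An[OF H2.scale_mem[OF H2.diff_mem[OF XH F(1)]], of "\<kappa>" n] by simp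
    qed
    then show "\<forall>\<^sub>F n in sequentially. norm (H2norm (\<lambda>z. g z * lin_comb zpow (map (\<lambda>(c, i). (\<kappa> * c, i)) (xs n)) z - zpow 0 z))
        \<le> 1 / nF * H2norm (\<lambda>z. X n z - F z)"
      using H2.nrm_nonneg[OF H2.diff_mem[OF gp(2) zpow_H2]] by simp
    show "(\<lambda>n. 1 / nF * H2norm (\<lambda>z. X n z - F z)) \<longlonglongrightarrow> 0"
      using tendsto_mult_left[OF X(2), of "1 / nF"] by simp
  qed
  show thesis by (rule that[OF HinfI[OF gh g1] g1 gu(2) cyc])
qed

section \<open>The de Branges-Rovnyak space\<close>

lemma z_mult_Hinf:
  assumes "u \<in> Hinf"
  shows "(\<lambda>z. z * u z) \<in> Hinf"
proof -
  have "(\<lambda>z. zpow 1 z * u z) = (\<lambda>z. z * u z)"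
    by (rule ext) (simp only: zpow_mult_hol_disc[OF Hinf_hol_disc[OF assms]] power_one_right)
  then show ?thesis using Hinf_mult[OF zpow_Hinf[of 1] assms] by simp
qed

text \<open>
  A Hilbert space with the de Branges-Rovnyak kernel of \<open>b\<close>, where \<open>\<bar>b\<bar> \<le> 1\<close> on the disc.
\<close>

locale dBR_space = function_hilbert_space H ip
  for H :: "(complex \<Rightarrow> complex) set"
    and ip :: "(complex \<Rightarrow> complex) \<Rightarrow> (complex \<Rightarrow> complex) \<Rightarrow> complex" +
  fixes b :: "complex \<Rightarrow> complex"
  assumes b_Hinf: "b \<in> Hinf" and b_le: "\<And>z. cmod z < 1 \<Longrightarrow> cmod (b z) \<le> 1"
    and kernel: "has_reproducing_kernel H ip (dBR_kernel b)"
begin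

abbreviation kb :: "complex \<Rightarrow> complex \<Rightarrow> complex" where "kb \<equiv> dBR_kernel b"

text \<open>
  The defect operator \<open>I - T S\<close>, with \<open>S = toep b\<close> and \<open>T\<close> multiplication by \<open>b\<close>. It maps the Szego
  kernels to the kernels of \<open>\<H>(b)\<close>.
\<close>

definition K :: "(complex \<Rightarrow> complex) \<Rightarrow> complex \<Rightarrow> complex" where
  "K u z = u z - b z * toep b u z"

lemma kb_mem: "cmod l < 1 \<Longrightarrow> kb l \<in> H"
  and ip_kb: "cmod l < 1 \<Longrightarrow> f \<in> H \<Longrightarrow> ip f (kb l) = f l"
  using kernel unfolding has_reproducing_kernel_def by auto

lemma K_H2: "u \<in> H2 \<Longrightarrow> K u \<in> H2"
  unfolding K_def[abs_def] by (intro H2.diff_mem Hinf_mult_H2 b_Hinf toep_H2)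

lemma K_lincomb: "u \<in> H2 \<Longrightarrow> v \<in> H2 \<Longrightarrow> K (\<lambda>z. c * u z + v z) = (\<lambda>z. c * K u z + K v z)"
  using toep_add[OF b_Hinf H2.scale_mem[of u c], of v] toep_scale[OF b_Hinf, of u c]
  by (simp add: K_def fun_eq_iff algebra_simps)

lemma K_szego: "cmod l < 1 \<Longrightarrow> K (szego l) = kb l"
proof
  fix z assume l: "cmod l < 1"
  show "K (szego l) z = kb l z"
  proof (cases "cmod z < 1")
    case True
    then show ?thesis
      by (simp add: K_def toep_szego[OF b_Hinf l] szego_eq[OF l True] dBR_kernel_def diff_divide_distrib)
  next
    case False
    have "szego l z = 0" "b z = 0"
      using hol_disc_zero[OF H2_hol_disc[OF szego_H2[OF l]]] hol_disc_zero[OF Hinf_hol_disc[OF b_Hinf]] False by auto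
    then show ?thesis using False by (simp add: K_def dBR_kernel_def)
  qed
qed

lemma H2ip_K:
  assumes u: "u \<in> H2" and v: "v \<in> H2"
  shows "H2ip (K u) v = H2ip u v - H2ip (toep b u) (toep b v)"
proof -
  let ?T = "toep b u"
  have T: "?T \<in> H2" "toep b v \<in> H2" by (intro toep_H2 b_Hinf u v)+
  have bT: "(\<lambda>z. b z * ?T z) \<in> H2" by (intro Hinf_mult_H2 b_Hinf T)
  have "H2ip (\<lambda>z. b z * ?T z) v = cnj (H2ip (toep b v) ?T)"
    using toep_adjoint[OF b_Hinf v T(1)] H2.ip_commute[OF v bT] by simp
  also have "\<dots> = H2ip ?T (toep b v)" using H2.ip_commute[OF T(2,1)] by simp
  finally show ?thesis
    using H2.ip_diff_left[OF u bT v] by (simp add: K_def[abs_def])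
qed

lemma H2ip_K_right:
  assumes u: "u \<in> H2" and v: "v \<in> H2"
  shows "H2ip u (K v) = H2ip (K u) v"
proof -
  have T: "toep b u \<in> H2" "toep b v \<in> H2" by (intro toep_H2 b_Hinf u v)+
  show ?thesis
    using H2.ip_commute[OF K_H2[OF v] u] H2ip_K[OF v u] H2ip_K[OF u v] H2.ip_commute[OF u v] H2.ip_commute[OF T] by simp
qed

lemma K_lin_comb_szego:
  assumes "xs \<in> lists (UNIV \<times> ball 0 1)"
  shows "lin_comb szego xs \<in> H2 \<and> lin_comb kb xs \<in> H \<and> K (lin_comb szego xs) = lin_comb kb xs \<and>
    (\<forall>f\<in>H. f \<in> H2 \<longrightarrow> ip f (lin_comb kb xs) = H2ip f (lin_comb szego xs))"
  using assms
proof (induction xs rule: list.induct)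
  case Nil
  have "toep b (\<lambda>z. 0) = (\<lambda>z. 0)"
    using toep_scale[OF b_Hinf H2.zero_mem, of 0] by simp
  moreover have "ip f (\<lambda>z. 0) = 0" if "f \<in> H" for f
    using ip_commute[OF zero_mem that] ip_zero_left[OF that] by simp
  moreover have "H2ip f (\<lambda>z. 0) = 0" if "f \<in> H2" for f
    using H2.ip_commute[OF H2.zero_mem that] H2.ip_zero_left[OF that] by simp
  ultimately show ?case by (simp add: lin_comb_Nil K_def fun_eq_iff H2.zero_mem zero_mem)
next
  case (Cons x xs)
  obtain c l where x: "x = (c, l)" by (cases x)
  have l: "cmod l < 1" and xs: "xs \<in> lists (UNIV \<times> ball 0 1)" using Cons.prems by (auto simp: x)
  note IH = Cons.IH[OF xs]
  have s: "szego l \<in> H2" by (rule szego_H2[OF l])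
  have "ip f (lin_comb kb (x # xs)) = H2ip f (lin_comb szego (x # xs))" if "f \<in> H" "f \<in> H2" for f
    using IH that kb_mem[OF l] s
    by (simp add: x lin_comb_Cons ip_add_right ip_scale_right scale_mem H2.ip_add_right H2.ip_scale_right
        H2.scale_mem ip_kb[OF l] H2ip_szego[OF l])
  then show ?case
    using IH s kb_mem[OF l] K_lincomb[OF s, of "lin_comb szego xs" c]
    by (auto simp: x lin_comb_Cons K_szego[OF l] intro!: H2.add_mem H2.scale_mem add_mem scale_mem)
qed

text \<open>
  For \<open>u\<close> in the span of the Szego kernels, \<open>K u\<close> has norm at most \<open>\<parallel>u\<parallel>\<close> in \<open>\<H>(b)\<close>. Hence
  \<open>u \<mapsto> \<langle>K u, f\<rangle>\<close> is a bounded functional on that span, and the vector of the Hardy space that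
  represents it has the same values as \<open>f\<close>.
\<close>

lemma mem_H2:
  assumes f: "f \<in> H"
  shows "f \<in> H2" "H2norm f \<le> nrm f"
proof -
  define G where "G = (\<lambda>xs. (lin_comb szego xs, ip (lin_comb kb xs) f)) ` lists (UNIV \<times> ball 0 1)"
  have bd: "cmod (ip (lin_comb kb xs) f) \<le> nrm f * H2norm (lin_comb szego xs)" if "xs \<in> lists (UNIV \<times> ball 0 1)" for xs
  proof -
    define u v where "u = lin_comb szego xs" and "v = lin_comb kb xs"
    have u: "u \<in> H2" and v: "v \<in> H" and Ku: "K u = v" and iv: "\<forall>f\<in>H. f \<in> H2 \<longrightarrow> ip f v = H2ip f u"
      using K_lin_comb_szego[OF that] by (auto simp: u_def v_def)
    have v2: "v \<in> H2" using K_H2[OF u] Ku by simp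
    have T: "toep b u \<in> H2" by (rule toep_H2[OF b_Hinf u])
    have "complex_of_real ((nrm v)\<^sup>2) = H2ip (K u) u" using iv v v2 ip_self[OF v] Ku by simp
    also have "\<dots> = of_real ((H2norm u)\<^sup>2 - (H2norm (toep b u))\<^sup>2)"
      unfolding H2ip_K[OF u u] by (simp add: H2.ip_self u T)
    finally have "(nrm v)\<^sup>2 = (H2norm u)\<^sup>2 - (H2norm (toep b u))\<^sup>2" by (simp only: of_real_eq_iff)
    then have "(nrm v)\<^sup>2 \<le> (H2norm u)\<^sup>2" by simp
    then have "nrm v \<le> H2norm u" using H2.nrm_nonneg[OF u] by (rule power2_le_imp_le)
    then have "nrm v * nrm f \<le> H2norm u * nrm f" using nrm_nonneg[OF f] by (rule mult_right_mono)
    then show ?thesis using Cauchy_Schwarz[OF v f] by (simp add: u_def v_def mult.commute)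
  qed
  obtain F X where F: "F \<in> H2" "\<And>v d. (v, d) \<in> G \<Longrightarrow> H2ip v F = d" "H2norm F \<le> nrm f \<or> F = (\<lambda>z. 0)"
    and X: "\<And>n :: nat. \<exists>c. (X n, c) \<in> G" "(\<lambda>n. H2norm (\<lambda>z. X n z - F z)) \<longlonglongrightarrow> 0"
  proof (rule H2.Riesz_relation[of G "nrm f"])
    show "G \<noteq> {}" by (auto simp: G_def)
    show "u \<in> H2" if "(u, c) \<in> G" for u c using that K_lin_comb_szego by (auto simp: G_def)
    show "cmod c \<le> nrm f * H2norm u" if "(u, c) \<in> G" for u c using that bd by (auto simp: G_def)
    show "(\<lambda>z. u z + a * v z, c + a * d) \<in> G" if uv: "(u, c) \<in> G" "(v, d) \<in> G" for u c v d a
    proof -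
      obtain xs ys where xs: "xs \<in> lists (UNIV \<times> ball 0 1)" "u = lin_comb szego xs" "c = ip (lin_comb kb xs) f"
        and ys: "ys \<in> lists (UNIV \<times> ball 0 1)" "v = lin_comb szego ys" "d = ip (lin_comb kb ys) f"
        using uv by (auto simp: G_def)
      let ?zs = "xs @ map (\<lambda>(c, i). (a * c, i)) ys"
      have zs: "?zs \<in> lists (UNIV \<times> ball 0 1)" using xs(1) ys(1) by (auto simp: in_lists_conv_set)
      have "(\<lambda>z. u z + a * v z) = lin_comb szego ?zs" by (simp add: xs ys lin_comb_append lin_comb_scale)
      moreover have "c + a * d = ip (lin_comb kb ?zs) f"
        using K_lin_comb_szego[OF xs(1)] K_lin_comb_szego[OF ys(1)] f
        by (simp add: xs ys lin_comb_append lin_comb_scale ip_add_left ip_scale_left scale_mem)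
      ultimately show ?thesis unfolding G_def using zs by (intro image_eqI[of _ _ ?zs]) simp_all
    qed
  qed (rule that)
  have "F = f"
  proof (rule hol_disc_eqI[OF H2_hol_disc[OF F(1)] in_hol_disc[OF f]])
    fix l :: complex assume l: "cmod l < 1"
    have "(szego l, ip (kb l) f) \<in> G"
      unfolding G_def using l by (intro image_eqI[of _ _ "[(1, l)]"]) (auto simp: lin_comb_Cons lin_comb_Nil)
    then have "H2ip (szego l) F = ip (kb l) f" by (rule F(2))
    then have "cnj (H2ip F (szego l)) = cnj (ip f (kb l))"
      using H2.ip_commute[OF F(1) szego_H2[OF l]] ip_commute[OF f kb_mem[OF l]] by simp
    then show "F l = f l" by (simp add: H2ip_szego[OF l F(1)] ip_kb[OF l f])
  qed
  then show "f \<in> H2" "H2norm f \<le> nrm f" using F(1,3) nrm_nonneg[OF f] by auto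
qed

lemma
  assumes u: "u \<in> H2"
  shows K_mem: "K u \<in> H" and ip_K: "f \<in> H \<Longrightarrow> ip f (K u) = H2ip f u"
proof -
  \<comment> \<open>\<open>f \<mapsto> \<langle>f, u\<rangle>\<close> is bounded on \<open>\<H>(b)\<close>; the kernels identify the representing vector as \<open>K u\<close>\<close>
  define G where "G = (\<lambda>f. (f, H2ip f u)) ` H"
  obtain F X where F: "F \<in> H" "\<And>v d. (v, d) \<in> G \<Longrightarrow> ip v F = d" "nrm F \<le> H2norm u \<or> F = (\<lambda>z. 0)"
    and X: "\<And>n :: nat. \<exists>c. (X n, c) \<in> G" "(\<lambda>n. nrm (\<lambda>z. X n z - F z)) \<longlonglongrightarrow> 0"
  proof (rule Riesz_relation[of G "H2norm u"])
    show "G \<noteq> {}" using zero_mem by (auto simp: G_def)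
    show "f \<in> H" if "(f, c) \<in> G" for f c using that by (auto simp: G_def)
    show "cmod c \<le> H2norm u * nrm f" if "(f, c) \<in> G" for f c
    proof -
      have f: "f \<in> H" "c = H2ip f u" using that by (auto simp: G_def)
      have "cmod c \<le> H2norm f * H2norm u" unfolding f(2) by (rule H2.Cauchy_Schwarz[OF mem_H2(1)[OF f(1)] u])
      also have "\<dots> \<le> nrm f * H2norm u" using mem_H2(2)[OF f(1)] H2.nrm_nonneg[OF u] by (rule mult_right_mono)
      finally show ?thesis by (simp add: mult.commute)
    qed
    show "(\<lambda>z. f z + a * g z, c + a * d) \<in> G" if fg: "(f, c) \<in> G" "(g, d) \<in> G" for f c g d a
    proof -
      have f: "f \<in> H" "c = H2ip f u" and g: "g \<in> H" "d = H2ip g u" using fg by (auto simp: G_def)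
      have "H2ip (\<lambda>z. f z + a * g z) u = c + a * d"
        using mem_H2(1)[OF f(1)] mem_H2(1)[OF g(1)] u by (simp add: f g H2.ip_add_left H2.ip_scale_left H2.scale_mem)
      then show ?thesis
        unfolding G_def by (intro image_eqI[of _ _ "\<lambda>z. f z + a * g z"] add_mem scale_mem f g) simp_all
    qed
  qed (rule that)
  have rep: "ip f F = H2ip f u" if "f \<in> H" for f using F(2) that by (auto simp: G_def)
  have FK: "F = K u"
  proof (rule hol_disc_eqI[OF in_hol_disc[OF F(1)] H2_hol_disc[OF K_H2[OF u]]])
    fix l :: complex assume l: "cmod l < 1"
    have s: "szego l \<in> H2" by (rule szego_H2[OF l])
    have "F l = cnj (ip (kb l) F)" using ip_kb[OF l F(1)] ip_commute[OF kb_mem[OF l] F(1)] by simp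
    also have "\<dots> = cnj (H2ip (K (szego l)) u)" by (simp add: rep kb_mem[OF l] K_szego[OF l])
    also have "\<dots> = H2ip (K u) (szego l)"
      using H2.ip_commute[OF K_H2[OF s] u] H2ip_K_right[OF u s] by simp
    also have "\<dots> = K u l" by (rule H2ip_szego[OF l K_H2[OF u]])
    finally show "F l = K u l" .
  qed
  show "K u \<in> H" using F(1) FK by simp
  show "ip f (K u) = H2ip f u" if "f \<in> H" using rep[OF that] FK by simp
qed

lemma nrm_K_sq:
  assumes u: "u \<in> H2"
  shows "(nrm (K u))\<^sup>2 = (H2norm u)\<^sup>2 - (H2norm (toep b u))\<^sup>2"
proof -
  have "complex_of_real ((nrm (K u))\<^sup>2) = H2ip (K u) u"
    using ip_self[OF K_mem[OF u]] ip_K[OF u K_mem[OF u]] by simp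
  also have "\<dots> = of_real ((H2norm u)\<^sup>2 - (H2norm (toep b u))\<^sup>2)"
    unfolding H2ip_K[OF u u] by (simp add: H2.ip_self u toep_H2 b_Hinf)
  finally show ?thesis by (simp only: of_real_eq_iff)
qed

text \<open>
  The bound makes \<open>K u \<mapsto> \<langle>u, f\<rangle>\<close> a bounded functional on the range of \<open>K\<close>. Evaluating at the
  kernels shows that its representing vector is \<open>f\<close>.
\<close>

lemma membership_criterion:
  assumes f: "f \<in> H2" and C: "0 \<le> C" and bd: "\<And>u. u \<in> H2 \<Longrightarrow> cmod (H2ip f u) \<le> C * nrm (K u)"
  shows "f \<in> H" "nrm f \<le> C"
proof -
  define G where "G = (\<lambda>u. (K u, H2ip u f)) ` H2"
  have sym: "H2ip u f = cnj (H2ip f u)" if "u \<in> H2" for u using H2.ip_commute[OF f that] .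
  obtain F X where F: "F \<in> H" "\<And>v d. (v, d) \<in> G \<Longrightarrow> ip v F = d" "nrm F \<le> C \<or> F = (\<lambda>z. 0)"
    and X: "\<And>n :: nat. \<exists>c. (X n, c) \<in> G" "(\<lambda>n. nrm (\<lambda>z. X n z - F z)) \<longlonglongrightarrow> 0"
  proof (rule Riesz_relation[of G C])
    show "G \<noteq> {}" using H2.zero_mem by (auto simp: G_def)
    show "v \<in> H" if "(v, c) \<in> G" for v c using that K_mem by (auto simp: G_def)
    show "cmod c \<le> C * nrm v" if "(v, c) \<in> G" for v c using that bd sym by (auto simp: G_def)
    show "(\<lambda>z. v z + a * w z, c + a * d) \<in> G" if vw: "(v, c) \<in> G" "(w, d) \<in> G" for v c w d a
    proof -
      obtain u1 u2 where u1: "u1 \<in> H2" "v = K u1" "c = H2ip u1 f" and u2: "u2 \<in> H2" "w = K u2" "d = H2ip u2 f"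
        using vw by (auto simp: G_def)
      have "K (\<lambda>z. a * u2 z + u1 z) = (\<lambda>z. v z + a * w z)"
        using K_lincomb[OF u2(1) u1(1), of a] by (simp add: u1 u2 add.commute)
      moreover have "H2ip (\<lambda>z. a * u2 z + u1 z) f = c + a * d"
        using f u1(1) u2(1) by (simp add: u1(3) u2(3) H2.ip_add_left H2.ip_scale_left H2.scale_mem)
      ultimately show ?thesis
        unfolding G_def by (intro image_eqI[of _ _ "\<lambda>z. a * u2 z + u1 z"] H2.add_mem H2.scale_mem u1 u2) simp_all
    qed
  qed (rule that)
  have "F = f"
  proof (rule hol_disc_eqI[OF in_hol_disc[OF F(1)] H2_hol_disc[OF f]])
    fix l :: complex assume l: "cmod l < 1"
    have "(kb l, H2ip (szego l) f) \<in> G"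
      unfolding G_def using szego_H2[OF l] K_szego[OF l] by (intro image_eqI[of _ _ "szego l"]) auto
    then have "ip (kb l) F = H2ip (szego l) f" by (rule F(2))
    then have "cnj (ip F (kb l)) = cnj (H2ip f (szego l))"
      using ip_commute[OF F(1) kb_mem[OF l]] H2.ip_commute[OF f szego_H2[OF l]] by simp
    then show "F l = f l" by (simp add: ip_kb[OF l F(1)] H2ip_szego[OF l f])
  qed
  then show "f \<in> H" "nrm f \<le> C" using F(1,3) C by auto
qed

lemma
  assumes p: "\<phi> \<in> Hinf" and c: "\<And>z. cmod z < 1 \<Longrightarrow> cmod (\<phi> z) \<le> c" and f: "f \<in> H"
  shows toep_mem: "toep \<phi> f \<in> H" and toep_nrm_le: "nrm (toep \<phi> f) \<le> c * nrm f"
proof -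
  have f2: "f \<in> H2" by (rule mem_H2(1)[OF f])
  have c0: "0 \<le> c" using order_trans[OF norm_ge_zero c[of 0]] by simp
  have bd: "cmod (H2ip (toep \<phi> f) u) \<le> (c * nrm f) * nrm (K u)" if u: "u \<in> H2" for u
  proof -
    have pu: "(\<lambda>z. \<phi> z * u z) \<in> H2" by (rule Hinf_mult_H2[OF p u])
    have "(nrm (K (\<lambda>z. \<phi> z * u z)))\<^sup>2 \<le> (c * nrm (K u))\<^sup>2"
      using defect_mult_le[OF b_Hinf b_le p c u] by (simp add: nrm_K_sq u pu power_mult_distrib)
    then have le: "nrm (K (\<lambda>z. \<phi> z * u z)) \<le> c * nrm (K u)"
      by (rule power2_le_imp_le) (simp add: c0 nrm_nonneg K_mem u)
    have "cmod (H2ip (toep \<phi> f) u) = cmod (ip f (K (\<lambda>z. \<phi> z * u z)))"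
      using toep_adjoint[OF p f2 u] ip_K[OF pu f] by simp
    also have "\<dots> \<le> nrm f * nrm (K (\<lambda>z. \<phi> z * u z))" by (rule Cauchy_Schwarz[OF f K_mem[OF pu]])
    also have "\<dots> \<le> nrm f * (c * nrm (K u))" by (rule mult_left_mono[OF le nrm_nonneg[OF f]])
    finally show ?thesis by (simp add: mult_ac)
  qed
  have "0 \<le> c * nrm f" using c0 nrm_nonneg[OF f] by simp
  from membership_criterion[OF toep_H2[OF p f2] this bd]
  show "toep \<phi> f \<in> H" "nrm (toep \<phi> f) \<le> c * nrm f" by auto
qed

lemma toeplitz_eq: "\<phi> \<in> Hinf \<Longrightarrow> f \<in> H \<Longrightarrow> toeplitz_cnj \<phi> f = toep \<phi> f"
  by (rule toeplitz_cnj_eq_toep[OF _ mem_H2(1)])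

lemma toeplitz_mem: "\<phi> \<in> Hinf \<Longrightarrow> f \<in> H \<Longrightarrow> toeplitz_cnj \<phi> f \<in> H"
  using Hinf_bound[of \<phi>] toep_mem[of \<phi> _ f] toeplitz_eq[of \<phi> f] by metis

lemma toeplitz_bounded:
  assumes p: "\<phi> \<in> Hinf"
  shows "bounded_operator_on H nrm (toeplitz_cnj \<phi>)"
proof -
  obtain c where c: "0 < c" "\<And>z. cmod z < 1 \<Longrightarrow> cmod (\<phi> z) \<le> c" using Hinf_bound[OF p] by blast
  show ?thesis
    unfolding bounded_operator_on_def
  proof (intro conjI ballI allI exI[of _ c])
    show "toeplitz_cnj \<phi> f \<in> H" if "f \<in> H" for f using toep_mem[OF p c(2) that] toeplitz_eq[OF p that] by simp
    show "toeplitz_cnj \<phi> (\<lambda>z. f z + g z) = (\<lambda>z. toeplitz_cnj \<phi> f z + toeplitz_cnj \<phi> g z)" if "f \<in> H" "g \<in> H" for f g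
      using that by (simp add: toeplitz_eq p add_mem toep_add mem_H2)
    show "toeplitz_cnj \<phi> (\<lambda>z. a * f z) = (\<lambda>z. a * toeplitz_cnj \<phi> f z)" if "f \<in> H" for f a
      using that by (simp add: toeplitz_eq p scale_mem toep_scale mem_H2)
    show "nrm (toeplitz_cnj \<phi> f) \<le> c * nrm f" if "f \<in> H" for f
      using toep_nrm_le[OF p c(2) that] toeplitz_eq[OF p that] by simp
  qed
qed

end

subsection \<open>The non-extreme case\<close>

text \<open>
  A cyclic multiplier \<open>a\<close> that is dominated by the defect of \<open>b\<close>; such \<open>a\<close> exist if \<open>b\<close> is not an extreme
  point. The lists \<open>ys\<close> are the coefficients of polynomials \<open>p\<close> for which \<open>a p\<close> tends to \<open>1\<close>.
\<close>

locale dBR_outer = dBR_space H ip b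
  for H ip b +
  fixes a :: "complex \<Rightarrow> complex" and ys :: "nat \<Rightarrow> (complex \<times> nat) list"
  assumes a_Hinf: "a \<in> Hinf"
    and a_le: "\<And>u. u \<in> H2 \<Longrightarrow> (H2norm (\<lambda>z. a z * u z))\<^sup>2 + (H2norm (toep b u))\<^sup>2 \<le> (H2norm u)\<^sup>2"
    and a_cyclic: "(\<lambda>n. H2norm (\<lambda>z. a z * lin_comb zpow (ys n) z - zpow 0 z)) \<longlonglongrightarrow> 0"
begin

lemma a_norm_le: "u \<in> H2 \<Longrightarrow> H2norm (\<lambda>z. a z * u z) \<le> nrm (K u)"
  by (rule power2_le_imp_le) (use a_le[of u] in \<open>simp_all add: nrm_K_sq nrm_nonneg K_mem\<close>)

lemma
  assumes g: "g \<in> H2"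
  shows toep_a_mem: "toep a g \<in> H" and toep_a_nrm_le: "nrm (toep a g) \<le> H2norm g"
proof -
  have bd: "cmod (H2ip (toep a g) u) \<le> H2norm g * nrm (K u)" if u: "u \<in> H2" for u
  proof -
    have au: "(\<lambda>z. a z * u z) \<in> H2" by (rule Hinf_mult_H2[OF a_Hinf u])
    have "cmod (H2ip (toep a g) u) = cmod (H2ip g (\<lambda>z. a z * u z))" using toep_adjoint[OF a_Hinf g u] by simp
    also have "\<dots> \<le> H2norm g * H2norm (\<lambda>z. a z * u z)" by (rule H2.Cauchy_Schwarz[OF g au])
    also have "\<dots> \<le> H2norm g * nrm (K u)" by (rule mult_left_mono[OF a_norm_le[OF u] H2.nrm_nonneg[OF g]])
    finally show ?thesis .
  qed
  from membership_criterion[OF toep_H2[OF a_Hinf g] H2.nrm_nonneg[OF g] bd]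
  show "toep a g \<in> H" "nrm (toep a g) \<le> H2norm g" by auto
qed

lemma a_nonzero: "\<exists>z. cmod z < 1 \<and> a z \<noteq> 0"
proof (rule ccontr)
  assume "\<not> (\<exists>z. cmod z < 1 \<and> a z \<noteq> 0)"
  then have "a = (\<lambda>z. 0)"
    by (intro hol_disc_eqI[OF Hinf_hol_disc[OF a_Hinf] zero_hol_disc]) auto
  then have "(\<lambda>n::nat. H2norm (\<lambda>z. - zpow 0 z)) \<longlonglongrightarrow> 0" using a_cyclic by simp
  then have "H2norm (\<lambda>z. (-1) * zpow 0 z) = 0" by (simp add: LIMSEQ_const_iff)
  then have "(\<lambda>z. (-1) * zpow 0 z) = (\<lambda>z. 0)" by (intro H2.nrm_eq_0 H2.scale_mem zpow_H2)
  then have "(-1) * zpow 0 0 = 0" by (rule fun_cong)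
  then show False by (simp add: zpow_def)
qed

text \<open>
  On the circle, \<open>cnj b u\<close> splits into the boundary function of \<open>toep b u\<close> and an anti-analytic part,
  whose Fourier coefficients are, up to conjugation, the Taylor coefficients of \<open>toep (z u) b\<close>. Multiplying \<open>u\<close> by
  \<open>z\<^sup>J\<close> moves \<open>J\<close> of them into the analytic part without changing the norm of \<open>u\<close>, and there they are
  controlled by the contractivity of \<open>toep b\<close>.
\<close>

lemma anti_analytic_norm_le:
  assumes u: "u \<in> H2" "u \<in> Hinf"
  shows "H2norm (toep (\<lambda>z. z * u z) b) \<le> nrm (K u)"
proof -
  have zu: "(\<lambda>z. z * u z) \<in> Hinf"
    by (rule z_mult_Hinf[OF u(2)])
  have bH: "b \<in> H2" by (rule Hinf_H2[OF b_Hinf])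
  have bsh: "(\<lambda>z. b z * zpow j z) \<in> H2" for j by (rule Hinf_mult_H2[OF b_Hinf zpow_H2])
  have bz: "(\<lambda>z. b z * zpow j z) = (\<lambda>z. z ^ j * b z)" for j
    using zpow_mult_hol_disc[OF Hinf_hol_disc[OF b_Hinf], of j] by (simp only: mult.commute[of "b _"])
  have Wc: "coef (toep (\<lambda>z. z * u z) b) j = cnj (H2ip (\<lambda>z. z ^ Suc j * u z) b)" for j
  proof -
    have "coef (toep (\<lambda>z. z * u z) b) j = H2ip b (\<lambda>z. z * u z * zpow j z)" by (rule coef_toep[OF zu bH])
    also have "(\<lambda>z. z * u z * zpow j z) = (\<lambda>z. z ^ Suc j * u z)"
      using zpow_mult_hol_disc[OF H2_hol_disc[OF u(1)], of j] by (auto simp: fun_eq_iff mult_ac)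
    finally show ?thesis using H2.ip_commute[OF shift_H2[OF u(1), of "Suc j"] bH] by simp
  qed
  have W: "toep (\<lambda>z. z * u z) b \<in> H2" by (rule toep_H2[OF zu bH])
  have T: "toep b u \<in> H2" by (rule toep_H2[OF b_Hinf u(1)])
  have le: "(\<Sum>j<J. (cmod (coef (toep (\<lambda>z. z * u z) b) j))\<^sup>2) + (H2norm (toep b u))\<^sup>2 \<le> (H2norm u)\<^sup>2" for J
  proof -
    let ?v = "\<lambda>z. z ^ J * u z"
    have v: "?v \<in> H2" by (rule shift_H2[OF u(1)])
    have Tv: "toep b ?v \<in> H2" by (rule toep_H2[OF b_Hinf v])
    have c1: "coef (toep b ?v) k = cnj (coef (toep (\<lambda>z. z * u z) b) (J - Suc k))" if "k < J" for k
    proof -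
      have "coef (toep b ?v) k = H2ip (\<lambda>z. z ^ k * (z ^ (J - k) * u z)) (\<lambda>z. z ^ k * b z)"
        unfolding coef_toep[OF b_Hinf v] bz using that by (simp add: mult.assoc[symmetric] power_add[symmetric])
      also have "\<dots> = H2ip (\<lambda>z. z ^ (J - k) * u z) b" by (rule H2ip_shift[OF shift_H2[OF u(1)] bH])
      finally show ?thesis unfolding Wc using that by (simp add: Suc_diff_Suc)
    qed
    have c2: "coef (toep b ?v) (J + k) = coef (toep b u) k" for k
    proof -
      have "coef (toep b ?v) (J + k) = H2ip ?v (\<lambda>z. z ^ J * (z ^ k * b z))"
        unfolding coef_toep[OF b_Hinf v] bz by (simp add: power_add mult.assoc)
      also have "\<dots> = H2ip u (\<lambda>z. z ^ k * b z)" by (rule H2ip_shift[OF u(1) shift_H2[OF bH]])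
      finally show ?thesis unfolding coef_toep[OF b_Hinf u(1)] bz .
    qed
    have "(H2norm (toep b ?v))\<^sup>2 = (\<Sum>k<J. (cmod (coef (toep b ?v) k))\<^sup>2) + (\<Sum>k. (cmod (coef (toep b ?v) (k + J)))\<^sup>2)"
      unfolding H2norm_sq[OF Tv] using suminf_split_initial_segment[OF H2_summable[OF Tv], of J] by simp
    also have "(\<Sum>k. (cmod (coef (toep b ?v) (k + J)))\<^sup>2) = (H2norm (toep b u))\<^sup>2"
      unfolding H2norm_sq[OF T] using c2 by (simp add: add.commute)
    also have "(\<Sum>k<J. (cmod (coef (toep b ?v) k))\<^sup>2) = (\<Sum>k<J. (cmod (coef (toep (\<lambda>z. z * u z) b) (J - Suc k)))\<^sup>2)"
      by (intro sum.cong refl) (simp add: c1)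
    also have "\<dots> = (\<Sum>k<J. (cmod (coef (toep (\<lambda>z. z * u z) b) k))\<^sup>2)"
      by (rule sum.nat_diff_reindex)
    finally have "(H2norm (toep b ?v))\<^sup>2 = (\<Sum>k<J. (cmod (coef (toep (\<lambda>z. z * u z) b) k))\<^sup>2) + (H2norm (toep b u))\<^sup>2" .
    moreover have "H2norm (toep b ?v) \<le> H2norm u"
    proof -
      have "H2norm (toep b ?v) \<le> H2norm (\<lambda>z. b z * ?v z)" by (rule toep_norm_le[OF b_Hinf v])
      also have "\<dots> \<le> 1 * H2norm ?v" by (rule mult_H2norm_le[OF Hinf_hol_disc[OF b_Hinf] b_le v])
      also have "H2norm ?v = H2norm u" using H2ip_shift[OF u(1) u(1), of J] by (simp add: ip_norm_def)
      finally show ?thesis by simp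
    qed
    ultimately show ?thesis using power_mono[OF _ H2.nrm_nonneg[OF Tv], of "H2norm u" 2] by simp
  qed
  have "(\<Sum>j<J. (cmod (coef (toep (\<lambda>z. z * u z) b) j))\<^sup>2) \<le> (nrm (K u))\<^sup>2" for J
    using le[of J] by (simp add: nrm_K_sq u)
  then show ?thesis
    by (rule H2_from_partial_sums(2)[OF H2_hol_disc[OF W] _ nrm_nonneg[OF K_mem[OF u(1)]]])
qed

text \<open>
  The range of \<open>toep a\<close> is dense in \<open>\<H>(b)\<close>. Approximate \<open>f\<close> by \<open>K (u n)\<close> with \<open>u n\<close> in the span of the
  Szego kernels. Orthogonality says that \<open>a u n\<close> tends weakly to \<open>0\<close>. Let \<open>W n\<close> be the (reflected)
  anti-analytic part of \<open>cnj b (u n)\<close>. The inner products of \<open>W n\<close> with \<open>z\<^sup>k a\<close> are inner products of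
  \<open>a u n\<close> with fixed vectors, so cyclicity of \<open>a\<close> and boundedness give \<open>W n \<rightarrow> 0\<close> weakly. The function
  \<open>a toep b (u n)\<close> differs from the analytic part of \<open>cnj b a (u n)\<close> only by a term that depends on
  \<open>W n\<close>, so its coefficients tend to \<open>0\<close>, and so do those of \<open>a K (u n)\<close>. In the limit \<open>a f = 0\<close>.
\<close>

lemma toep_a_total:
  assumes f: "f \<in> H" and orth: "\<And>g. g \<in> H2 \<Longrightarrow> ip (toep a g) f = 0"
  shows "f = (\<lambda>z. 0)"
proof -
  have f2: "f \<in> H2" by (rule mem_H2(1)[OF f])
  have bH: "b \<in> H2" by (rule Hinf_H2[OF b_Hinf])
  have aH: "a \<in> H2" by (rule Hinf_H2[OF a_Hinf])
  have ah: "a \<in> hol_disc" by (rule Hinf_hol_disc[OF a_Hinf])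
  have bh: "b \<in> hol_disc" by (rule Hinf_hol_disc[OF b_Hinf])
  have "\<exists>xs\<in>lists (UNIV \<times> ball 0 1). nrm (\<lambda>z. lin_comb kb xs z - f z) < 1 / real (Suc n)" for n
  proof (rule lin_comb_dense_if_total)
    show "kb l \<in> H" if "l \<in> ball 0 1" for l using kb_mem that by simp
    show "h = (\<lambda>z. 0)" if h: "h \<in> H" "\<And>l. l \<in> ball 0 1 \<Longrightarrow> ip h (kb l) = 0" for h
      by (rule hol_disc_eqI[OF in_hol_disc[OF h(1)] zero_hol_disc]) (use h ip_kb in auto)
  qed (use f in auto)
  then obtain xs where xs: "\<And>n. xs n \<in> lists (UNIV \<times> ball 0 1)"
    "\<And>n. nrm (\<lambda>z. lin_comb kb (xs n) z - f z) < 1 / real (Suc n)" by metis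
  define u where "u n = lin_comb szego (xs n)" for n
  have uH: "u n \<in> H2" and Ku: "K (u n) = lin_comb kb (xs n)" for n
    using K_lin_comb_szego[OF xs(1)[of n]] by (auto simp: u_def)
  have uInf: "u n \<in> Hinf" for n
  proof -
    have "lin_comb szego ws \<in> Hinf" if "ws \<in> lists (UNIV \<times> ball 0 1)" for ws
      using that
    proof (induction ws rule: list.induct)
      case Nil
      show ?case unfolding lin_comb_Nil by (rule HinfI[OF zero_hol_disc, of 0]) simp
    next
      case (Cons x ws)
      obtain c l where x: "x = (c, l)" by (cases x)
      have l: "cmod l < 1" and ws: "ws \<in> lists (UNIV \<times> ball 0 1)" using Cons.prems by (auto simp: x)
      obtain A where A: "0 < A" "\<And>z. cmod z < 1 \<Longrightarrow> cmod (szego l z) \<le> A" using Hinf_bound[OF szego_Hinf[OF l]] by blast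
      obtain B where B: "0 < B" "\<And>z. cmod z < 1 \<Longrightarrow> cmod (lin_comb szego ws z) \<le> B"
        using Hinf_bound[OF Cons.IH[OF ws]] by blast
      show ?case unfolding x lin_comb_Cons
      proof (rule HinfI)
        show "(\<lambda>z. c * szego l z + lin_comb szego ws z) \<in> hol_disc"
          by (intro add_hol_disc scale_hol_disc Hinf_hol_disc szego_Hinf[OF l] Cons.IH[OF ws])
        show "cmod (c * szego l z + lin_comb szego ws z) \<le> cmod c * A + B" if "cmod z < 1" for z
          by (rule order_trans[OF norm_triangle_ineq add_mono[OF _ B(2)[OF that]]])
             (simp add: norm_mult mult_left_mono A(2)[OF that])
      qed
    qed
    then show ?thesis unfolding u_def using xs(1) by blast
  qed
  have KuH: "K (u n) \<in> H" for n by (rule K_mem[OF uH])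
  have lim: "(\<lambda>n. nrm (\<lambda>z. K (u n) z - f z)) \<longlonglongrightarrow> 0"
  proof (rule Lim_null_comparison)
    show "\<forall>\<^sub>F n in sequentially. norm (nrm (\<lambda>z. K (u n) z - f z)) \<le> 1 / real (Suc n)"
      using xs(2) nrm_nonneg[OF diff_mem[OF KuH f]] by (simp add: Ku less_imp_le)
    show "(\<lambda>n. 1 / real (Suc n)) \<longlonglongrightarrow> 0"
      using LIMSEQ_inverse_real_of_nat by (simp add: inverse_eq_divide)
  qed
  define M where "M = nrm f + 1"
  have KuM: "nrm (K (u n)) \<le> M" for n
  proof -
    have "1 / real (Suc n) \<le> 1" by simp
    then show ?thesis
      using nrm_le_add_diff[OF KuH f, of n] xs(2)[of n] unfolding Ku M_def by linarith
  qed
  have auH: "(\<lambda>z. a z * u n z) \<in> H2" for n by (rule Hinf_mult_H2[OF a_Hinf uH])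
  have weak: "(\<lambda>n. H2ip g (\<lambda>z. a z * u n z)) \<longlonglongrightarrow> 0" if g: "g \<in> H2" for g
  proof -
    have "H2ip g (\<lambda>z. a z * u n z) = ip (toep a g) (K (u n))" for n
      using toep_adjoint[OF a_Hinf g uH] ip_K[OF uH toep_a_mem[OF g]] by simp
    moreover have "(\<lambda>n. ip (toep a g) (K (u n))) \<longlonglongrightarrow> ip (toep a g) f"
      by (rule tendsto_ip_right[OF KuH f toep_a_mem[OF g] lim])
    ultimately show ?thesis by (simp add: orth g)
  qed
  have weak': "(\<lambda>n. H2ip (\<lambda>z. a z * u n z) g) \<longlonglongrightarrow> 0" if g: "g \<in> H2" for g
    using tendsto_cnj[OF weak[OF g]] H2.ip_commute[OF g auH] by simp
  define W where "W n = toep (\<lambda>z. z * u n z) b" for n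
  have zu: "(\<lambda>z. z * u n z) \<in> Hinf" for n
    by (rule z_mult_Hinf[OF uInf])
  have WH: "W n \<in> H2" for n unfolding W_def by (rule toep_H2[OF zu bH])
  have WM: "H2norm (W n) \<le> M" for n
    unfolding W_def using anti_analytic_norm_le[OF uH uInf, of n] KuM[of n] by linarith
  have M0: "0 \<le> M" using nrm_nonneg[OF f] by (simp add: M_def)
  have Wip: "H2ip (W n) g = H2ip b (\<lambda>z. z * u n z * g z)" if "g \<in> H2" for n g
    unfolding W_def by (rule toep_adjoint[OF zu bH that])
  have Wa: "(\<lambda>n. H2ip (W n) (\<lambda>z. z ^ k * a z)) \<longlonglongrightarrow> 0" for k
  proof -
    have "H2ip (W n) (\<lambda>z. z ^ k * a z) = H2ip (toep (zpow (Suc k)) b) (\<lambda>z. a z * u n z)" for n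
    proof -
      have "H2ip (W n) (\<lambda>z. z ^ k * a z) = H2ip b (\<lambda>z. z * u n z * (z ^ k * a z))" by (rule Wip[OF shift_H2[OF aH]])
      also have "(\<lambda>z. z * u n z * (z ^ k * a z)) = (\<lambda>z. z ^ Suc k * (a z * u n z))" by (simp add: fun_eq_iff mult_ac)
      also have "\<dots> = (\<lambda>z. zpow (Suc k) z * (a z * u n z))"
        by (simp only: zpow_mult_hol_disc[OF H2_hol_disc[OF auH]])
      also have "H2ip b \<dots> = H2ip (toep (zpow (Suc k)) b) (\<lambda>z. a z * u n z)"
        by (rule toep_adjoint[OF zpow_Hinf bH auH, symmetric])
      finally show ?thesis .
    qed
    then show ?thesis using weak[OF toep_H2[OF zpow_Hinf bH], of "Suc k"] by simp
  qed
  have Wpoly: "(\<lambda>n. H2ip (W n) (\<lambda>z. a z * lin_comb zpow ws z)) \<longlonglongrightarrow> 0" for ws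
  proof (induction ws)
    case Nil
    have "H2ip (W n) (\<lambda>z. 0) = 0" for n
      using H2.ip_commute[OF H2.zero_mem WH[of n]] H2.ip_zero_left[OF WH[of n]] by simp
    then show ?case by (simp add: lin_comb_Nil)
  next
    case (Cons w ws)
    obtain c i where w: "w = (c, i)" by (cases w)
    have e: "(\<lambda>z. a z * lin_comb zpow (w # ws) z) = (\<lambda>z. c * (z ^ i * a z) + a z * lin_comb zpow ws z)"
      using zpow_mult_hol_disc[OF ah, of i] by (auto simp: w lin_comb_Cons fun_eq_iff algebra_simps)
    have "H2ip (W n) (\<lambda>z. a z * lin_comb zpow (w # ws) z)
        = cnj c * H2ip (W n) (\<lambda>z. z ^ i * a z) + H2ip (W n) (\<lambda>z. a z * lin_comb zpow ws z)" for n
      unfolding e using WH aH Hinf_mult_H2[OF a_Hinf polynomial_H2, of ws]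
      by (simp add: H2.ip_add_right H2.ip_scale_right H2.scale_mem shift_H2)
    then show ?case using tendsto_add[OF tendsto_mult_left[OF Wa, of "cnj c" i] Cons] by simp
  qed
  have Wclosed: "(\<lambda>n. H2ip (W n) g) \<longlonglongrightarrow> 0"
    if g: "g \<in> H2" and ap: "\<And>e. e > 0 \<Longrightarrow> \<exists>h\<in>H2. H2norm (\<lambda>z. h z - g z) < e \<and> (\<lambda>n. H2ip (W n) h) \<longlonglongrightarrow> 0" for g
  proof (rule LIMSEQ_I)
    fix r :: real assume r: "0 < r"
    have M1: "M + 1 \<noteq> 0" using M0 by simp
    define e where "e = (r / 2) / (M + 1)"
    have e: "0 < e" using r M0 by (simp add: e_def)
    obtain h where h: "h \<in> H2" "H2norm (\<lambda>z. h z - g z) < e" "(\<lambda>n. H2ip (W n) h) \<longlonglongrightarrow> 0" using ap[OF e] by blast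
    have r2: "0 < r / 2" using r by simp
    obtain n0 where n0: "\<And>n. n \<ge> n0 \<Longrightarrow> norm (H2ip (W n) h - 0) < r / 2" using LIMSEQ_D[OF h(3) r2] by blast
    have "norm (H2ip (W n) g - 0) < r" if "n \<ge> n0" for n
    proof -
      have "H2ip (W n) g = H2ip (W n) h - H2ip (W n) (\<lambda>z. h z - g z)"
        using H2.ip_diff_right[OF h(1) g WH[of n]] by simp
      then have "cmod (H2ip (W n) g) \<le> cmod (H2ip (W n) h) + cmod (H2ip (W n) (\<lambda>z. h z - g z))"
        by (simp only: norm_triangle_ineq4)
      also have "cmod (H2ip (W n) (\<lambda>z. h z - g z)) \<le> H2norm (W n) * H2norm (\<lambda>z. h z - g z)"
        by (rule H2.Cauchy_Schwarz[OF WH H2.diff_mem[OF h(1) g]])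
      also have "\<dots> \<le> (M + 1) * e"
        using WM[of n] h(2) M0 H2.nrm_nonneg[OF H2.diff_mem[OF h(1) g]] by (intro mult_mono) auto
      also have "\<dots> = r / 2"
        unfolding e_def times_divide_eq_right[of "M + 1" "r / 2" "M + 1"]
        by (rule nonzero_mult_div_cancel_left[OF M1])
      finally show ?thesis using n0[OF that] by simp
    qed
    then show "\<exists>no. \<forall>n\<ge>no. norm (H2ip (W n) g - 0) < r" by blast
  qed
  have Wzpow: "(\<lambda>n. H2ip (W n) (zpow k)) \<longlonglongrightarrow> 0" for k
  proof (rule Wclosed[OF zpow_H2])
    fix e :: real assume e: "e > 0"
    have t: "(\<lambda>n. H2norm (\<lambda>z. z ^ k * (a z * lin_comb zpow (ys n) z) - z ^ k * zpow 0 z)) \<longlonglongrightarrow> 0"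
      by (rule shift_tendsto[OF Hinf_mult_H2[OF a_Hinf polynomial_H2] zpow_H2 a_cyclic])
    obtain n where n: "H2norm (\<lambda>z. z ^ k * (a z * lin_comb zpow (ys n) z) - z ^ k * zpow 0 z) < e"
      using order_tendstoD(2)[OF t e] by (auto simp: eventually_sequentially)
    let ?h = "\<lambda>z. a z * lin_comb zpow (map (\<lambda>(c, i). (c, i + k)) (ys n)) z"
    have h: "?h = (\<lambda>z. z ^ k * (a z * lin_comb zpow (ys n) z))"
      unfolding shift_polynomial[symmetric] by (simp add: fun_eq_iff mult_ac)
    have zk: "z ^ k * zpow 0 z = zpow k z" for z by (simp add: zpow_def)
    have "H2norm (\<lambda>z. ?h z - zpow k z) < e" using n unfolding zk by (simp only: fun_cong[OF h])
    moreover have "?h \<in> H2" by (rule Hinf_mult_H2[OF a_Hinf polynomial_H2])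
    ultimately show "\<exists>h\<in>H2. H2norm (\<lambda>z. h z - zpow k z) < e \<and> (\<lambda>n. H2ip (W n) h) \<longlonglongrightarrow> 0"
      using Wpoly[of "map (\<lambda>(c, i). (c, i + k)) (ys n)"] by (intro bexI[of _ ?h] conjI)
  qed
  have Wtaylor: "(\<lambda>n. H2ip (W n) (taylor g J)) \<longlonglongrightarrow> 0" for g J
  proof (induction J)
    case 0
    have "H2ip (W n) (\<lambda>z. 0) = 0" for n
      using H2.ip_commute[OF H2.zero_mem WH[of n]] H2.ip_zero_left[OF WH[of n]] by simp
    then show ?case by (simp add: taylor_0)
  next
    case (Suc J)
    have "H2ip (W n) (taylor g (Suc J)) = H2ip (W n) (taylor g J) + cnj (coef g J) * H2ip (W n) (zpow J)" for n
      using WH by (simp add: taylor_Suc H2.ip_add_right H2.ip_scale_right H2.scale_mem taylor_H2 zpow_H2)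
    then show ?case using tendsto_add[OF Suc tendsto_mult_left[OF Wzpow, of "cnj (coef g J)" J]] by simp
  qed
  have Wweak: "(\<lambda>n. H2ip (W n) g) \<longlonglongrightarrow> 0" if g: "g \<in> H2" for g
  proof (rule Wclosed[OF g])
    fix e :: real assume e: "e > 0"
    obtain J where "H2norm (\<lambda>z. taylor g J z - g z) < e"
      using order_tendstoD(2)[OF taylor_tendsto[OF g] e] by (auto simp: eventually_sequentially)
    then show "\<exists>h\<in>H2. H2norm (\<lambda>z. h z - g z) < e \<and> (\<lambda>n. H2ip (W n) h) \<longlonglongrightarrow> 0"
      using taylor_H2 Wtaylor by blast
  qed
  have TH: "toep b (u n) \<in> H2" for n by (rule toep_H2[OF b_Hinf uH])
  have aT: "(\<lambda>n. coef (\<lambda>z. a z * toep b (u n) z) k) \<longlonglongrightarrow> 0" for k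
  proof -
    \<comment> \<open>split \<open>a\<close> at degree \<open>k\<close>: the polynomial acts on the analytic part of \<open>cnj b (u n)\<close>, the tail on \<open>W n\<close>\<close>
    define a' where "a' = of_coef (\<lambda>j. coef a (j + Suc k))"
    have sa': "summable (\<lambda>j. (cmod (coef a (j + Suc k)))\<^sup>2)"
      using H2_summable[OF aH] by (subst summable_iff_shift)
    have a': "a' \<in> H2" "coef a' = (\<lambda>j. coef a (j + Suc k))" unfolding a'_def using of_coef_H2[OF sa'] by auto
    have asplit: "a = (\<lambda>z. taylor a (Suc k) z + z ^ Suc k * a' z)"
    proof (rule hol_disc_eq_if_coef_eq[OF ah])
      show "(\<lambda>z. taylor a (Suc k) z + z ^ Suc k * a' z) \<in> hol_disc"
        by (intro add_hol_disc H2_hol_disc taylor_H2 shift_H2 a')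
      show "coef a = coef (\<lambda>z. taylor a (Suc k) z + z ^ Suc k * a' z)"
        by (subst coef_add) (auto simp: H2_hol_disc taylor_H2 shift_H2 a' coef_taylor coef_shift fun_eq_iff simp del: power_Suc)
    qed
    have bk: "(\<lambda>z. z ^ k * b z) \<in> H2" by (rule shift_H2[OF bH])
    have eq: "coef (\<lambda>z. a z * toep b (u n) z) k = H2ip (\<lambda>z. a z * u n z) (\<lambda>z. z ^ k * b z) - cnj (H2ip (W n) a')" for n
    proof -
      have tu: "(\<lambda>z. u n z * taylor a (Suc k) z) \<in> H2" "(\<lambda>z. u n z * a' z) \<in> H2"
        by (rule Hinf_mult_H2[OF uInf taylor_H2], rule Hinf_mult_H2[OF uInf a'(1)])
      have "(\<lambda>z. a z * u n z) = (\<lambda>z. u n z * taylor a (Suc k) z + z ^ k * (z ^ 1 * (u n z * a' z)))"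
        by (subst asplit) (simp add: fun_eq_iff algebra_simps)
      then have "H2ip (\<lambda>z. a z * u n z) (\<lambda>z. z ^ k * b z)
          = H2ip (\<lambda>z. u n z * taylor a (Suc k) z) (\<lambda>z. z ^ k * b z)
            + H2ip (\<lambda>z. z ^ k * (z ^ 1 * (u n z * a' z))) (\<lambda>z. z ^ k * b z)"
        by (simp only: H2.ip_add_left[OF tu(1) shift_H2[OF shift_H2[OF tu(2)]] bk])
      also have "H2ip (\<lambda>z. z ^ k * (z ^ 1 * (u n z * a' z))) (\<lambda>z. z ^ k * b z) = H2ip (\<lambda>z. z ^ 1 * (u n z * a' z)) b"
        by (rule H2ip_shift[OF shift_H2[OF tu(2)] bH])
      also have "\<dots> = cnj (H2ip (W n) a')"
        using Wip[OF a'(1), of n] H2.ip_commute[OF shift_H2[OF tu(2), of 1] bH] by (simp add: mult.assoc)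
      also have "H2ip (\<lambda>z. u n z * taylor a (Suc k) z) (\<lambda>z. z ^ k * b z) = coef (\<lambda>z. a z * toep b (u n) z) k"
      proof -
        have tm: "H2ip (\<lambda>z. z ^ i * u n z) (\<lambda>z. z ^ k * b z) = coef (toep b (u n)) (k - i)" if "i \<le> k" for i
        proof -
          have "(\<lambda>z. z ^ k * b z) = (\<lambda>z. z ^ i * (z ^ (k - i) * b z))"
            using that by (simp add: mult.assoc[symmetric] power_add[symmetric])
          then have "H2ip (\<lambda>z. z ^ i * u n z) (\<lambda>z. z ^ k * b z) = H2ip (u n) (\<lambda>z. z ^ (k - i) * b z)"
            using H2ip_shift[OF uH shift_H2[OF bH], of i n "k - i"] by simp
          also have "(\<lambda>z. z ^ (k - i) * b z) = (\<lambda>z. b z * zpow (k - i) z)"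
            using zpow_mult_hol_disc[OF bh, of "k - i"] by (simp only: mult.commute[of "b _"])
          finally show ?thesis by (simp only: coef_toep[OF b_Hinf uH])
        qed
        have "H2ip (\<lambda>z. u n z * taylor a J z) (\<lambda>z. z ^ k * b z) = (\<Sum>i<J. coef a i * coef (toep b (u n)) (k - i))"
          if "J \<le> Suc k" for J
          using that
        proof (induction J)
          case 0
          then show ?case using H2.ip_zero_left[OF bk] by (simp add: taylor_0)
        next
          case (Suc J)
          have "(\<lambda>z. u n z * taylor a (Suc J) z) = (\<lambda>z. u n z * taylor a J z + coef a J * (z ^ J * u n z))"
            using zpow_mult_hol_disc[OF H2_hol_disc[OF uH[of n]], of J] by (auto simp: taylor_Suc fun_eq_iff algebra_simps)
          then have "H2ip (\<lambda>z. u n z * taylor a (Suc J) z) (\<lambda>z. z ^ k * b z)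
              = H2ip (\<lambda>z. u n z * taylor a J z) (\<lambda>z. z ^ k * b z) + coef a J * H2ip (\<lambda>z. z ^ J * u n z) (\<lambda>z. z ^ k * b z)"
            using bk uH Hinf_mult_H2[OF uInf taylor_H2] by (simp add: H2.ip_add_left H2.ip_scale_left H2.scale_mem shift_H2)
          then show ?case using Suc tm[of J] by simp
        qed
        from this[of "Suc k"] show ?thesis
          by (simp add: coef_mult ah H2_hol_disc TH lessThan_Suc_atMost)
      qed
      finally show ?thesis by simp
    qed
    have "(\<lambda>n. H2ip (\<lambda>z. a z * u n z) (\<lambda>z. z ^ k * b z) - cnj (H2ip (W n) a')) \<longlonglongrightarrow> 0 - cnj 0"
      by (intro tendsto_diff tendsto_cnj weak'[OF bk] Wweak[OF a'(1)])
    then show ?thesis by (simp add: eq)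
  qed
  have "coef (\<lambda>z. a z * f z) k = 0" for k
  proof -
    have afH: "(\<lambda>z. a z * f z) \<in> H2" by (rule Hinf_mult_H2[OF a_Hinf f2])
    have KuH2: "K (u n) \<in> H2" for n by (rule K_H2[OF uH])
    have lim2: "(\<lambda>n. H2norm (\<lambda>z. K (u n) z - f z)) \<longlonglongrightarrow> 0"
    proof (rule Lim_null_comparison[OF _ lim])
      show "\<forall>\<^sub>F n in sequentially. norm (H2norm (\<lambda>z. K (u n) z - f z)) \<le> nrm (\<lambda>z. K (u n) z - f z)"
        using mem_H2(2)[OF diff_mem[OF KuH f]] H2.nrm_nonneg[OF H2.diff_mem[OF KuH2 f2]] by simp
    qed
    have "(\<lambda>n. H2ip (\<lambda>z. a z * K (u n) z) (zpow k)) \<longlonglongrightarrow> H2ip (\<lambda>z. a z * f z) (zpow k)"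
      by (rule H2.tendsto_ip_left[OF Hinf_mult_H2[OF a_Hinf KuH2] afH zpow_H2 Hinf_mult_tendsto[OF a_Hinf KuH2 f2 lim2]])
    moreover have "H2ip (\<lambda>z. a z * K (u n) z) (zpow k)
        = H2ip (\<lambda>z. a z * u n z) (zpow k) - (\<Sum>i\<le>k. coef b i * coef (\<lambda>z. a z * toep b (u n) z) (k - i))" for n
    proof -
      have aTH: "(\<lambda>z. a z * toep b (u n) z) \<in> H2" by (rule Hinf_mult_H2[OF a_Hinf TH])
      have baT: "(\<lambda>z. b z * (a z * toep b (u n) z)) \<in> H2" by (rule Hinf_mult_H2[OF b_Hinf aTH])
      have "(\<lambda>z. a z * K (u n) z) = (\<lambda>z. a z * u n z - b z * (a z * toep b (u n) z))"
        by (simp add: K_def fun_eq_iff algebra_simps)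
      then have "H2ip (\<lambda>z. a z * K (u n) z) (zpow k)
          = H2ip (\<lambda>z. a z * u n z) (zpow k) - H2ip (\<lambda>z. b z * (a z * toep b (u n) z)) (zpow k)"
        by (simp only: H2.ip_diff_left[OF auH baT zpow_H2])
      also have "H2ip (\<lambda>z. b z * (a z * toep b (u n) z)) (zpow k) = (\<Sum>i\<le>k. coef b i * coef (\<lambda>z. a z * toep b (u n) z) (k - i))"
        by (simp add: H2ip_zpow[OF baT] coef_mult[OF bh H2_hol_disc[OF aTH]])
      finally show ?thesis .
    qed
    moreover have "(\<lambda>n. H2ip (\<lambda>z. a z * u n z) (zpow k) - (\<Sum>i\<le>k. coef b i * coef (\<lambda>z. a z * toep b (u n) z) (k - i)))
        \<longlonglongrightarrow> 0 - (\<Sum>i\<le>k. coef b i * 0)"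
      by (intro tendsto_diff tendsto_sum tendsto_mult_left weak'[OF zpow_H2] aT)
    ultimately have "H2ip (\<lambda>z. a z * f z) (zpow k) = 0" using LIMSEQ_unique by fastforce
    then show ?thesis by (simp add: H2ip_zpow[OF afH])
  qed
  then have "(\<lambda>z. a z * f z) = (\<lambda>z. 0)"
    by (intro hol_disc_eq_if_coef_eq mult_hol_disc ah H2_hol_disc[OF f2] zero_hol_disc) (simp add: coef_zero fun_eq_iff)
  then have prod: "a z * f z = 0" for z by (rule fun_cong)
  obtain z0 where z0: "cmod z0 < 1" "a z0 \<noteq> 0" using a_nonzero by blast
  have "open {z \<in> ball 0 1. a z \<noteq> 0}"
  proof -
    have "open (ball 0 1 \<inter> a -` (- {0}))"
      by (rule continuous_open_preimage[OF holomorphic_on_imp_continuous_on[OF hol_disc_holomorphic[OF ah]]]) auto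
    moreover have "ball 0 1 \<inter> a -` (- {0}) = {z \<in> ball 0 1. a z \<noteq> 0}" by auto
    ultimately show ?thesis by simp
  qed
  show ?thesis
  proof (rule hol_disc_eqI[OF in_hol_disc[OF f] zero_hol_disc])
    fix z :: complex assume z: "cmod z < 1"
    show "f z = 0"
      by (rule analytic_continuation_open[OF \<open>open {z \<in> ball 0 1. a z \<noteq> 0}\<close> open_ball[of 0 1], where f = f and g = "\<lambda>_. 0"])
         (use z z0 prod in \<open>auto intro: hol_disc_holomorphic[OF in_hol_disc[OF f]]\<close>)
  qed
qed

end

section \<open>Hypercyclicity\<close>

lemma hol_disc_zero_if_zero_on_open:
  assumes f: "f \<in> hol_disc" and U: "open U" "U \<noteq> {}" "U \<subseteq> ball 0 1" and z: "\<And>z. z \<in> U \<Longrightarrow> f z = 0"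
  shows "f = (\<lambda>z. 0)"
proof (rule hol_disc_eqI[OF f zero_hol_disc])
  fix w :: complex assume "cmod w < 1"
  then show "f w = 0"
    by (intro analytic_continuation_open[OF U(1) open_ball[of 0 1] U(2) connected_ball U(3) hol_disc_holomorphic[OF f]
        holomorphic_on_const z]) auto
qed

text \<open>
  With \<open>b = (1 - t) f + t g\<close> and \<open>s = min t (1 - t)\<close>, both \<open>b + s (g - f)\<close> and \<open>b - s (g - f)\<close> are convex
  combinations of \<open>f\<close> and \<open>g\<close>, hence bounded by \<open>1\<close>; add the squares of their moduli.
\<close>

lemma not_extreme_imp_column:
  assumes b: "b \<in> Hinf_ball" and ne: "\<not> extreme_function_of b Hinf_ball"
  obtains h where "h \<in> Hinf" "h \<noteq> (\<lambda>z. 0)" "\<And>z. cmod z < 1 \<Longrightarrow> (cmod (b z))\<^sup>2 + (cmod (h z))\<^sup>2 \<le> 1"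
proof -
  obtain f g t where fg: "f \<in> Hinf_ball" "g \<in> Hinf_ball" "f \<noteq> g" and t: "0 < t" "t < 1"
    and bt: "b = (\<lambda>z. of_real (1 - t) * f z + of_real t * g z)"
    using b ne unfolding extreme_function_of_def by blast
  have le1: "cmod (f z) \<le> 1" if "f \<in> Hinf_ball" "cmod z < 1" for f z
  proof -
    have "f \<in> Hinf" "Hinf_norm f \<le> 1" using that by (auto simp: Hinf_ball_def)
    then obtain c where "\<And>z. cmod z < 1 \<Longrightarrow> cmod (f z) \<le> c" using Hinf_bound by blast
    then have "bdd_above ((\<lambda>z. cmod (f z)) ` ball 0 1)" by (intro bdd_aboveI2[where M = c]) simp
    then have "cmod (f z) \<le> Hinf_norm f"
      unfolding Hinf_norm_def using that(2) by (intro cSUP_upper) auto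
    then show ?thesis using \<open>Hinf_norm f \<le> 1\<close> by simp
  qed
  define s where "s = min t (1 - t)"
  have s: "0 < s" "s \<le> t" "s \<le> 1 - t" using t by (auto simp: s_def)
  define h where "h z = of_real s * (g z - f z)" for z
  have conv: "cmod (of_real (1 - r) * f z + of_real r * g z) \<le> 1" if "0 \<le> r" "r \<le> 1" "cmod z < 1" for r z
  proof -
    have "cmod (of_real (1 - r) * f z + of_real r * g z) \<le> (1 - r) * cmod (f z) + r * cmod (g z)"
      using norm_triangle_ineq[of "of_real (1 - r) * f z" "of_real r * g z"] that by (simp add: norm_mult del: of_real_diff)
    also have "\<dots> \<le> (1 - r) * 1 + r * 1"
      using le1[OF fg(1) that(3)] le1[OF fg(2) that(3)] that by (intro add_mono mult_left_mono) auto
    finally show ?thesis by simp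
  qed
  show thesis
  proof (rule that)
    have fgh: "f \<in> hol_disc" "g \<in> hol_disc" using fg by (auto simp: Hinf_ball_def Hinf_def)
    show "h \<in> Hinf"
    proof (rule HinfI)
      show "h \<in> hol_disc" unfolding h_def by (intro scale_hol_disc diff_hol_disc fgh)
      show "cmod (h z) \<le> s * 2" if "cmod z < 1" for z
        unfolding h_def norm_mult using s norm_triangle_ineq4[of "g z" "f z"] le1[OF fg(1) that] le1[OF fg(2) that]
        by (intro mult_mono) auto
    qed
    show "h \<noteq> (\<lambda>z. 0)"
    proof
      assume "h = (\<lambda>z. 0)"
      then have "h z = 0" for z by simp
      then have "f = g" using s by (auto simp: h_def fun_eq_iff)
      then show False using fg(3) by simp
    qed
    show "(cmod (b z))\<^sup>2 + (cmod (h z))\<^sup>2 \<le> 1" if z: "cmod z < 1" for z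
    proof -
      have p: "b z + h z = of_real (1 - (t + s)) * f z + of_real (t + s) * g z"
        and m: "b z - h z = of_real (1 - (t - s)) * f z + of_real (t - s) * g z"
        by (simp_all add: bt h_def algebra_simps)
      have "cmod (b z + h z) \<le> 1" "cmod (b z - h z) \<le> 1"
        unfolding p m using s t z by (intro conv; simp)+
      then have "(cmod (b z + h z))\<^sup>2 \<le> 1" "(cmod (b z - h z))\<^sup>2 \<le> 1" by (simp_all add: power_le_one)
      moreover have "(cmod (b z + h z))\<^sup>2 + (cmod (b z - h z))\<^sup>2 = 2 * ((cmod (b z))\<^sup>2 + (cmod (h z))\<^sup>2)"
        unfolding cmod_power2 by (simp add: power2_eq_square algebra_simps)
      ultimately show ?thesis by simp
    qed
  qed
qed

context dBR_outer
begin

lemma szego_mem: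
  assumes l: "cmod l < 1" "a l \<noteq> 0"
  shows "szego l \<in> H"
proof -
  have "(\<lambda>z. inverse (cnj (a l)) * toep a (szego l) z) \<in> H"
    by (intro scale_mem toep_a_mem szego_H2 l)
  then show ?thesis using l by (simp add: toep_szego[OF a_Hinf l(1)] flip: mult.assoc)
qed

text \<open>
  If \<open>f\<close> is orthogonal to the kernels over \<open>U\<close>, the vector of the Hardy space that represents
  \<open>g \<mapsto> \<langle>toep a g, f\<rangle>\<close> vanishes on \<open>U\<close>, hence everywhere. So \<open>f\<close> is orthogonal to the range of
  \<open>toep a\<close>.
\<close>

lemma szego_total:
  assumes U: "open U" "U \<noteq> {}" "U \<subseteq> ball 0 1" "\<And>l. l \<in> U \<Longrightarrow> a l \<noteq> 0"
    and f: "f \<in> H" and orth: "\<And>l. l \<in> U \<Longrightarrow> ip f (szego l) = 0"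
  shows "f = (\<lambda>z. 0)"
proof (rule toep_a_total[OF f])
  define G where "G = (\<lambda>g. (g, ip (toep a g) f)) ` H2"
  obtain q X where q: "q \<in> H2" "\<And>v d. (v, d) \<in> G \<Longrightarrow> H2ip v q = d" "H2norm q \<le> nrm f \<or> q = (\<lambda>z. 0)"
    and X: "\<And>n :: nat. \<exists>c. (X n, c) \<in> G" "(\<lambda>n. H2norm (\<lambda>z. X n z - q z)) \<longlonglongrightarrow> 0"
  proof (rule H2.Riesz_relation[of G "nrm f"])
    show "G \<noteq> {}" using H2.zero_mem by (auto simp: G_def)
    show "g \<in> H2" if "(g, c) \<in> G" for g c using that by (auto simp: G_def)
    show "cmod c \<le> nrm f * H2norm g" if "(g, c) \<in> G" for g c
    proof -
      have g: "g \<in> H2" "c = ip (toep a g) f" using that by (auto simp: G_def)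
      have "cmod c \<le> nrm (toep a g) * nrm f" unfolding g(2) by (rule Cauchy_Schwarz[OF toep_a_mem[OF g(1)] f])
      also have "\<dots> \<le> H2norm g * nrm f" by (rule mult_right_mono[OF toep_a_nrm_le[OF g(1)] nrm_nonneg[OF f]])
      finally show ?thesis by (simp add: mult.commute)
    qed
    show "(\<lambda>z. g z + c * h z, d + c * d') \<in> G" if gh: "(g, d) \<in> G" "(h, d') \<in> G" for g d h d' c
    proof -
      have g: "g \<in> H2" "d = ip (toep a g) f" and h: "h \<in> H2" "d' = ip (toep a h) f" using gh by (auto simp: G_def)
      have "toep a (\<lambda>z. g z + c * h z) = (\<lambda>z. toep a g z + c * toep a h z)"
        using toep_add[OF a_Hinf g(1) H2.scale_mem[OF h(1)], of c] toep_scale[OF a_Hinf h(1), of c] by simp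
      then have "ip (toep a (\<lambda>z. g z + c * h z)) f = d + c * d'"
        using f by (simp add: g h ip_add_left ip_scale_left scale_mem toep_a_mem)
      then show ?thesis
        unfolding G_def by (intro image_eqI[of _ _ "\<lambda>z. g z + c * h z"] H2.add_mem H2.scale_mem g h) simp_all
    qed
  qed (rule that)
  have rep: "H2ip g q = ip (toep a g) f" if "g \<in> H2" for g using q(2) that by (auto simp: G_def)
  have "q l = 0" if l: "l \<in> U" for l
  proof -
    have l1: "cmod l < 1" "a l \<noteq> 0" using U(3,4) l by auto
    have "cnj (q l) = H2ip (szego l) q"
      using H2ip_szego[OF l1(1) q(1)] H2.ip_commute[OF q(1) szego_H2[OF l1(1)]] by simp
    also have "\<dots> = cnj (a l) * ip (szego l) f"
      using rep[OF szego_H2[OF l1(1)]] szego_mem[OF l1] f by (simp add: toep_szego[OF a_Hinf l1(1)] ip_scale_left)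
    also have "\<dots> = 0" using orth[OF l] ip_commute[OF f szego_mem[OF l1]] by simp
    finally show ?thesis by simp
  qed
  then have "q = (\<lambda>z. 0)" by (rule hol_disc_zero_if_zero_on_open[OF H2_hol_disc[OF q(1)] U(1-3)])
  then show "ip (toep a g) f = 0" if "g \<in> H2" for g
    using rep[OF that] H2.ip_commute[OF H2.zero_mem that] H2.ip_zero_left[OF that] by simp
qed

lemma toeplitz_power_szego:
  assumes p: "\<phi> \<in> Hinf" and xs: "xs \<in> lists (UNIV \<times> {l \<in> ball 0 1. a l \<noteq> 0})"
  shows "(toeplitz_cnj \<phi> ^^ n) (lin_comb szego xs) = lin_comb szego (map (\<lambda>(c, l). (c * cnj (\<phi> l) ^ n, l)) xs)"
proof -
  note T = toeplitz_bounded[OF p]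
  have mem: "lin_comb szego xs \<in> H" if "xs \<in> lists (UNIV \<times> {l \<in> ball 0 1. a l \<noteq> 0})" for xs
    by (rule lin_comb_mem[OF _ that]) (auto intro: szego_mem)
  have one: "(toeplitz_cnj \<phi> ^^ n) (szego l) = (\<lambda>z. cnj (\<phi> l) ^ n * szego l z)" if l: "cmod l < 1" "a l \<noteq> 0" for l n
  proof (induction n)
    case (Suc n)
    have "toeplitz_cnj \<phi> (szego l) = (\<lambda>z. cnj (\<phi> l) * szego l z)"
      using toeplitz_eq[OF p szego_mem[OF l]] toep_szego[OF p l(1)] by simp
    moreover have "toeplitz_cnj \<phi> (\<lambda>z. cnj (\<phi> l) ^ n * szego l z) = (\<lambda>z. cnj (\<phi> l) ^ n * toeplitz_cnj \<phi> (szego l) z)"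
      using power_op(3)[OF T szego_mem[OF l], of 1 "cnj (\<phi> l) ^ n"] by simp
    ultimately show ?case by (simp add: Suc mult_ac)
  qed simp
  show ?thesis
    using xs
  proof (induction xs rule: list.induct)
    case Nil
    show ?case using power_op(3)[OF T zero_mem, of n 0] by (simp add: lin_comb_Nil)
  next
    case (Cons x xs)
    obtain c l where x: "x = (c, l)" by (cases x)
    have l: "cmod l < 1" "a l \<noteq> 0" and xs: "xs \<in> lists (UNIV \<times> {l \<in> ball 0 1. a l \<noteq> 0})"
      using Cons.prems by (auto simp: x)
    have "(toeplitz_cnj \<phi> ^^ n) (\<lambda>z. c * szego l z + lin_comb szego xs z)
        = (\<lambda>z. c * (cnj (\<phi> l) ^ n * szego l z) + (toeplitz_cnj \<phi> ^^ n) (lin_comb szego xs) z)"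
      using power_op(2)[OF T scale_mem[OF szego_mem[OF l]] mem[OF xs], of n c]
        power_op(3)[OF T szego_mem[OF l], of n c] one[OF l, of n] by simp
    then show ?case by (simp add: x lin_comb_Cons Cons.IH[OF xs] mult.assoc)
  qed
qed

lemma szego_geometric_tendsto:
  assumes xs: "xs \<in> lists (UNIV \<times> {l \<in> ball 0 1. a l \<noteq> 0 \<and> cmod (w l) < 1})"
  shows "(\<lambda>n. nrm (lin_comb szego (map (\<lambda>(c, l). (c * w l ^ n, l)) xs))) \<longlonglongrightarrow> 0"
  using xs
proof (induction xs rule: list.induct)
  case Nil
  show ?case by (simp add: lin_comb_Nil)
next
  case (Cons x xs)
  obtain c l where x: "x = (c, l)" by (cases x)
  have l: "cmod l < 1" "a l \<noteq> 0" "cmod (w l) < 1" and xs: "xs \<in> lists (UNIV \<times> {l \<in> ball 0 1. a l \<noteq> 0 \<and> cmod (w l) < 1})"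
    using Cons.prems by (auto simp: x)
  let ?r = "\<lambda>n. lin_comb szego (map (\<lambda>(c, l). (c * w l ^ n, l)) xs)"
  have rm: "?r n \<in> H" for n
  proof (rule lin_comb_mem[of "{l \<in> ball 0 1. a l \<noteq> 0}"])
    show "map (\<lambda>(c, l). (c * w l ^ n, l)) xs \<in> lists (UNIV \<times> {l \<in> ball 0 1. a l \<noteq> 0})"
      using xs by (auto simp: in_lists_conv_set)
  qed (auto intro: szego_mem)
  have s: "szego l \<in> H" by (rule szego_mem[OF l(1,2)])
  have e: "lin_comb szego (map (\<lambda>(c, l). (c * w l ^ n, l)) (x # xs)) = (\<lambda>z. (c * w l ^ n) * szego l z + ?r n z)" for n
    by (simp add: x lin_comb_Cons)
  show ?case
  proof (rule Lim_null_comparison)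
    have "nrm (\<lambda>z. (c * w l ^ n) * szego l z + ?r n z) \<le> cmod c * nrm (szego l) * cmod (w l) ^ n + nrm (?r n)" for n
      using nrm_triangle[OF scale_mem[OF s, of "c * w l ^ n"] rm[of n]] nrm_scale[OF s, of "c * w l ^ n"]
      by (simp add: norm_mult norm_power mult_ac)
    then show "\<forall>\<^sub>F n in sequentially. norm (nrm (lin_comb szego (map (\<lambda>(c, l). (c * w l ^ n, l)) (x # xs))))
        \<le> cmod c * nrm (szego l) * cmod (w l) ^ n + nrm (?r n)"
      unfolding e using nrm_nonneg[OF add_mem[OF scale_mem[OF s] rm]] by simp
    have "(\<lambda>n. cmod c * nrm (szego l) * cmod (w l) ^ n + nrm (?r n)) \<longlonglongrightarrow> cmod c * nrm (szego l) * 0 + 0"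
      using l(3) by (intro tendsto_add tendsto_mult_left LIMSEQ_power_zero Cons.IH[OF xs]) simp
    then show "(\<lambda>n. cmod c * nrm (szego l) * cmod (w l) ^ n + nrm (?r n)) \<longlonglongrightarrow> 0" by simp
  qed
qed

text \<open>
  Removing the zeros of \<open>a\<close> from an open set leaves an open set, nonempty by the identity theorem.
\<close>

lemma open_nonvanishing:
  assumes p: "\<phi> \<in> Hinf" and S: "open S" and l0: "cmod l0 < 1" "\<phi> l0 \<in> S"
  shows "open {l \<in> ball 0 1. a l \<noteq> 0 \<and> \<phi> l \<in> S}" "{l \<in> ball 0 1. a l \<noteq> 0 \<and> \<phi> l \<in> S} \<noteq> {}"
proof -
  have op: "open (ball 0 1 \<inter> f -` A)" if "f \<in> hol_disc" "open A" for f A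
    by (rule continuous_open_preimage[OF holomorphic_on_imp_continuous_on[OF hol_disc_holomorphic[OF that(1)]] _ that(2)]) simp
  have ah: "a \<in> hol_disc" by (rule Hinf_hol_disc[OF a_Hinf])
  have ph: "\<phi> \<in> hol_disc" by (rule Hinf_hol_disc[OF p])
  have "open ((ball 0 1 \<inter> a -` (- {0})) \<inter> (ball 0 1 \<inter> \<phi> -` S))"
    by (intro open_Int op ah ph S) auto
  moreover have "(ball 0 1 \<inter> a -` (- {0})) \<inter> (ball 0 1 \<inter> \<phi> -` S) = {l \<in> ball 0 1. a l \<noteq> 0 \<and> \<phi> l \<in> S}" by auto
  ultimately show "open {l \<in> ball 0 1. a l \<noteq> 0 \<and> \<phi> l \<in> S}" by simp
  show "{l \<in> ball 0 1. a l \<noteq> 0 \<and> \<phi> l \<in> S} \<noteq> {}"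
  proof
    assume "{l \<in> ball 0 1. a l \<noteq> 0 \<and> \<phi> l \<in> S} = {}"
    then have "a z = 0" if "z \<in> ball 0 1 \<inter> \<phi> -` S" for z using that by auto
    then have "a = (\<lambda>z. 0)"
      by (rule hol_disc_zero_if_zero_on_open[OF ah op[OF ph S], rotated 2]) (use l0 in auto)
    then show False using a_nonzero by simp
  qed
qed

lemma separable:
  obtains Q where "countable Q" "Q \<subseteq> H" "\<And>f \<epsilon>. f \<in> H \<Longrightarrow> \<epsilon> > 0 \<Longrightarrow> \<exists>q\<in>Q. nrm (\<lambda>z. q z - f z) < \<epsilon>"
proof (rule separable_if_total[of UNIV "\<lambda>n. K (zpow n)"])
  show "K (zpow n) \<in> H" for n by (rule K_mem[OF zpow_H2])
  show "f = (\<lambda>z. 0)" if f: "f \<in> H" and orth: "\<And>n. n \<in> UNIV \<Longrightarrow> ip f (K (zpow n)) = 0" for f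
  proof (rule hol_disc_eq_if_coef_eq[OF in_hol_disc[OF f] zero_hol_disc])
    show "coef f = coef (\<lambda>z. 0)"
      using orth by (simp add: ip_K[OF zpow_H2 f] H2ip_zpow[OF mem_H2(1)[OF f]] coef_zero fun_eq_iff)
  qed
qed (auto intro: that)

lemma hypercyclic_if_meets_both_sides:
  assumes p: "\<phi> \<in> Hinf" and l1: "cmod l1 < 1" "cmod (\<phi> l1) < 1" and l2: "cmod l2 < 1" "1 < cmod (\<phi> l2)"
  shows "hypercyclic_on H nrm (toeplitz_cnj \<phi>)"
proof -
  obtain Q where Q: "countable Q" "Q \<subseteq> H" "\<And>f \<epsilon>. f \<in> H \<Longrightarrow> \<epsilon> > 0 \<Longrightarrow> \<exists>q\<in>Q. nrm (\<lambda>z. q z - f z) < \<epsilon>"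
    by (rule separable) (rule that)
  define U where "U S = {l \<in> ball 0 1. a l \<noteq> 0 \<and> \<phi> l \<in> S}" for S
  have dense: "\<exists>xs\<in>lists (UNIV \<times> U S). nrm (\<lambda>z. lin_comb szego xs z - f z) < \<epsilon>"
    if S: "open S" "cmod l < 1" "\<phi> l \<in> S" and f: "f \<in> H" "\<epsilon> > 0" for S l f \<epsilon>
  proof (rule lin_comb_dense_if_total[OF _ _ f])
    show "szego l \<in> H" if "l \<in> U S" for l using that by (auto simp: U_def intro: szego_mem)
    show "h = (\<lambda>z. 0)" if h: "h \<in> H" "\<And>l. l \<in> U S \<Longrightarrow> ip h (szego l) = 0" for h
      by (rule szego_total[OF open_nonvanishing[OF p S] _ _ h(1)]) (use h(2) in \<open>simp_all add: U_def subset_iff\<close>)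
  qed
  have lists_a: "xs \<in> lists (UNIV \<times> {l \<in> ball 0 1. a l \<noteq> 0})" if "xs \<in> lists (UNIV \<times> U S)" for xs :: "(complex \<times> complex) list" and S
    using that by (auto simp: U_def in_lists_conv_set)
  have mem: "lin_comb szego xs \<in> H" if "xs \<in> lists (UNIV \<times> {l \<in> ball 0 1. a l \<noteq> 0})" for xs
    by (rule lin_comb_mem[OF _ that]) (auto intro: szego_mem)
  show ?thesis
  proof (rule hypercyclicity_criterion[OF toeplitz_bounded[OF p] Q])
    fix f and \<epsilon> :: real assume f: "f \<in> H" "\<epsilon> > 0"
    have "\<exists>xs\<in>lists (UNIV \<times> U (ball 0 1)). nrm (\<lambda>z. lin_comb szego xs z - f z) < \<epsilon>"
      by (rule dense[OF open_ball l1(1) _ f]) (use l1(2) in simp)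
    then obtain xs where xs: "xs \<in> lists (UNIV \<times> U (ball 0 1))" "nrm (\<lambda>z. lin_comb szego xs z - f z) < \<epsilon>" ..
    have "(\<lambda>n. nrm ((toeplitz_cnj \<phi> ^^ n) (lin_comb szego xs))) \<longlonglongrightarrow> 0"
      unfolding toeplitz_power_szego[OF p lists_a[OF xs(1)]]
      by (rule szego_geometric_tendsto) (use xs(1) in \<open>auto simp: U_def in_lists_conv_set\<close>)
    then show "\<exists>x\<in>H. nrm (\<lambda>z. x z - f z) < \<epsilon> \<and> (\<lambda>n. nrm ((toeplitz_cnj \<phi> ^^ n) x)) \<longlonglongrightarrow> 0"
      using xs(2) mem[OF lists_a[OF xs(1)]] by (intro bexI[of _ "lin_comb szego xs"] conjI)
  next
    fix f and \<epsilon> :: real assume f: "f \<in> H" "\<epsilon> > 0"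
    have "\<exists>xs\<in>lists (UNIV \<times> U (- cball 0 1)). nrm (\<lambda>z. lin_comb szego xs z - f z) < \<epsilon>"
      by (rule dense[OF _ l2(1) _ f]) (use l2(2) in \<open>simp_all add: open_Compl\<close>)
    then obtain xs where xs: "xs \<in> lists (UNIV \<times> U (- cball 0 1))" "nrm (\<lambda>z. lin_comb szego xs z - f z) < \<epsilon>" ..
    define Y where "Y n = lin_comb szego (map (\<lambda>(c, l). (c * inverse (cnj (\<phi> l)) ^ n, l)) xs)" for n
    have Yl: "map (\<lambda>(c, l). (c * inverse (cnj (\<phi> l)) ^ n, l)) xs \<in> lists (UNIV \<times> {l \<in> ball 0 1. a l \<noteq> 0})" for n
      using xs(1) by (auto simp: U_def in_lists_conv_set)
    have YH: "Y n \<in> H" for n unfolding Y_def by (rule mem[OF Yl])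
    have map_inverse: "map (\<lambda>(c, l). (c * cnj (\<phi> l) ^ n, l)) (map (\<lambda>(c, l). (c * inverse (cnj (\<phi> l)) ^ n, l)) xs) = xs" for n
      unfolding map_map
    proof (rule map_idI)
      fix x assume x: "x \<in> set xs"
      obtain c l where cl: "x = (c, l)" by (cases x)
      have "l \<in> U (- cball 0 1)" using xs(1) x by (auto simp: in_lists_conv_set cl)
      then have "cnj (\<phi> l) \<noteq> 0" by (auto simp: U_def)
      then have "inverse (cnj (\<phi> l)) ^ n * cnj (\<phi> l) ^ n = 1" by (simp add: power_mult_distrib[symmetric] del: complex_cnj_zero_iff)
      then show "((\<lambda>(c, l). (c * cnj (\<phi> l) ^ n, l)) \<circ> (\<lambda>(c, l). (c * inverse (cnj (\<phi> l)) ^ n, l))) x = x"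
        by (simp add: cl mult.assoc)
    qed
    have TY: "(toeplitz_cnj \<phi> ^^ n) (Y n) = lin_comb szego xs" for n
      unfolding Y_def toeplitz_power_szego[OF p Yl] map_inverse ..
    have Y0: "(\<lambda>n. nrm (Y n)) \<longlonglongrightarrow> 0"
      unfolding Y_def
      by (rule szego_geometric_tendsto)
         (use xs(1) in \<open>auto simp: U_def in_lists_conv_set norm_inverse intro!: inverse_less_1_iff[THEN iffD2]\<close>)
    have "\<exists>Y. (\<forall>n. Y n \<in> H \<and> (toeplitz_cnj \<phi> ^^ n) (Y n) = lin_comb szego xs) \<and> (\<lambda>n. nrm (Y n)) \<longlonglongrightarrow> 0"
      by (intro exI[of _ Y] conjI allI YH TY Y0)
    then show "\<exists>y\<in>H. nrm (\<lambda>z. y z - f z) < \<epsilon> \<and>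
        (\<exists>Y. (\<forall>n. Y n \<in> H \<and> (toeplitz_cnj \<phi> ^^ n) (Y n) = y) \<and> (\<lambda>n. nrm (Y n)) \<longlonglongrightarrow> 0)"
      by (intro bexI[of _ "lin_comb szego xs"] conjI xs(2) mem[OF lists_a[OF xs(1)]])
  qed
qed

lemma nonzero_vector: "\<exists>y\<in>H. 0 < nrm y"
proof -
  obtain l where l: "cmod l < 1" "a l \<noteq> 0" using a_nonzero by blast
  have "szego l 0 = 1" using szego_eq[OF l(1), of 0] by simp
  then have "szego l \<noteq> (\<lambda>z. 0)" by (metis zero_neq_one)
  then have "nrm (szego l) \<noteq> 0" using nrm_eq_0[OF szego_mem[OF l]] by blast
  then show ?thesis using szego_mem[OF l] nrm_nonneg[OF szego_mem[OF l]] by (intro bexI[of _ "szego l"]) auto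
qed

lemma not_hypercyclic_if_contraction:
  assumes p: "\<phi> \<in> Hinf" and le: "\<And>z. cmod z < 1 \<Longrightarrow> cmod (\<phi> z) \<le> 1"
  shows "\<not> hypercyclic_on H nrm (toeplitz_cnj \<phi>)"
proof
  assume "hypercyclic_on H nrm (toeplitz_cnj \<phi>)"
  then obtain x where x: "x \<in> H" "\<And>y e. y \<in> H \<Longrightarrow> e > 0 \<Longrightarrow> \<exists>n. nrm (\<lambda>z. (toeplitz_cnj \<phi> ^^ n) x z - y z) < e"
    unfolding hypercyclic_on_def by blast
  note T = toeplitz_bounded[OF p]
  have Tx: "(toeplitz_cnj \<phi> ^^ n) x \<in> H" for n by (rule power_op(1)[OF T x(1)])
  have b: "nrm ((toeplitz_cnj \<phi> ^^ n) x) \<le> nrm x" for n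
  proof (induction n)
    case (Suc n)
    have "nrm ((toeplitz_cnj \<phi> ^^ Suc n) x) \<le> 1 * nrm ((toeplitz_cnj \<phi> ^^ n) x)"
      using toep_nrm_le[OF p le Tx[of n]] toeplitz_eq[OF p Tx[of n]] by simp
    then show ?case using Suc by simp
  qed simp
  obtain y0 where y0: "y0 \<in> H" "0 < nrm y0" using nonzero_vector by blast
  define y where "y = (\<lambda>z. of_real ((nrm x + 1) / nrm y0) * y0 z)"
  have y: "y \<in> H" unfolding y_def by (rule scale_mem[OF y0(1)])
  have ny: "nrm y = nrm x + 1"
    unfolding y_def nrm_scale[OF y0(1)] norm_of_real using y0(2) nrm_nonneg[OF x(1)] by (simp add: abs_of_nonneg)
  obtain n where n: "nrm (\<lambda>z. (toeplitz_cnj \<phi> ^^ n) x z - y z) < 1" using x(2)[OF y zero_less_one] by blast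
  have "nrm y \<le> nrm ((toeplitz_cnj \<phi> ^^ n) x) + nrm (\<lambda>z. y z - (toeplitz_cnj \<phi> ^^ n) x z)"
    by (rule nrm_le_add_diff[OF y Tx])
  then show False using n b[of n] ny nrm_minus_commute[OF y Tx[of n]] by simp
qed

text \<open>
  The operator with symbol \<open>1 / \<phi>\<close> is a contraction and inverts the given one, so no orbit of a nonzero
  vector approaches \<open>0\<close>.
\<close>

lemma not_hypercyclic_if_expansion:
  assumes p: "\<phi> \<in> Hinf" and ge: "\<And>z. cmod z < 1 \<Longrightarrow> 1 \<le> cmod (\<phi> z)"
  shows "\<not> hypercyclic_on H nrm (toeplitz_cnj \<phi>)"
proof
  assume "hypercyclic_on H nrm (toeplitz_cnj \<phi>)"
  then obtain x where x: "x \<in> H" "\<And>y e. y \<in> H \<Longrightarrow> e > 0 \<Longrightarrow> \<exists>n. nrm (\<lambda>z. (toeplitz_cnj \<phi> ^^ n) x z - y z) < e"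
    unfolding hypercyclic_on_def by blast
  note T = toeplitz_bounded[OF p]
  have Tx: "(toeplitz_cnj \<phi> ^^ n) x \<in> H" for n by (rule power_op(1)[OF T x(1)])
  have nz: "\<phi> z \<noteq> 0" if "cmod z < 1" for z using ge[OF that] by auto
  define \<psi> where "\<psi> z = (if cmod z < 1 then inverse (\<phi> z) else 0)" for z
  have ps1: "cmod (\<psi> z) \<le> 1" if "cmod z < 1" for z
    using ge[OF that] by (simp add: \<psi>_def norm_inverse inverse_le_1_iff that)
  have ps: "\<psi> \<in> Hinf"
  proof (rule HinfI[OF hol_discI ps1])
    show "\<psi> holomorphic_on ball 0 1"
      by (rule holomorphic_transform[of "\<lambda>z. inverse (\<phi> z)"])
         (use nz in \<open>auto intro!: holomorphic_intros hol_disc_holomorphic[OF Hinf_hol_disc[OF p]] simp: \<psi>_def\<close>)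
  qed (auto simp: \<psi>_def)
  have inv: "toep \<psi> (toep \<phi> f) = f" if f: "f \<in> H2" for f
  proof -
    have "(\<lambda>z. \<phi> z * \<psi> z) = zpow 0" using nz by (auto simp: \<psi>_def zpow_def fun_eq_iff)
    then have e: "toep \<psi> (toep \<phi> f) = toep (zpow 0) f" using toep_toep[OF ps p f] by simp
    show ?thesis unfolding e
    proof (rule H2_eqI[OF toep_H2[OF zpow_Hinf f] f])
      fix u assume u: "u \<in> H2"
      have "(\<lambda>z. zpow 0 z * u z) = u" 
        by (rule ext) (simp only: zpow_mult_hol_disc[OF H2_hol_disc[OF u]] power_0 mult_1_left)
      then show "H2ip (toep (zpow 0) f) u = H2ip f u" using toep_adjoint[OF zpow_Hinf f u, of 0] by simp
    qed
  qed
  have exp: "nrm f \<le> nrm (toeplitz_cnj \<phi> f)" if f: "f \<in> H" for f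
    using toep_nrm_le[OF ps ps1 toeplitz_mem[OF p f]] inv[OF mem_H2(1)[OF f]] toeplitz_eq[OF p f] by simp
  have b: "nrm x \<le> nrm ((toeplitz_cnj \<phi> ^^ n) x)" for n
  proof (induction n)
    case (Suc n)
    then show ?case using exp[OF Tx[of n]] by simp
  qed simp
  show False
  proof (cases "nrm x = 0")
    case True
    then have x0: "x = (\<lambda>z. 0)" using nrm_eq_0 x(1) by blast
    have T0: "(toeplitz_cnj \<phi> ^^ n) x = (\<lambda>z. 0)" for n
      using power_op(3)[OF T zero_mem, of n 0] by (simp add: x0)
    obtain y where y: "y \<in> H" "0 < nrm y" using nonzero_vector by blast
    obtain n where "nrm (\<lambda>z. (toeplitz_cnj \<phi> ^^ n) x z - y z) < nrm y" using x(2)[OF y] by blast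
    then show False using nrm_minus_commute[OF zero_mem y(1)] by (simp add: T0)
  next
    case False
    then have "0 < nrm x" using nrm_nonneg[OF x(1)] by simp
    then obtain n where "nrm (\<lambda>z. (toeplitz_cnj \<phi> ^^ n) x z - 0) < nrm x" using x(2)[OF zero_mem] by blast
    then show False using b[of n] by simp
  qed
qed

theorem hypercyclic_iff:
  assumes p: "\<phi> \<in> Hinf"
  shows "hypercyclic_on H nrm (toeplitz_cnj \<phi>) \<longleftrightarrow>
    \<not> \<phi> constant_on ball 0 1 \<and> \<phi> ` ball 0 1 \<inter> sphere 0 1 \<noteq> {}"
proof
  assume hyp: "hypercyclic_on H nrm (toeplitz_cnj \<phi>)"
  have "\<not> (\<forall>z. cmod z < 1 \<longrightarrow> cmod (\<phi> z) \<le> 1)"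
    using not_hypercyclic_if_contraction[OF p] hyp by auto
  then obtain z1 where z1: "cmod z1 < 1" "1 < cmod (\<phi> z1)" by (auto simp: not_le)
  have "\<not> (\<forall>z. cmod z < 1 \<longrightarrow> 1 \<le> cmod (\<phi> z))"
    using not_hypercyclic_if_expansion[OF p] hyp by auto
  then obtain z2 where z2: "cmod z2 < 1" "cmod (\<phi> z2) < 1" by (auto simp: not_le)
  have "\<not> \<phi> constant_on ball 0 1"
  proof
    assume "\<phi> constant_on ball 0 1"
    then obtain y where "\<forall>z\<in>ball 0 1. \<phi> z = y" unfolding constant_on_def by blast
    then have "\<phi> z1 = \<phi> z2" using z1 z2 by simp
    then show False using z1 z2 by simp
  qed
  moreover have "\<phi> ` ball 0 1 \<inter> sphere 0 1 \<noteq> {}"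
  proof -
    have "connected ((\<lambda>z. cmod (\<phi> z)) ` ball 0 1)"
      by (intro connected_continuous_image continuous_intros holomorphic_on_imp_continuous_on
          hol_disc_holomorphic Hinf_hol_disc p) auto
    then have "{cmod (\<phi> z2)..cmod (\<phi> z1)} \<subseteq> (\<lambda>z. cmod (\<phi> z)) ` ball 0 1"
      by (rule connected_contains_Icc) (use z1 z2 in auto)
    then have "1 \<in> (\<lambda>z. cmod (\<phi> z)) ` ball 0 1" using z1 z2 by (auto simp: subset_iff)
    then show ?thesis by auto
  qed
  ultimately show "\<not> \<phi> constant_on ball 0 1 \<and> \<phi> ` ball 0 1 \<inter> sphere 0 1 \<noteq> {}" by blast
next
  assume r: "\<not> \<phi> constant_on ball 0 1 \<and> \<phi> ` ball 0 1 \<inter> sphere 0 1 \<noteq> {}"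
  then obtain l where l: "cmod l < 1" "cmod (\<phi> l) = 1" by auto
  have "open (\<phi> ` ball 0 1)"
    by (rule open_mapping_thm[OF hol_disc_holomorphic[OF Hinf_hol_disc[OF p]]]) (use r in auto)
  then obtain e where e: "e > 0" "ball (\<phi> l) e \<subseteq> \<phi> ` ball 0 1"
    using l(1) openE[of "\<phi> ` ball 0 1" "\<phi> l"] by auto
  define d where "d = min (e / 2) (1 / 2)"
  have d: "0 < d" "d < e" "d < 1" using e by (auto simp: d_def)
  have in_ball: "of_real (1 + r) * \<phi> l \<in> \<phi> ` ball 0 1" if "\<bar>r\<bar> < e" for r
  proof -
    have "dist (\<phi> l) (of_real (1 + r) * \<phi> l) = cmod (of_real r * \<phi> l)"
      by (simp add: dist_norm distrib_right norm_minus_commute)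
    then show ?thesis using e(2) that l(2) by (auto simp: norm_mult)
  qed
  obtain l1 where l1: "cmod l1 < 1" "\<phi> l1 = of_real (1 + - d) * \<phi> l" using in_ball[of "- d"] d by auto
  obtain l2 where l2: "cmod l2 < 1" "\<phi> l2 = of_real (1 + d) * \<phi> l" using in_ball[of d] d by auto
  have "cmod (\<phi> l1) < 1" "1 < cmod (\<phi> l2)"
    unfolding l1(2) l2(2) norm_mult l(2) norm_of_real using d by auto
  then show "hypercyclic_on H nrm (toeplitz_cnj \<phi>)"
    by (rule hypercyclic_if_meets_both_sides[OF p l1(1) _ l2(1)])
qed

end

theorem theorem4p2:
  fixes b \<phi> :: "complex \<Rightarrow> complex"
    and Hb :: "(complex \<Rightarrow> complex) set"
    and ip :: "(complex \<Rightarrow> complex) \<Rightarrow> (complex \<Rightarrow> complex) \<Rightarrow> complex"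
  assumes "b \<in> Hinf_ball"
    and "\<not> extreme_function_of b Hinf_ball"
    and "de_Branges_Rovnyak_space b Hb ip"
    and "\<phi> \<in> Hinf"
  shows "hypercyclic_on Hb (ip_norm ip) (toeplitz_cnj \<phi>) \<longleftrightarrow>
           \<not> \<phi> constant_on ball 0 1 \<and> \<phi> ` ball 0 1 \<inter> sphere 0 1 \<noteq> {}"
proof -
  obtain h where h: "h \<in> Hinf" "h \<noteq> (\<lambda>z. 0)" "\<And>z. cmod z < 1 \<Longrightarrow> (cmod (b z))\<^sup>2 + (cmod (h z))\<^sup>2 \<le> 1"
    using not_extreme_imp_column[OF assms(1,2)] by blast
  have b: "b \<in> Hinf" using assms(1) by (simp add: Hinf_ball_def)
  have b1: "cmod (b z) \<le> 1" and h1: "cmod (h z) \<le> 1" if "cmod z < 1" for z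
  proof -
    have "(cmod (b z))\<^sup>2 \<le> 1\<^sup>2" "(cmod (h z))\<^sup>2 \<le> 1\<^sup>2"
      using h(3)[OF that] zero_le_power2[of "cmod (b z)"] zero_le_power2[of "cmod (h z)"]
      unfolding one_power2 by linarith+
    then show "cmod (b z) \<le> 1" "cmod (h z) \<le> 1" by (auto intro: power2_le_imp_le)
  qed
  obtain a ys where a: "a \<in> Hinf" "\<And>z. cmod z < 1 \<Longrightarrow> cmod (a z) \<le> 1"
    "\<And>u. u \<in> H2 \<Longrightarrow> H2norm (\<lambda>z. a z * u z) \<le> H2norm (\<lambda>z. h z * u z)"
    "(\<lambda>n. H2norm (\<lambda>z. a z * lin_comb zpow (ys n) z - zpow 0 z)) \<longlonglongrightarrow> 0"
    by (rule outer_part[OF h(1,2)]) (erule h1, rule that)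
  have am: "(H2norm (\<lambda>z. a z * u z))\<^sup>2 + (H2norm (toep b u))\<^sup>2 \<le> (H2norm u)\<^sup>2" if u: "u \<in> H2" for u
  proof -
    have "(H2norm (\<lambda>z. a z * u z))\<^sup>2 \<le> (H2norm (\<lambda>z. h z * u z))\<^sup>2"
      by (rule power_mono[OF a(3)[OF u] H2.nrm_nonneg[OF Hinf_mult_H2[OF a(1) u]]])
    moreover have "(H2norm (toep b u))\<^sup>2 \<le> (H2norm (\<lambda>z. b z * u z))\<^sup>2"
      by (rule power_mono[OF toep_norm_le[OF b u] H2.nrm_nonneg[OF toep_H2[OF b u]]])
    ultimately show ?thesis using H2_contractive_column[OF b h(1,3) u] by linarith
  qed
  interpret dBR_outer Hb ip b a ys
  proof
    show "analytic_hilbert_space Hb ip" "has_reproducing_kernel Hb ip (dBR_kernel b)"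
      using assms(3) by (simp_all only: de_Branges_Rovnyak_space_def)
  qed (fact b b1 a(1,4) am)+
  show ?thesis by (rule hypercyclic_iff[OF assms(4)])
qed

end
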